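(* Let $\mathcal{H}$ be an infinite dimensional complex Hilbert space and let $\pi\colon\mathcal{L}(\mathcal{H})\to\mathcal{C}(\mathcal{H})$ be the quotient map onto the Calkin algebra. The following statements hold. (i) $\pi(\mathscr{PBF}(\mathcal{H}))=\mathcal{C}(\mathcal{H})^{KD}$; equivalently, $\pi^{-1}(\mathcal{C}(\mathcal{H})^{KD})=\mathscr{PBF}(\mathcal{H})+\mathcal{K}(\mathcal{H})$. (ii) $\pi(\mathscr{BF}(\mathcal{H}))=\mathcal{C}(\mathcal{H})^{D}$; equivalently, $\pi^{-1}(\mathcal{C}(\mathcal{H})^{D})=\mathscr{BF}(\mathcal{H})+\mathcal{K}(\mathcal{H})$.
   Context: $\mathcal{L}(\mathcal{H})$ is the algebra of bounded linear operators on $\mathcal{H}$, $\mathcal{K}(\mathcal{H})$ the closed ideal of compact operators, $\mathcal{C}(\mathcal{H})=\mathcal{L}(\mathcal{H})/\mathcal{K}(\mathcal{H})$ the Calkin algebra. The Hilbert space is not assumed separable. An operator is Fredholm if it has closed range, finite-dimensional kernel and finite-dimensional cokernel (every operator on a finite-dimensional, possibly zero, space is Fredholm). $T\in\mathcal{L}(\mathcal{H})$ is B-Fredholm if there is $n\in\mathbb{N}$ such that the range $R(T^n)$ is closed and the restriction $T|_{R(T^n)}\in\mathcal{L}(R(T^n))$ is Fredholm; $\mathscr{BF}(\mathcal{H})$ is the set of B-Fredholm operators. $T\in\mathcal{L}(\mathcal{H})$ is pseudo B-Fredholm if there are two closed subspaces $M$ and $N$ of $\mathcal{H}$ (possibly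 zero), invariant for $T$, such that $\mathcal{H}=M\oplus N$ (not necessarily orthogonal), $T|_M$ is quasi-nilpotent and $T|_N$ is Fredholm; $\mathscr{PBF}(\mathcal{H})$ is the set of pseudo B-Fredholm operators. For a unital Banach algebra $\mathcal{B}$: $\mathcal{B}^{D}$ is the set of Drazin invertible elements, i.e. $b\in\mathcal{B}$ for which there exist $c\in\mathcal{B}$ and $m\in\mathbb{N}$ with $bc=cb$, $cbc=c$, $b^mcb=b^m$; $\mathcal{B}^{KD}$ is the set of Koliha-Drazin invertible elements, i.e. $b\in\mathcal{B}$ for which there exists $c\in\mathcal{B}$ with $bc=cb$, $cbc=c$ and $bcb=b+w$ for some quasi-nilpotent $w\in\mathcal{B}$. Invertible elements belong to both sets. *)

theory Defs
  imports "HOL-Analysis.Analysis" "HOL-Algebra.Module" "HOL-Algebra.QuotRing"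
begin

text \<open>The inner product is conjugate-linear in its first argument. The norm, topology and
  completeness come from \<^class>\<open>banach\<close>; the dimension is not restricted in any way.\<close>

class chilbert_space = banach +
  fixes scaleC :: "complex \<Rightarrow> 'a \<Rightarrow> 'a" (infixr \<open>*\<^sub>C\<close> 75)
    and cinner :: "'a \<Rightarrow> 'a \<Rightarrow> complex"
  assumes scaleR_scaleC: "scaleR r x = complex_of_real r *\<^sub>C x"
    and scaleC_add_right: "a *\<^sub>C (x + y) = a *\<^sub>C x + a *\<^sub>C y"
    and scaleC_add_left: "(a + b) *\<^sub>C x = a *\<^sub>C x + b *\<^sub>C x"
    and scaleC_scaleC: "a *\<^sub>C (b *\<^sub>C x) = (a * b) *\<^sub>C x"
    and scaleC_one: "1 *\<^sub>C x = x"
    and cinner_commute: "cinner x y = cnj (cinner y x)"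
    and cinner_add_left: "cinner (x + y) z = cinner x z + cinner y z"
    and cinner_scaleC_left: "cinner (a *\<^sub>C x) y = cnj a * cinner x y"
    and cinner_self_nonneg: "0 \<le> Re (cinner x x)"
    and cinner_self_eq_0_iff: "cinner x x = 0 \<longleftrightarrow> x = 0"
    and norm_eq_sqrt_cinner: "norm x = sqrt (Re (cinner x x))"

lemma vector_space_scaleC: "vector_space (scaleC :: complex \<Rightarrow> 'a::chilbert_space \<Rightarrow> 'a)"
  by unfold_locales (simp_all add: scaleC_add_right scaleC_add_left scaleC_scaleC scaleC_one)

abbreviation csubspace :: "'a::chilbert_space set \<Rightarrow> bool"
  where "csubspace \<equiv> module.subspace scaleC"

abbreviation cspan :: "'a::chilbert_space set \<Rightarrow> 'a set"
  where "cspan \<equiv> module.span scaleC"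

definition cfinite_dim :: "'a::chilbert_space set \<Rightarrow> bool"
  where "cfinite_dim V \<longleftrightarrow> (\<exists>F. finite F \<and> F \<subseteq> V \<and> V \<subseteq> cspan F)"

text \<open>The quotient space \<open>V / W\<close> is spanned by the classes of finitely many vectors of \<open>V\<close>.\<close>

definition cfinite_codim :: "'a::chilbert_space set \<Rightarrow> 'a set \<Rightarrow> bool"
  where "cfinite_codim V W \<longleftrightarrow> (\<exists>F. finite F \<and> F \<subseteq> V \<and> V \<subseteq> cspan (W \<union> F))"


text \<open>
  Unital complex algebras are records of type \<open>(complex, 'b) module\<close>, which carry a
  multiplication besides the scalar multiplication. (The locale \<^locale>\<open>algebra\<close>
  is not used since it requires commutativity.) In a Banach algebra, an element is quasi-nilpotent
  if its spectrum is \<open>{0}\<close>; the inclusion below is stated instead of equality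
  only to include the zero algebra, where the spectrum is empty. The inverse, hence the spectrum,
  depends only on the underlying algebra and not on the norm.
\<close>

definition alg_spectrum :: "(complex, 'b, 'm) module_scheme \<Rightarrow> 'b \<Rightarrow> complex set"
  where "alg_spectrum B b = {z. z \<odot>\<^bsub>B\<^esub> \<one>\<^bsub>B\<^esub> \<ominus>\<^bsub>B\<^esub> b \<notin> Units B}"

definition quasi_nilpotent :: "(complex, 'b, 'm) module_scheme \<Rightarrow> 'b \<Rightarrow> bool"
  where "quasi_nilpotent B b \<longleftrightarrow> b \<in> carrier B \<and> alg_spectrum B b \<subseteq> {0}"

definition drazin_invertibles :: "(complex, 'b, 'm) module_scheme \<Rightarrow> 'b set"
  where "drazin_invertibles B = {b \<in> carrier B. \<exists>c\<in>carrier B. \<exists>m::nat.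
    b \<otimes>\<^bsub>B\<^esub> c = c \<otimes>\<^bsub>B\<^esub> b \<and>
    c \<otimes>\<^bsub>B\<^esub> b \<otimes>\<^bsub>B\<^esub> c = c \<and>
    b [^]\<^bsub>B\<^esub> m \<otimes>\<^bsub>B\<^esub> c \<otimes>\<^bsub>B\<^esub> b = b [^]\<^bsub>B\<^esub> m}"

definition koliha_drazin_invertibles :: "(complex, 'b, 'm) module_scheme \<Rightarrow> 'b set"
  where "koliha_drazin_invertibles B = {b \<in> carrier B. \<exists>c\<in>carrier B. \<exists>w.
    quasi_nilpotent B w \<and>
    b \<otimes>\<^bsub>B\<^esub> c = c \<otimes>\<^bsub>B\<^esub> b \<and>
    c \<otimes>\<^bsub>B\<^esub> b \<otimes>\<^bsub>B\<^esub> c = c \<and>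
    b \<otimes>\<^bsub>B\<^esub> c \<otimes>\<^bsub>B\<^esub> b = b \<oplus>\<^bsub>B\<^esub> w}"

text \<open>\<^const>\<open>FactRing\<close> together with the induced scalar multiplication.\<close>

definition quotient_algebra ::
    "(complex, 'b, 'm) module_scheme \<Rightarrow> 'b set \<Rightarrow> (complex, 'b set) module"
  where "quotient_algebra A I =
    \<lparr>carrier = carrier (A Quot I), mult = mult (A Quot I), one = one (A Quot I),
     zero = zero (A Quot I), add = add (A Quot I),
     smult = (\<lambda>c X. \<Union>x\<in>X. I +>\<^bsub>A\<^esub> (c \<odot>\<^bsub>A\<^esub> x))\<rparr>"


text \<open>
  The algebra of bounded linear operators on a subspace \<open>M\<close> of the ambient space. Its
  elements are functions on \<open>M\<close> (extensional, i.e. \<open>undefined\<close> outside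
  \<open>M\<close>), so that the restriction of an operator to an invariant subspace is
  \<^term>\<open>restrict T M\<close>. For \<open>M = UNIV\<close> extensionality is void.
\<close>

definition bounded_ops :: "'a::chilbert_space set \<Rightarrow> (complex, 'a \<Rightarrow> 'a) module"
  where "bounded_ops M =
    \<lparr>carrier = {f \<in> M \<rightarrow>\<^sub>E M. (\<forall>x\<in>M. \<forall>y\<in>M. f (x + y) = f x + f y) \<and>
        (\<forall>c. \<forall>x\<in>M. f (c *\<^sub>C x) = c *\<^sub>C f x) \<and> (\<exists>K. \<forall>x\<in>M. norm (f x) \<le> K * norm x)},
     mult = (\<lambda>f g. compose M f g), one = (\<lambda>x\<in>M. x),
     zero = (\<lambda>x\<in>M. 0), add = (\<lambda>f g. \<lambda>x\<in>M. f x + g x),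
     smult = (\<lambda>c f. \<lambda>x\<in>M. c *\<^sub>C f x)\<rparr>"

abbreviation operator_algebra :: "(complex, 'a \<Rightarrow> 'a::chilbert_space) module" (\<open>\<L>\<close>)
  where "\<L> \<equiv> bounded_ops UNIV"

definition compact_ops :: "('a \<Rightarrow> 'a::chilbert_space) set" (\<open>\<K>\<close>)
  where "\<K> = {T \<in> carrier \<L>. compact (closure (T ` cball 0 1))}"

definition calkin_algebra :: "(complex, ('a \<Rightarrow> 'a::chilbert_space) set) module" (\<open>\<C>\<close>)
  where "\<C> = quotient_algebra \<L> \<K>"

definition calkin_map :: "('a \<Rightarrow> 'a::chilbert_space) \<Rightarrow> ('a \<Rightarrow> 'a) set" (\<open>\<pi>\<^sub>C\<close>)
  where "\<pi>\<^sub>C T = \<K> +>\<^bsub>\<L>\<^esub> T"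

text \<open>Fredholm operators on a closed subspace \<open>M\<close>; since \<open>M\<close> is closed, it makes no
  difference whether the range is closed in \<open>M\<close> or in the ambient space.\<close>

definition fredholm_on :: "'a::chilbert_space set \<Rightarrow> ('a \<Rightarrow> 'a) \<Rightarrow> bool"
  where "fredholm_on M S \<longleftrightarrow> S \<in> carrier (bounded_ops M) \<and>
    closed (S ` M) \<and> cfinite_dim {x \<in> M. S x = 0} \<and> cfinite_codim M (S ` M)"

definition B_fredholm :: "('a \<Rightarrow> 'a::chilbert_space) set" (\<open>\<B>\<F>\<close>)
  where "\<B>\<F> = {T \<in> carrier \<L>. \<exists>n::nat. closed (range (T ^^ n)) \<and>
    fredholm_on (range (T ^^ n)) (restrict T (range (T ^^ n)))}"

definition pseudo_B_fredholm :: "('a \<Rightarrow> 'a::chilbert_space) set" (\<open>\<P>\<B>\<F>\<close>)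
  where "\<P>\<B>\<F> = {T \<in> carrier \<L>. \<exists>M N.
    csubspace M \<and> closed M \<and> T ` M \<subseteq> M \<and>
    csubspace N \<and> closed N \<and> T ` N \<subseteq> N \<and>
    M \<inter> N = {0} \<and> {x + y |x y. x \<in> M \<and> y \<in> N} = UNIV \<and>
    quasi_nilpotent (bounded_ops M) (restrict T M) \<and>
    fredholm_on N (restrict T N)}"

lemma subspaceD:
  assumes "csubspace M"
  shows "0 \<in> M" "x \<in> M \<Longrightarrow> y \<in> M \<Longrightarrow> x + y \<in> M" "x \<in> M \<Longrightarrow> c *\<^sub>C x \<in> M"
proof -
  interpret vector_space "scaleC :: complex \<Rightarrow> 'a \<Rightarrow> 'a" by (rule vector_space_scaleC)
  show "0 \<in> M" "x \<in> M \<Longrightarrow> y \<in> M \<Longrightarrow> x + y \<in> M" "x \<in> M \<Longrightarrow> c *\<^sub>C x \<in> M"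
    using assms by (auto simp: subspace_def)
qed

lemma csubspace_UNIV: "csubspace (UNIV :: 'a::chilbert_space set)"
proof -
  interpret vector_space "scaleC :: complex \<Rightarrow> 'a \<Rightarrow> 'a" by (rule vector_space_scaleC)
  show ?thesis by (auto simp: subspace_def)
qed

lemma scaleC_zero_right: "c *\<^sub>C (0::'a::chilbert_space) = 0"
  using scaleC_add_right[of c 0 "0::'a"] by simp

lemma scaleC_minus_one: "(- 1) *\<^sub>C (x::'a::chilbert_space) = - x"
  by (metis (no_types) of_real_1 of_real_minus scaleR_minus1_left scaleR_scaleC)

lemma norm_scaleC: "norm (c *\<^sub>C (x::'a::chilbert_space)) = cmod c * norm x"
proof -
  have r: "cinner y (c *\<^sub>C x) = c * cinner y x" for y
    by (metis cinner_commute cinner_scaleC_left complex_cnj_cnj complex_cnj_mult)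
  have "cinner (c *\<^sub>C x) (c *\<^sub>C x) = (cnj c * c) * cinner x x"
    by (simp add: r cinner_scaleC_left)
  also have "cnj c * c = complex_of_real ((cmod c)\<^sup>2)"
    by (simp add: complex_norm_square[symmetric] mult.commute)
  finally have "Re (cinner (c *\<^sub>C x) (c *\<^sub>C x)) = (cmod c)\<^sup>2 * Re (cinner x x)"
    by simp
  then show ?thesis
    by (simp add: norm_eq_sqrt_cinner real_sqrt_mult)
qed

lemma carrier_operator_algebra:
  "carrier \<L> = {T. bounded_linear T \<and> (\<forall>c x. T (c *\<^sub>C x) = c *\<^sub>C T (x::'a::chilbert_space))}"
proof -
  have "bounded_linear T" if "\<forall>x y. T (x + y) = T x + T y"
    "\<forall>c x. T (c *\<^sub>C x) = c *\<^sub>C T x" "\<forall>x. norm (T x) \<le> K * norm x"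
    for T :: "'a \<Rightarrow> 'a" and K
    by (rule bounded_linear_intro[where K=K]) (use that in \<open>auto simp: scaleR_scaleC mult.commute\<close>)
  moreover have "\<exists>K. \<forall>x. norm (T x) \<le> K * norm x" if "bounded_linear T" for T :: "'a \<Rightarrow> 'a"
    using bounded_linear.bounded[OF that] by (auto simp: mult.commute)
  ultimately show ?thesis
    by (auto simp: bounded_ops_def linear_simps)
qed

lemma bounded_ops_closed:
  assumes M: "csubspace M"
  shows "f \<in> carrier (bounded_ops M) \<Longrightarrow> g \<in> carrier (bounded_ops M) \<Longrightarrow>
      f \<oplus>\<^bsub>bounded_ops M\<^esub> g \<in> carrier (bounded_ops M)"
    and "f \<in> carrier (bounded_ops M) \<Longrightarrow> g \<in> carrier (bounded_ops M) \<Longrightarrow>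
      f \<otimes>\<^bsub>bounded_ops M\<^esub> g \<in> carrier (bounded_ops M)"
    and "f \<in> carrier (bounded_ops M) \<Longrightarrow> c \<odot>\<^bsub>bounded_ops M\<^esub> f \<in> carrier (bounded_ops M)"
    and "\<zero>\<^bsub>bounded_ops M\<^esub> \<in> carrier (bounded_ops M)"
    and "\<one>\<^bsub>bounded_ops M\<^esub> \<in> carrier (bounded_ops M)"
proof -
  note S = subspaceD[OF M]
  show "f \<oplus>\<^bsub>bounded_ops M\<^esub> g \<in> carrier (bounded_ops M)"
    if f: "f \<in> carrier (bounded_ops M)" and g: "g \<in> carrier (bounded_ops M)"
  proof -
    obtain K L where K: "\<forall>x\<in>M. norm (f x) \<le> K * norm x" and L: "\<forall>x\<in>M. norm (g x) \<le> L * norm x"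
      using f g by (auto simp: bounded_ops_def)
    have "\<forall>x\<in>M. norm (f x + g x) \<le> (K + L) * norm x"
      using K L by (metis (no_types, lifting) distrib_right norm_triangle_mono)
    then have "\<exists>K. \<forall>x\<in>M. norm (f x + g x) \<le> K * norm x" by blast
    with f g show ?thesis
      by (auto simp: bounded_ops_def S PiE_iff scaleC_add_right algebra_simps)
  qed
  show "f \<otimes>\<^bsub>bounded_ops M\<^esub> g \<in> carrier (bounded_ops M)"
    if f: "f \<in> carrier (bounded_ops M)" and g: "g \<in> carrier (bounded_ops M)"
  proof -
    have gM: "g x \<in> M" if "x \<in> M" for x using g that by (auto simp: bounded_ops_def)
    obtain K L where K: "\<forall>x\<in>M. norm (f x) \<le> K * norm x" and L: "\<forall>x\<in>M. norm (g x) \<le> L * norm x"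
      using f g by (auto simp: bounded_ops_def)
    have "norm (f (g x)) \<le> (\<bar>K\<bar> * L) * norm x" if "x \<in> M" for x
    proof -
      have "norm (f (g x)) \<le> K * norm (g x)" using K gM that by blast
      also have "\<dots> \<le> \<bar>K\<bar> * norm (g x)" by (intro mult_right_mono) auto
      also have "\<dots> \<le> \<bar>K\<bar> * (L * norm x)" using L that by (intro mult_left_mono) auto
      finally show ?thesis by simp
    qed
    then have "\<exists>K. \<forall>x\<in>M. norm (f (g x)) \<le> K * norm x" by blast
    with f g show ?thesis
      by (auto simp: bounded_ops_def S PiE_iff compose_def)
  qed
  show "c \<odot>\<^bsub>bounded_ops M\<^esub> f \<in> carrier (bounded_ops M)" if f: "f \<in> carrier (bounded_ops M)"
  proof -
    obtain K where K: "\<forall>x\<in>M. norm (f x) \<le> K * norm x"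
      using f by (auto simp: bounded_ops_def)
    have "\<forall>x\<in>M. norm (c *\<^sub>C f x) \<le> (cmod c * K) * norm x"
      using K by (auto simp: norm_scaleC mult.assoc intro: mult_left_mono)
    then have "\<exists>K. \<forall>x\<in>M. norm (c *\<^sub>C f x) \<le> K * norm x" by blast
    with f show ?thesis
      by (auto simp: bounded_ops_def S PiE_iff scaleC_add_right scaleC_scaleC mult.commute)
  qed
  show "\<zero>\<^bsub>bounded_ops M\<^esub> \<in> carrier (bounded_ops M)"
    by (auto simp: bounded_ops_def S scaleC_zero_right intro: exI[of _ 0])
  show "\<one>\<^bsub>bounded_ops M\<^esub> \<in> carrier (bounded_ops M)"
    by (auto simp: bounded_ops_def S intro: exI[of _ 1])
qed

lemma bounded_ops_simps:
  "f \<oplus>\<^bsub>bounded_ops M\<^esub> g = (\<lambda>x\<in>M. f x + g x)" "f \<otimes>\<^bsub>bounded_ops M\<^esub> g = compose M f g"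
  "\<zero>\<^bsub>bounded_ops M\<^esub> = (\<lambda>x\<in>M. 0)" "\<one>\<^bsub>bounded_ops M\<^esub> = (\<lambda>x\<in>M. x)"
  "c \<odot>\<^bsub>bounded_ops M\<^esub> f = (\<lambda>x\<in>M. c *\<^sub>C f x)"
  by (simp_all add: bounded_ops_def)

lemma bounded_opsD:
  assumes "f \<in> carrier (bounded_ops M)"
  shows "f \<in> extensional M" "x \<in> M \<Longrightarrow> f x \<in> M"
    "x \<in> M \<Longrightarrow> y \<in> M \<Longrightarrow> f (x + y) = f x + f y"
    "x \<in> M \<Longrightarrow> f (c *\<^sub>C x) = c *\<^sub>C f x"
  using assms by (auto simp: bounded_ops_def PiE_iff)

lemma ring_bounded_ops:
  assumes M: "csubspace M"
  shows "ring (bounded_ops M)"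
proof (rule ringI)
  note S = subspaceD[OF M]
  note ext = extensionalityI[where A = M]
  show "abelian_group (bounded_ops M)"
  proof (rule abelian_groupI)
    fix f assume f: "f \<in> carrier (bounded_ops M)"
    show "\<zero>\<^bsub>bounded_ops M\<^esub> \<oplus>\<^bsub>bounded_ops M\<^esub> f = f"
      by (rule ext) (auto simp: bounded_ops_simps bounded_opsD[OF f])
    show "\<exists>g\<in>carrier (bounded_ops M). g \<oplus>\<^bsub>bounded_ops M\<^esub> f = \<zero>\<^bsub>bounded_ops M\<^esub>"
    proof
      show "(- 1) \<odot>\<^bsub>bounded_ops M\<^esub> f \<in> carrier (bounded_ops M)"
        by (rule bounded_ops_closed(3)[OF M f])
      show "(- 1) \<odot>\<^bsub>bounded_ops M\<^esub> f \<oplus>\<^bsub>bounded_ops M\<^esub> f = \<zero>\<^bsub>bounded_ops M\<^esub>"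
        by (rule ext) (auto simp: bounded_ops_simps scaleC_minus_one)
    qed
  qed (use bounded_ops_closed[OF M] in \<open>auto simp: bounded_ops_simps add_ac\<close>)
  show "monoid (bounded_ops M)"
  proof (rule monoidI)
    fix f assume f: "f \<in> carrier (bounded_ops M)"
    show "\<one>\<^bsub>bounded_ops M\<^esub> \<otimes>\<^bsub>bounded_ops M\<^esub> f = f"
      by (rule ext) (auto simp: bounded_ops_simps compose_def bounded_opsD[OF f])
    show "f \<otimes>\<^bsub>bounded_ops M\<^esub> \<one>\<^bsub>bounded_ops M\<^esub> = f"
      by (rule ext) (auto simp: bounded_ops_simps compose_def bounded_opsD[OF f])
  next
    fix f g h
    assume f: "f \<in> carrier (bounded_ops M)" and g: "g \<in> carrier (bounded_ops M)"
      and h: "h \<in> carrier (bounded_ops M)"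
    show "f \<otimes>\<^bsub>bounded_ops M\<^esub> g \<otimes>\<^bsub>bounded_ops M\<^esub> h =
        f \<otimes>\<^bsub>bounded_ops M\<^esub> (g \<otimes>\<^bsub>bounded_ops M\<^esub> h)"
      by (rule ext) (auto simp: bounded_ops_simps compose_def bounded_opsD[OF h])
  qed (use bounded_ops_closed[OF M] in auto)
next
  note ext = extensionalityI[where A = M]
  fix f g h
  assume f: "f \<in> carrier (bounded_ops M)" and g: "g \<in> carrier (bounded_ops M)"
    and h: "h \<in> carrier (bounded_ops M)"
  show "(f \<oplus>\<^bsub>bounded_ops M\<^esub> g) \<otimes>\<^bsub>bounded_ops M\<^esub> h =
      f \<otimes>\<^bsub>bounded_ops M\<^esub> h \<oplus>\<^bsub>bounded_ops M\<^esub> g \<otimes>\<^bsub>bounded_ops M\<^esub> h"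
    by (rule ext) (auto simp: bounded_ops_simps compose_def bounded_opsD[OF h])
  show "h \<otimes>\<^bsub>bounded_ops M\<^esub> (f \<oplus>\<^bsub>bounded_ops M\<^esub> g) =
      h \<otimes>\<^bsub>bounded_ops M\<^esub> f \<oplus>\<^bsub>bounded_ops M\<^esub> h \<otimes>\<^bsub>bounded_ops M\<^esub> g"
    by (rule ext)
      (auto simp: bounded_ops_simps compose_def bounded_opsD[OF h] bounded_opsD[OF f] bounded_opsD[OF g])
qed

lemmas ring_operator_algebra = ring_bounded_ops[OF csubspace_UNIV]

lemma compact_opsI:
  assumes T: "T \<in> carrier \<L>" and "T ` cball 0 1 \<subseteq> S" "compact S"
  shows "T \<in> \<K>"
proof -
  have "closure (T ` cball 0 1) \<subseteq> S"
    by (intro closure_minimal) (use assms in \<open>auto intro: compact_imp_closed\<close>)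
  then have "compact (closure (T ` cball 0 1))"
    using assms(3) by (metis closed_closure compact_Int_closed inf.absorb_iff2)
  then show ?thesis using T by (simp add: compact_ops_def)
qed

lemma compact_ops_smult:
  assumes T: "T \<in> \<K>"
  shows "c \<odot>\<^bsub>\<L>\<^esub> T \<in> \<K>"
proof (rule compact_opsI)
  have c: "continuous_on UNIV (\<lambda>x::'a. c *\<^sub>C x)"
  proof (rule linear_continuous_on, rule bounded_linear_intro[where K = "cmod c"])
    show "c *\<^sub>C (r *\<^sub>R x) = r *\<^sub>R (c *\<^sub>C x)" for r and x :: 'a
      by (simp add: scaleR_scaleC scaleC_scaleC mult.commute)
  qed (simp_all add: scaleC_add_right norm_scaleC mult.commute)
  show "compact ((\<lambda>x. c *\<^sub>C x) ` closure (T ` cball 0 1))"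
    by (rule compact_continuous_image)
      (use T c in \<open>auto simp: compact_ops_def intro: continuous_on_subset\<close>)
  show "(c \<odot>\<^bsub>\<L>\<^esub> T) ` cball 0 1 \<subseteq> (\<lambda>x. c *\<^sub>C x) ` closure (T ` cball 0 1)"
    using closure_subset[of "T ` cball 0 1"] by (auto simp: bounded_ops_simps)
  show "c \<odot>\<^bsub>\<L>\<^esub> T \<in> carrier \<L>"
    by (rule bounded_ops_closed(3)[OF csubspace_UNIV]) (use T in \<open>simp add: compact_ops_def\<close>)
qed

lemma ideal_compact_ops: "ideal \<K> (\<L> :: (complex, 'a \<Rightarrow> 'a::chilbert_space) module)"
proof (rule idealI)
  interpret ring "\<L> :: (complex, 'a \<Rightarrow> 'a) module" by (rule ring_operator_algebra)
  show "ring (\<L> :: (complex, 'a \<Rightarrow> 'a) module)" by (rule ring_operator_algebra)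
  have K: "T \<in> carrier \<L>" if "T \<in> \<K>" for T :: "'a \<Rightarrow> 'a" using that by (simp add: compact_ops_def)
  show "subgroup \<K> (add_monoid (\<L> :: (complex, 'a \<Rightarrow> 'a) module))"
  proof (rule add.subgroupI)
    show "\<K> \<subseteq> carrier (\<L> :: (complex, 'a \<Rightarrow> 'a) module)" using K by auto
    have "\<zero>\<^bsub>\<L>\<^esub> \<in> (\<K> :: ('a \<Rightarrow> 'a) set)"
      by (rule compact_opsI[where S = "{0}"])
        (use bounded_ops_closed(4)[OF csubspace_UNIV] in \<open>auto simp: bounded_ops_simps(3)\<close>)
    then show "(\<K> :: ('a \<Rightarrow> 'a) set) \<noteq> {}" by auto
  next
    fix T :: "'a \<Rightarrow> 'a" assume T: "T \<in> \<K>"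
    have "(- 1) \<odot>\<^bsub>\<L>\<^esub> T \<oplus>\<^bsub>\<L>\<^esub> T = \<zero>\<^bsub>\<L>\<^esub>"
      by (auto simp: bounded_ops_simps scaleC_minus_one)
    then have "\<ominus>\<^bsub>\<L>\<^esub> T = (- 1) \<odot>\<^bsub>\<L>\<^esub> T"
      using K[OF T] bounded_ops_closed(3)[OF csubspace_UNIV K[OF T]] minus_equality by blast
    then show "\<ominus>\<^bsub>\<L>\<^esub> T \<in> \<K>" using compact_ops_smult[OF T, of "- 1"] by simp
  next
    fix T U :: "'a \<Rightarrow> 'a" assume T: "T \<in> \<K>" and U: "U \<in> \<K>"
    show "T \<oplus>\<^bsub>\<L>\<^esub> U \<in> \<K>"
    proof (rule compact_opsI)
      show "compact {x + y |x y. x \<in> closure (T ` cball 0 1) \<and> y \<in> closure (U ` cball 0 1)}"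
        by (rule compact_sums) (use T U in \<open>auto simp: compact_ops_def\<close>)
      show "(T \<oplus>\<^bsub>\<L>\<^esub> U) ` cball 0 1 \<subseteq>
          {x + y |x y. x \<in> closure (T ` cball 0 1) \<and> y \<in> closure (U ` cball 0 1)}"
        using closure_subset[of "T ` cball 0 1"] closure_subset[of "U ` cball 0 1"]
        by (force simp: bounded_ops_simps)
    qed (use K T U in auto)
  qed
  fix T U :: "'a \<Rightarrow> 'a" assume T: "T \<in> \<K>" and U: "U \<in> carrier \<L>"
  have U': "bounded_linear U" using U by (simp add: carrier_operator_algebra)
  show "U \<otimes>\<^bsub>\<L>\<^esub> T \<in> \<K>"
  proof (rule compact_opsI)
    show "compact (U ` closure (T ` cball 0 1))"
      by (rule compact_continuous_image)
        (use T U' in \<open>auto simp: compact_ops_def intro: linear_continuous_on\<close>)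
    show "(U \<otimes>\<^bsub>\<L>\<^esub> T) ` cball 0 1 \<subseteq> U ` closure (T ` cball 0 1)"
      using closure_subset[of "T ` cball 0 1"] by (auto simp: bounded_ops_simps compose_def)
  qed (use K T U in auto)
  obtain b where b: "b > 0" "\<And>x. norm (U x) \<le> norm x * b"
    using bounded_linear.pos_bounded[OF U'] by blast
  show "T \<otimes>\<^bsub>\<L>\<^esub> U \<in> \<K>"
  proof (rule compact_opsI)
    have lin: "bounded_linear T" using K[OF T] by (simp add: carrier_operator_algebra)
    show "compact ((\<lambda>x. b *\<^sub>R x) ` closure (T ` cball 0 1))"
      by (rule compact_scaling) (use T in \<open>auto simp: compact_ops_def\<close>)
    have "T (U x) \<in> (\<lambda>x. b *\<^sub>R x) ` closure (T ` cball 0 1)" if "norm x \<le> 1" for x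
    proof -
      have "norm (U x) \<le> b" using order_trans[OF b(2)[of x] mult_right_mono[OF that, of b]] b(1)
        by simp
      then have "U x /\<^sub>R b \<in> cball 0 1" using b(1) by (simp add: field_simps)
      then have "T (U x /\<^sub>R b) \<in> closure (T ` cball 0 1)"
        by (intro subsetD[OF closure_subset] imageI)
      moreover have "T (U x) = b *\<^sub>R T (U x /\<^sub>R b)"
        using b(1) by (simp add: linear_simps[OF lin])
      ultimately show ?thesis by (rule rev_image_eqI)
    qed
    then show "(T \<otimes>\<^bsub>\<L>\<^esub> U) ` cball 0 1 \<subseteq> (\<lambda>x. b *\<^sub>R x) ` closure (T ` cball 0 1)"
      by (auto simp: bounded_ops_simps compose_def)
  qed (use K T U in auto)
qed

lemma ring_calkin_algebra: "ring (\<C> :: (complex, ('a \<Rightarrow> 'a::chilbert_space) set) module)"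
proof -
  interpret Q: ring "\<L> Quot (\<K> :: ('a \<Rightarrow> 'a) set)"
    by (rule ideal.quotient_is_ring[OF ideal_compact_ops])
  have sel: "carrier \<C> = carrier (\<L> Quot (\<K> :: ('a \<Rightarrow> 'a) set))"
    "mult \<C> = mult (\<L> Quot (\<K> :: ('a \<Rightarrow> 'a) set))" "one \<C> = one (\<L> Quot (\<K> :: ('a \<Rightarrow> 'a) set))"
    "zero \<C> = zero (\<L> Quot (\<K> :: ('a \<Rightarrow> 'a) set))" "add \<C> = add (\<L> Quot (\<K> :: ('a \<Rightarrow> 'a) set))"
    by (simp_all add: calkin_algebra_def quotient_algebra_def)
  show ?thesis
  proof (rule ringI)
    show "abelian_group (\<C> :: (complex, ('a \<Rightarrow> 'a) set) module)"
    proof (rule abelian_groupI, unfold sel, goal_cases)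
      case (6 x)
      then show ?case by (intro bexI[where x = "\<ominus>\<^bsub>\<L> Quot \<K>\<^esub> x"] Q.l_neg Q.a_inv_closed)
    qed (fact Q.add.m_closed Q.zero_closed Q.a_assoc Q.a_comm Q.l_zero)+
    show "monoid (\<C> :: (complex, ('a \<Rightarrow> 'a) set) module)"
      by (rule monoidI; unfold sel; fact Q.m_closed Q.one_closed Q.m_assoc Q.l_one Q.r_one)
  qed (unfold sel; fact Q.l_distr Q.r_distr)+
qed

lemma calkin_map_ring_hom:
  "calkin_map \<in> ring_hom (\<L> :: (complex, 'a \<Rightarrow> 'a::chilbert_space) module) \<C>"
  using ideal.rcos_ring_hom[OF ideal_compact_ops]
  by (auto simp: ring_hom_def calkin_map_def[abs_def] calkin_algebra_def quotient_algebra_def)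

lemma calkin_map_smult:
  assumes T: "T \<in> carrier (\<L> :: (complex, 'a \<Rightarrow> 'a::chilbert_space) module)"
  shows "\<pi>\<^sub>C (c \<odot>\<^bsub>\<L>\<^esub> T) = c \<odot>\<^bsub>\<C>\<^esub> \<pi>\<^sub>C T"
proof -
  interpret ideal \<K> "\<L> :: (complex, 'a \<Rightarrow> 'a) module" by (rule ideal_compact_ops)
  have *: "\<K> +>\<^bsub>\<L>\<^esub> (c \<odot>\<^bsub>\<L>\<^esub> x) = \<K> +>\<^bsub>\<L>\<^esub> (c \<odot>\<^bsub>\<L>\<^esub> T)" if x: "x \<in> \<K> +>\<^bsub>\<L>\<^esub> T" for x
  proof -
    obtain k where k: "k \<in> \<K>" "x = k \<oplus>\<^bsub>\<L>\<^esub> T" using x by (auto simp: a_r_coset_def')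
    have "c \<odot>\<^bsub>\<L>\<^esub> x = c \<odot>\<^bsub>\<L>\<^esub> k \<oplus>\<^bsub>\<L>\<^esub> c \<odot>\<^bsub>\<L>\<^esub> T"
      by (auto simp: k bounded_ops_simps scaleC_add_right)
    then have "c \<odot>\<^bsub>\<L>\<^esub> x \<in> \<K> +>\<^bsub>\<L>\<^esub> (c \<odot>\<^bsub>\<L>\<^esub> T)"
      using compact_ops_smult[OF k(1), of c] by (auto simp: a_r_coset_def')
    then show ?thesis
      by (rule a_repr_independence[OF _ bounded_ops_closed(3)[OF csubspace_UNIV T] a_subgroup, symmetric])
  qed
  have "T \<in> \<K> +>\<^bsub>\<L>\<^esub> T" using a_rcos_self[OF T] .
  then have "(\<Union>x\<in>\<K> +>\<^bsub>\<L>\<^esub> T. \<K> +>\<^bsub>\<L>\<^esub> (c \<odot>\<^bsub>\<L>\<^esub> x)) = \<K> +>\<^bsub>\<L>\<^esub> (c \<odot>\<^bsub>\<L>\<^esub> T)"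
    using * by blast
  then show ?thesis
    by (simp add: calkin_map_def calkin_algebra_def quotient_algebra_def)
qed

end

theory Submission
  imports Defs
begin

text \<open>If \<open>c\<close> is a (Koliha-)Drazin inverse of \<open>b\<close> in the Calkin algebra, then \<open>p = 1 - b c\<close> is an idempotent
  commuting with \<open>b\<close>, the part \<open>b p\<close> is nilpotent (quasi-nilpotent), and \<open>b\<close> is invertible relative to
  \<open>1 - p\<close>. So it suffices to lift idempotents, nilpotents and quasi-nilpotents: the diagonal blocks of a
  lift of \<open>b\<close> for a lift of \<open>p\<close> are then a compact perturbation of a (quasi-)nilpotent operator and,
  by Atkinson's theorem, a Fredholm operator.

  Idempotents and nilpotents are lifted by one principle: if \<open>A B\<close> is compact, there is an orthogonal
  projection \<open>P\<close> such that \<open>A P\<close> and \<open>(1 - P) B\<close> are compact. It is assembled from spectral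
  projections of the positive operators \<open>B B\<^sup>*\<close>. Quasi-nilpotents are lifted by the West
  decomposition: an operator \<open>A\<close> whose class is quasi-nilpotent satisfies the Riesz alternative for
  \<open>A - \<mu>\<close>, \<open>\<mu> \<noteq> 0\<close>; splitting off one eigenvector after another, each for an eigenvalue of nearly
  maximal modulus, yields an orthonormal sequence for which \<open>A\<close> is upper triangular with diagonal entries
  tending to 0, and subtracting this compact diagonal leaves a quasi-nilpotent operator.

  Conversely, the summands of a pseudo B-Fredholm operator provide the Koliha-Drazin inverse, and
  a B-Fredholm operator is strongly \<open>\<pi>\<close>-regular, hence Drazin invertible, modulo the compact operators.\<close>


subsection \<open>Inner products and orthogonal decompositions\<close>

text \<open>Lifts must satisfy exact identities, so no correction may leave a corner that is already
  fixed: this is why the projection lemma, the nilpotent lift and the West decomposition all carry a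
  clause on a projection that absorbs their data. Only sequential constructions are made, and what
  lies outside them is treated as one orthogonal complement. The Riesz alternative is proved without
  an index. For each radius, \<open>riesz\<close> supplies an inequality for just one power of
  \<open>A\<close>; properness on bounded sets is the consequence of it that yields closed ranges
  for the powers of \<open>A - \<mu>\<close>. The spectral radius has to be read off from inverses
  in the Calkin algebra alone, and averaging over roots of -1 replaces contour integrals there.
  Infinite sums are forced to converge in norm, by weights \<open>(1/2) ^ k\<close> or by
  orthogonality and small coefficients, because compactness passes to norm limits but not to strong
  ones.\<close>

interpretation cv: vector_space "scaleC :: complex \<Rightarrow> 'a::chilbert_space \<Rightarrow> 'a"
  by (rule vector_space_scaleC)

lemma cinner_add_right: "cinner x (y + z) = cinner x y + cinner x (z::'a::chilbert_space)"
  by (metis cinner_add_left cinner_commute complex_cnj_add)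

lemma cinner_scaleC_right: "cinner x (c *\<^sub>C y) = c * cinner x (y::'a::chilbert_space)"
  by (metis cinner_commute cinner_scaleC_left complex_cnj_cnj complex_cnj_mult)

lemma cinner_zero [simp]: "cinner 0 (x::'a::chilbert_space) = 0" "cinner (x::'a) 0 = 0"
  using cinner_scaleC_left[of 0 x x] cinner_scaleC_right[of x 0 x] by simp_all

lemma cinner_minus [simp]: "cinner (- x) (y::'a::chilbert_space) = - cinner x y"
    "cinner x (- y) = - cinner x y"
  using cinner_add_left[of x "-x" y] cinner_add_right[of x y "-y"]
  by (simp_all add: eq_neg_iff_add_eq_0 add.commute)

lemma cinner_diff: "cinner (x - y) (z::'a::chilbert_space) = cinner x z - cinner y z"
    "cinner z (x - y) = cinner z x - cinner z y"
  using cinner_add_left[of x "-y" z] cinner_add_right[of z x "-y"] by simp_all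

lemma cinner_sum: "cinner (\<Sum>i\<in>I. f i) (z::'a::chilbert_space) = (\<Sum>i\<in>I. cinner (f i) z)"
    "cinner z (\<Sum>i\<in>I. f i) = (\<Sum>i\<in>I. cinner z (f i))"
  by (induction I rule: infinite_finite_induct) (auto simp: cinner_add_left cinner_add_right)

lemmas cinner_simps = cinner_add_left cinner_add_right cinner_scaleC_left cinner_scaleC_right
  cinner_diff

lemma cinner_self: "cinner x x = of_real ((norm (x::'a::chilbert_space))\<^sup>2)"
proof -
  have "Im (cinner x x) = 0"
    by (metis cinner_commute complex_cnj cnj.simps(2) add.inverse_neutral equal_neg_zero)
  then show ?thesis
    using cinner_self_nonneg[of x] by (auto simp: norm_eq_sqrt_cinner complex_eq_iff)
qed

lemma Re_cinner_self: "Re (cinner x x) = (norm (x::'a::chilbert_space))\<^sup>2"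
  by (simp only: cinner_self Re_complex_of_real)

lemma cinner_eq_0_swap: "cinner x y = 0 \<longleftrightarrow> cinner y (x::'a::chilbert_space) = 0"
  by (metis cinner_commute complex_cnj_zero)

lemma norm_add_sq: "(norm (x + y))\<^sup>2 = (norm x)\<^sup>2 + 2 * Re (cinner x y) + (norm (y::'a::chilbert_space))\<^sup>2"
proof -
  have "Re (cinner y x) = Re (cinner x y)" by (metis cinner_commute cnj.simps(1))
  moreover have "(norm (x + y))\<^sup>2 = Re (cinner (x + y) (x + y))"
    by (simp only: Re_cinner_self)
  ultimately show ?thesis by (simp add: cinner_add_left cinner_add_right Re_cinner_self)
qed

lemma norm_diff_sq: "(norm (x - y))\<^sup>2 = (norm x)\<^sup>2 - 2 * Re (cinner x y) + (norm (y::'a::chilbert_space))\<^sup>2"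
  using norm_add_sq[of x "-y"] by simp

lemma parallelogram:
  "(norm (x - y))\<^sup>2 = 2 * (norm x)\<^sup>2 + 2 * (norm y)\<^sup>2 - (norm (x + (y::'a::chilbert_space)))\<^sup>2"
  by (simp add: norm_add_sq norm_diff_sq)

lemma pythagoras: "cinner x y = 0 \<Longrightarrow> (norm (x + y))\<^sup>2 = (norm x)\<^sup>2 + (norm (y::'a::chilbert_space))\<^sup>2"
  by (simp add: norm_add_sq)

lemma cauchy_schwarz: "cmod (cinner x y) \<le> norm x * norm (y::'a::chilbert_space)"
proof (cases "y = 0")
  case False
  define c where "c = cinner y x / of_real ((norm y)\<^sup>2)"
  have o: "cinner (c *\<^sub>C y) (x - c *\<^sub>C y) = 0"
  proof -
    have "c * cinner y y = cinner y x" using False by (simp add: c_def cinner_self del: of_real_power)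
    then show ?thesis by (simp add: cinner_simps)
  qed
  have "(norm x)\<^sup>2 = (norm (c *\<^sub>C y))\<^sup>2 + (norm (x - c *\<^sub>C y))\<^sup>2"
    using pythagoras[OF o] by simp
  then have "(norm (c *\<^sub>C y))\<^sup>2 \<le> (norm x)\<^sup>2" by simp
  then have "cmod c * norm y \<le> norm x" by (simp add: norm_scaleC power2_le_iff_abs_le)
  moreover have "cmod c * norm y = cmod (cinner y x) / norm y"
    using False by (simp add: c_def norm_divide power2_eq_square norm_mult)
  ultimately have "cmod (cinner y x) \<le> norm x * norm y"
    using False by (simp add: divide_le_eq)
  then show ?thesis by (metis cinner_commute complex_mod_cnj)
qed simp

lemma bounded_bilinear_cinner: "bounded_bilinear (cinner :: 'a::chilbert_space \<Rightarrow> 'a \<Rightarrow> complex)"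
proof
  show "\<exists>K. \<forall>a b. norm (cinner (a::'a) b) \<le> norm a * norm b * K"
    using cauchy_schwarz by (metis mult.right_neutral)
qed (auto simp: cinner_simps scaleR_scaleC scaleR_conv_of_real)

lemmas tendsto_cinner [tendsto_intros] = bounded_bilinear.tendsto[OF bounded_bilinear_cinner]

lemma bounded_linear_scaleC: "bounded_linear (\<lambda>x::'a::chilbert_space. c *\<^sub>C x)"
  by (rule bounded_linear_intro[where K = "cmod c"])
    (auto simp: scaleC_add_right scaleR_scaleC scaleC_scaleC norm_scaleC mult.commute)

lemma tendsto_scaleC [tendsto_intros]:
  "(f \<longlongrightarrow> l) F \<Longrightarrow> ((\<lambda>x. c *\<^sub>C (f x :: 'a::chilbert_space)) \<longlongrightarrow> c *\<^sub>C l) F"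
  by (rule bounded_linear.tendsto[OF bounded_linear_scaleC])

lemma csubspace_diff: "csubspace M \<Longrightarrow> x \<in> M \<Longrightarrow> y \<in> M \<Longrightarrow> x - y \<in> (M::'a::chilbert_space set)"
  by (rule cv.subspace_diff)

lemma csubspace_closure:
  assumes "csubspace (M :: 'a::chilbert_space set)" shows "csubspace (closure M)"
  unfolding cv.subspace_def
proof (intro conjI ballI allI)
  show "0 \<in> closure M" using subspaceD(1)[OF assms] closure_subset by blast
  fix x y assume "x \<in> closure M" "y \<in> closure M"
  then obtain f g where f: "\<And>n. f n \<in> M" "f \<longlonglongrightarrow> x" and g: "\<And>n. g n \<in> M" "g \<longlonglongrightarrow> y"
    by (metis closure_sequential)
  show "x + y \<in> closure M" unfolding closure_sequential
    by (rule exI[of _ "\<lambda>n. f n + g n"]) (use f g subspaceD(2)[OF assms] in \<open>auto intro: tendsto_add\<close>)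
  show "c *\<^sub>C x \<in> closure M" for c unfolding closure_sequential
    by (rule exI[of _ "\<lambda>n. c *\<^sub>C f n"]) (use f subspaceD(3)[OF assms] in \<open>auto intro: tendsto_scaleC\<close>)
qed

text \<open>The midpoint of two members of a minimizing sequence lies in \<open>M\<close>, so the
  parallelogram law bounds their distance and the sequence is Cauchy.\<close>

lemma exists_closest:
  assumes M: "csubspace (M :: 'a::chilbert_space set)" "closed M"
  obtains m where "m \<in> M" "\<And>y. y \<in> M \<Longrightarrow> norm (x - m) \<le> norm (x - y)"
proof -
  define d where "d = (INF y\<in>M. norm (x - y))"
  have ne: "M \<noteq> {}" using subspaceD(1)[OF M(1)] by auto
  have d: "d \<le> norm (x - y)" if "y \<in> M" for y
    unfolding d_def by (rule cINF_lower) (use that in \<open>auto intro: bdd_belowI[of _ 0]\<close>)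
  have "\<exists>y\<in>M. norm (x - y) < d + 1 / real (Suc n)" for n
    using cInf_lessD[of "(\<lambda>y. norm (x - y)) ` M" "d + 1 / real (Suc n)"] ne by (auto simp: d_def)
  then obtain y where y: "\<And>n. y n \<in> M" "\<And>n. norm (x - y n) < d + 1 / real (Suc n)" by metis
  have d0: "0 \<le> d" unfolding d_def by (rule cINF_greatest[OF ne]) auto
  have lim: "(\<lambda>n. norm (x - y n)) \<longlonglongrightarrow> d"
  proof (rule tendsto_sandwich[OF _ _ tendsto_const])
    show "(\<lambda>n. d + 1 / real (Suc n)) \<longlonglongrightarrow> d"
      using tendsto_add[OF tendsto_const LIMSEQ_inverse_real_of_nat, of d]
      by (simp add: inverse_eq_divide)
  qed (use d y in \<open>auto intro!: always_eventually less_imp_le\<close>)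
  have par: "(norm (y m - y n))\<^sup>2 \<le> 2 * (norm (x - y n))\<^sup>2 + 2 * (norm (x - y m))\<^sup>2 - 4 * d\<^sup>2" for m n
  proof -
    have "(1/2) *\<^sub>R (y m + y n) \<in> M"
      using subspaceD(2,3)[OF M(1)] y(1) by (simp add: scaleR_scaleC)
    then have "d \<le> norm (x - (1/2) *\<^sub>R (y m + y n))" by (rule d)
    moreover have "(x - y n) + (x - y m) = 2 *\<^sub>R (x - (1/2) *\<^sub>R (y m + y n))"
      by (simp add: algebra_simps scaleR_2)
    ultimately have "2 * d \<le> norm ((x - y n) + (x - y m))" by simp
    then have "(2 * d)\<^sup>2 \<le> (norm ((x - y n) + (x - y m)))\<^sup>2" using d0 by (intro power_mono) auto
    with parallelogram[of "x - y n" "x - y m"] show ?thesis by (simp add: power_mult_distrib)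
  qed
  have "Cauchy y"
  proof (rule metric_CauchyI)
    fix e :: real assume e: "0 < e"
    have "(\<lambda>n. 2 * (norm (x - y n))\<^sup>2 - 2 * d\<^sup>2) \<longlonglongrightarrow> 2 * d\<^sup>2 - 2 * d\<^sup>2"
      by (intro tendsto_intros lim)
    then have "\<forall>\<^sub>F n in sequentially. 2 * (norm (x - y n))\<^sup>2 - 2 * d\<^sup>2 < e\<^sup>2 / 2"
      by (rule order_tendstoD(2)) (use e in auto)
    then obtain N where N: "\<And>n. n \<ge> N \<Longrightarrow> 2 * (norm (x - y n))\<^sup>2 - 2 * d\<^sup>2 < e\<^sup>2 / 2"
      by (auto simp: eventually_sequentially)
    have "dist (y m) (y n) < e" if "m \<ge> N" "n \<ge> N" for m n
    proof -
      have "(norm (y m - y n))\<^sup>2 < e\<^sup>2" using par[of m n] N[OF that(1)] N[OF that(2)] by simp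
      then show ?thesis using e by (simp add: dist_norm power2_less_imp_less)
    qed
    then show "\<exists>N. \<forall>m\<ge>N. \<forall>n\<ge>N. dist (y m) (y n) < e" by blast
  qed
  then obtain m where m: "y \<longlonglongrightarrow> m" by (metis Cauchy_convergent_iff convergent_def)
  have "m \<in> M" using closed_sequentially[OF M(2)] y(1) m by blast
  moreover have "norm (x - m) = d"
    by (rule LIMSEQ_unique[OF _ lim]) (intro tendsto_intros m)
  ultimately show ?thesis using that d by auto
qed

lemma orthogonal_decomposition:
  assumes M: "csubspace (M :: 'a::chilbert_space set)" "closed M"
  shows "\<exists>!m. m \<in> M \<and> (\<forall>y\<in>M. cinner y (x - m) = 0)"
proof (rule ex_ex1I)
  obtain m where m: "m \<in> M" "\<And>y. y \<in> M \<Longrightarrow> norm (x - m) \<le> norm (x - y)"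
    using exists_closest[OF M] by blast
  have "cinner y (x - m) = 0" if y: "y \<in> M" for y
  proof (cases "y = 0")
    case False
    \<comment> \<open>\<open>c\<close> gives the multiple of \<open>y\<close> nearest to
      \<open>x - m\<close>; adding it to \<open>m\<close> would lead closer to \<open>x\<close>
      unless it vanishes.\<close>
    define c where "c = cinner y (x - m) / of_real ((norm y)\<^sup>2)"
    have o: "cinner (c *\<^sub>C y) (x - m - c *\<^sub>C y) = 0"
    proof -
      have "c * cinner y y = cinner y (x - m)"
        using False by (simp add: c_def cinner_self del: of_real_power)
      moreover have "cinner (c *\<^sub>C y) (x - m - c *\<^sub>C y) = cnj c * (cinner y (x - m) - c * cinner y y)"
        by (simp add: cinner_simps algebra_simps)
      ultimately show ?thesis by simp
    qed
    have "(norm (x - m))\<^sup>2 = (norm (c *\<^sub>C y))\<^sup>2 + (norm (x - m - c *\<^sub>C y))\<^sup>2"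
      using pythagoras[OF o] by simp
    moreover have "norm (x - m) \<le> norm (x - m - c *\<^sub>C y)"
      using m(2)[of "m + c *\<^sub>C y"] subspaceD[OF M(1)] m(1) y by (simp add: diff_diff_eq)
    then have "(norm (x - m))\<^sup>2 \<le> (norm (x - m - c *\<^sub>C y))\<^sup>2" by (intro power_mono) auto
    ultimately have "norm (c *\<^sub>C y) = 0" by simp
    then have "c = 0" using False by (simp add: norm_scaleC)
    then show ?thesis using False by (simp add: c_def)
  qed simp
  with m(1) show "\<exists>m. m \<in> M \<and> (\<forall>y\<in>M. cinner y (x - m) = 0)" by blast
next
  fix m n assume m: "m \<in> M \<and> (\<forall>y\<in>M. cinner y (x - m) = 0)" and n: "n \<in> M \<and> (\<forall>y\<in>M. cinner y (x - n) = 0)"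
  have "m - n \<in> M" using m n csubspace_diff[OF M(1)] by blast
  then have "cinner (m - n) ((x - n) - (x - m)) = 0" using m n by (subst cinner_diff(2)) simp
  then have "cinner (m - n) (m - n) = 0" by simp
  then show "m = n" by (simp add: cinner_self_eq_0_iff)
qed

text \<open>The kernel of a nonzero \<open>f\<close> has codimension one, so a vector orthogonal to
  it, suitably scaled, represents \<open>f\<close>.\<close>

lemma riesz_representation:
  fixes f :: "'a::chilbert_space \<Rightarrow> complex"
  assumes f: "bounded_linear f" and fC: "\<And>c x. f (c *\<^sub>C x) = c * f x"
  shows "\<exists>z. \<forall>x. f x = cinner z x"
proof (cases "\<forall>x. f x = 0")
  case False
  then obtain u where u: "f u \<noteq> 0" by blast
  interpret f: bounded_linear f by fact
  define M where "M = {x. f x = 0}"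
  have M: "csubspace M" by (auto simp: cv.subspace_def M_def f.add f.zero fC)
  have "closed M" unfolding M_def
    by (intro closed_Collect_eq continuous_on_const linear_continuous_on f)
  then obtain m where m: "m \<in> M" "\<And>y. y \<in> M \<Longrightarrow> cinner y (u - m) = 0"
    using orthogonal_decomposition[OF M] by blast
  define w where "w = u - m"
  have fw: "f w = f u" using m(1) by (simp add: w_def f.diff M_def)
  have w0: "cinner w w \<noteq> 0" using fw u by (auto simp: cinner_self_eq_0_iff f.zero)
  have "f x = cinner (cnj (f w / cinner w w) *\<^sub>C w) x" for x
  proof -
    have "x - (f x / f w) *\<^sub>C w \<in> M" using u fw by (simp add: M_def f.diff fC)
    then have "cinner (x - (f x / f w) *\<^sub>C w) w = 0" using m(2) w_def by blast
    then have "cinner w (x - (f x / f w) *\<^sub>C w) = 0" by (simp add: cinner_eq_0_swap)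
    then have "cinner w x = f x / f w * cinner w w" by (simp add: cinner_simps)
    then show ?thesis using u fw w0 by (simp add: cinner_scaleC_left)
  qed
  then show ?thesis by blast
qed (rule exI[of _ 0], simp)

subsection \<open>The algebra of bounded operators as a type\<close>

typedef (overloaded) 'a bop =
  "{T :: 'a::chilbert_space \<Rightarrow> 'a. bounded_linear T \<and> (\<forall>c x. T (c *\<^sub>C x) = c *\<^sub>C T x)}"
  morphisms app Bop
  by (rule exI[of _ "\<lambda>x. 0"]) (simp add: scaleC_zero_right)

setup_lifting type_definition_bop

notation app (infixr "*\<^sub>V" 75)

lemma bop_eqI: "(\<And>x. S *\<^sub>V x = T *\<^sub>V x) \<Longrightarrow> S = T"
  by (metis app_inject ext)

lemma bounded_linear_app: "bounded_linear (app T)"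
  using app[of T] by simp

lemma app_scaleC [simp]: "T *\<^sub>V (c *\<^sub>C x) = c *\<^sub>C (T *\<^sub>V x)"
  using app[of T] by simp

lemma app_simps [simp]: "T *\<^sub>V (x + y) = T *\<^sub>V x + T *\<^sub>V y" "T *\<^sub>V (x - y) = T *\<^sub>V x - T *\<^sub>V y"
  "T *\<^sub>V 0 = 0" "T *\<^sub>V (- x) = - (T *\<^sub>V x)" "T *\<^sub>V (r *\<^sub>R x) = r *\<^sub>R (T *\<^sub>V x)"
  "T *\<^sub>V (\<Sum>i\<in>I. f i) = (\<Sum>i\<in>I. T *\<^sub>V f i)"
  using bounded_linear_app[of T]
  by (simp_all add: linear_simps linear_sum[OF bounded_linear.linear])

lemma tendsto_app [tendsto_intros]: "(f \<longlongrightarrow> l) F \<Longrightarrow> ((\<lambda>x. T *\<^sub>V f x) \<longlongrightarrow> T *\<^sub>V l) F"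
  by (rule bounded_linear.tendsto[OF bounded_linear_app])

lemma continuous_on_app: "continuous_on S (app T)"
  by (rule linear_continuous_on[OF bounded_linear_app])

text \<open>\<open>real_normed_algebra_1\<close> would demand \<open>norm 1 = 1\<close>, which fails
  on the zero space; hence the separate instances and the mere inequality
  \<open>norm_one_bop\<close>.\<close>

instantiation bop :: (chilbert_space) "{real_normed_algebra, one, power}"
begin
lift_definition zero_bop :: "'a bop" is "\<lambda>x. 0" by (simp add: scaleC_zero_right)
lift_definition one_bop :: "'a bop" is "\<lambda>x. x" by simp
lift_definition plus_bop :: "'a bop \<Rightarrow> 'a bop \<Rightarrow> 'a bop" is "\<lambda>S T x. S x + T x"
  by (auto simp: scaleC_add_right intro: bounded_linear_add)
lift_definition minus_bop :: "'a bop \<Rightarrow> 'a bop \<Rightarrow> 'a bop" is "\<lambda>S T x. S x - T x"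
  by (auto simp: cv.scale_right_diff_distrib intro: bounded_linear_sub)
lift_definition uminus_bop :: "'a bop \<Rightarrow> 'a bop" is "\<lambda>T x. - T x"
  by (auto intro: bounded_linear_minus)
lift_definition times_bop :: "'a bop \<Rightarrow> 'a bop \<Rightarrow> 'a bop" is "\<lambda>S T x. S (T x)"
  by (auto intro: bounded_linear_compose)
lift_definition scaleR_bop :: "real \<Rightarrow> 'a bop \<Rightarrow> 'a bop" is "\<lambda>r T x. r *\<^sub>R T x"
  by (auto simp: scaleR_scaleC scaleC_scaleC mult.commute
      intro: bounded_linear_compose[OF bounded_linear_scaleC])
lift_definition norm_bop :: "'a bop \<Rightarrow> real" is onorm .
lemma app_ops [simp]: "(0::'a::chilbert_space bop) *\<^sub>V x = 0" "(1::'a bop) *\<^sub>V x = x" "(S + T) *\<^sub>V x = S *\<^sub>V x + T *\<^sub>V x"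
  "(S - T) *\<^sub>V x = S *\<^sub>V x - T *\<^sub>V x" "(- T) *\<^sub>V x = - (T *\<^sub>V x)" "(S * T) *\<^sub>V x = S *\<^sub>V (T *\<^sub>V x)"
  "(r *\<^sub>R T) *\<^sub>V x = r *\<^sub>R (T *\<^sub>V x)"
  by (transfer; simp)+

lemma norm_app: "norm (T *\<^sub>V x) \<le> norm T * norm x"
  by transfer (simp add: onorm)

lemma norm_bop_bound: "0 \<le> b \<Longrightarrow> (\<And>x. norm (T *\<^sub>V x) \<le> b * norm x) \<Longrightarrow> norm T \<le> b"
  by transfer (rule onorm_bound)

definition "dist_bop (S::'a bop) T = norm (S - T)"
definition "sgn_bop (T::'a bop) = inverse (norm T) *\<^sub>R T"
definition "(uniformity :: ('a bop \<times> 'a bop) filter) = (INF e\<in>{0 <..}. principal {(S, T). dist S T < e})"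
definition "open_bop (U::'a bop set) = (\<forall>S\<in>U. eventually (\<lambda>(S', T). S' = S \<longrightarrow> T \<in> U) uniformity)"

instance
proof
  fix S T U :: "'a bop" and r s :: real
  show "norm T = 0 \<longleftrightarrow> T = 0"
  proof
    assume "norm T = 0"
    then have "norm (T *\<^sub>V x) \<le> 0" for x using norm_app[of T x] by simp
    then show "T = 0" by (intro bop_eqI) simp
  next
    assume "T = 0" then show "norm T = 0" by transfer (simp add: onorm_zero)
  qed
  have nn: "0 \<le> norm V" for V :: "'a bop" by transfer (simp add: onorm_pos_le)
  show "norm (S + T) \<le> norm S + norm T" by transfer (simp add: onorm_triangle)
  show "norm (r *\<^sub>R T) = \<bar>r\<bar> * norm T" by transfer (simp add: onorm_scaleR)
  show "norm (S * T) \<le> norm S * norm T"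
  proof (rule norm_bop_bound)
    fix x
    have "norm (S *\<^sub>V T *\<^sub>V x) \<le> norm S * norm (T *\<^sub>V x)" by (rule norm_app)
    also have "\<dots> \<le> norm S * (norm T * norm x)" by (intro mult_left_mono norm_app nn)
    finally show "norm ((S * T) *\<^sub>V x) \<le> norm S * norm T * norm x" by (simp add: mult.assoc)
  qed (simp add: nn)
qed (auto intro!: bop_eqI simp: dist_bop_def sgn_bop_def uniformity_bop_def open_bop_def algebra_simps)
end

instance bop :: (chilbert_space) monoid_mult
  by standard (auto intro!: bop_eqI)

lemma app_power: "(T ^ n) *\<^sub>V x = (app T ^^ n) x"
  by (induction n arbitrary: x) (auto simp: power_Suc2 funpow_swap1 simp del: power_Suc)

lemma norm_one_bop: "norm (1::'a::chilbert_space bop) \<le> 1"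
  by (rule norm_bop_bound) auto

instance bop :: (chilbert_space) banach
proof
  fix X :: "nat \<Rightarrow> 'a bop" assume X: "Cauchy X"
  have C: "Cauchy (\<lambda>n. X n *\<^sub>V x)" for x
  proof (rule CauchyI)
    fix e :: real assume e: "0 < e"
    obtain N where N: "\<And>m n. m \<ge> N \<Longrightarrow> n \<ge> N \<Longrightarrow> norm (X m - X n) < e / (norm x + 1)"
      using CauchyD[OF X, of "e / (norm x + 1)"] e
      by (metis add_pos_nonneg divide_pos_pos norm_ge_zero zero_less_one add.commute)
    have "norm (X m *\<^sub>V x - X n *\<^sub>V x) < e" if "m \<ge> N" "n \<ge> N" for m n
    proof -
      have "norm (X m *\<^sub>V x - X n *\<^sub>V x) \<le> norm (X m - X n) * norm x"
        using norm_app[of "X m - X n" x] by simp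
      also have "\<dots> \<le> e / (norm x + 1) * norm x"
        by (intro mult_right_mono less_imp_le[OF N] that) simp
      also have "\<dots> < e" using e by (simp add: field_simps add_pos_nonneg)
      finally show ?thesis .
    qed
    then show "\<exists>M. \<forall>m\<ge>M. \<forall>n\<ge>M. norm (X m *\<^sub>V x - X n *\<^sub>V x) < e" by blast
  qed
  define L where "L x = lim (\<lambda>n. X n *\<^sub>V x)" for x
  have L: "(\<lambda>n. X n *\<^sub>V x) \<longlonglongrightarrow> L x" for x
    unfolding L_def using C[of x] by (simp add: Cauchy_convergent_iff convergent_LIMSEQ_iff)
  obtain B where B: "\<And>n. norm (X n) \<le> B"
    using Cauchy_Bseq[OF X] by (auto simp: Bseq_def)
  have "bounded_linear L \<and> (\<forall>c x. L (c *\<^sub>C x) = c *\<^sub>C L x)"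
  proof (intro conjI allI)
    show "bounded_linear L"
    proof (rule bounded_linear_intro)
      show "L (x + y) = L x + L y" for x y
        using LIMSEQ_unique[OF L] tendsto_add[OF L[of x] L[of y]] by simp
      show "L (r *\<^sub>R x) = r *\<^sub>R L x" for r x
        using LIMSEQ_unique[OF L] tendsto_scaleR[OF tendsto_const L[of x]] by simp
      show "norm (L x) \<le> norm x * B" for x
      proof (rule LIMSEQ_le_const2[OF tendsto_norm[OF L]])
        show "\<exists>N. \<forall>n\<ge>N. norm (X n *\<^sub>V x) \<le> norm x * B"
          by (metis B mult.commute mult_right_mono norm_app norm_ge_zero order_trans)
      qed
    qed
    show "L (c *\<^sub>C x) = c *\<^sub>C L x" for c x
      using LIMSEQ_unique[OF L] tendsto_scaleC[OF L[of x]] by simp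
  qed
  then have app_L: "app (Bop L) = L" by (simp add: Bop_inverse)
  have "X \<longlonglongrightarrow> Bop L"
  proof (rule LIMSEQ_I)
    fix e :: real assume e: "0 < e"
    obtain N where N: "\<And>m n. m \<ge> N \<Longrightarrow> n \<ge> N \<Longrightarrow> norm (X m - X n) < e / 2"
      using CauchyD[OF X, of "e / 2"] e by auto
    have "norm (X n - Bop L) \<le> e / 2" if n: "n \<ge> N" for n
    proof (rule norm_bop_bound)
      fix x
      have "(\<lambda>m. norm (X n *\<^sub>V x - X m *\<^sub>V x)) \<longlonglongrightarrow> norm (X n *\<^sub>V x - L x)"
        by (intro tendsto_intros L)
      moreover have "norm (X n *\<^sub>V x - X m *\<^sub>V x) \<le> e / 2 * norm x" if "m \<ge> N" for m
        using norm_app[of "X n - X m" x] mult_right_mono[OF less_imp_le[OF N[OF n that]], of "norm x"]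
        by simp
      ultimately have "norm (X n *\<^sub>V x - L x) \<le> e / 2 * norm x"
        by (intro LIMSEQ_le_const2) blast+
      then show "norm ((X n - Bop L) *\<^sub>V x) \<le> e / 2 * norm x" by (simp add: app_L)
    qed (use e in simp)
    then show "\<exists>no. \<forall>n\<ge>no. norm (X n - Bop L) < e"
      using e by (metis field_sum_of_halves less_add_same_cancel1 order_le_less_trans zero_less_divide_iff zero_less_numeral)
  qed
  then show "convergent X" by (auto simp: convergent_def)
qed

subsection \<open>The open mapping theorem\<close>

text \<open>Baire's theorem in the range yields approximate preimages of controlled norm, and summing the
  successive corrections yields exact ones.\<close>

lemma closed_range_approx_preimage:
  fixes f :: "'b::banach \<Rightarrow> 'c::banach"
  assumes f: "bounded_linear f" and V: "subspace V" and W: "closed (f ` V)"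
  shows "\<exists>C>0. \<forall>w\<in>f ` V. \<exists>v\<in>V. norm v \<le> C * norm w \<and> norm (w - f v) \<le> norm w / 2"
proof -
  interpret f: bounded_linear f by fact
  interpret S: Submetric UNIV dist "f ` V" by unfold_locales auto
  define D where "D n = f ` (V \<inter> cball 0 (real n))" for n
  have sW: "subspace (f ` V)" by (rule linear_subspace_image[OF f.linear_axioms V])
  have compl: "S.sub.mcomplete"
    by (rule S.closedin_mcomplete_imp_mcomplete) (use W in \<open>auto simp: complete_UNIV\<close>)
  have "\<exists>n. S.sub.mtopology interior_of (closure (D n) \<inter> f ` V) \<noteq> {}"
  proof (rule ccontr)
    assume "\<not> ?thesis"
    moreover have "closedin S.sub.mtopology (closure (D n) \<inter> f ` V)" for n
      by (auto simp: S.mtopology_submetric closedin_subtopology intro!: exI[of _ "closure (D n)"])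
    ultimately have "S.sub.mtopology interior_of (\<Union>n. closure (D n) \<inter> f ` V) = {}"
      by (intro S.sub.metric_Baire_category_alt[OF compl]) auto
    moreover have "(\<Union>n. closure (D n) \<inter> f ` V) = f ` V"
    proof -
      have "f v \<in> (\<Union>n. closure (D n))" if "v \<in> V" for v
      proof -
        obtain n where "norm v \<le> real n" using real_arch_simple by blast
        then have "f v \<in> D n" using that by (auto simp: D_def)
        then show ?thesis using closure_subset by blast
      qed
      then show ?thesis by blast
    qed
    moreover have "S.sub.mtopology interior_of (f ` V) = f ` V"
      by (metis S.sub.topspace_mtopology interior_of_topspace)
    ultimately show False using subspace_0[OF V] by auto
  qed
  then obtain n w0 where "w0 \<in> S.sub.mtopology interior_of (closure (D n) \<inter> f ` V)" by auto
  then obtain U where U: "openin S.sub.mtopology U" "w0 \<in> U" "U \<subseteq> closure (D n) \<inter> f ` V"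
    by (auto simp: interior_of_def)
  then obtain O' where O': "open O'" "U = O' \<inter> f ` V"
    by (auto simp: S.mtopology_submetric openin_subtopology)
  then obtain e where e: "e > 0" "cball w0 e \<subseteq> O'" using U(2) open_contains_cball by blast
  have w0: "w0 \<in> closure (D n)" "w0 \<in> f ` V" using U by auto
  have approach: "\<exists>a. a \<in> V \<and> norm a \<le> real n \<and> dist (f a) u < e / 4" if "u \<in> closure (D n)" for u
  proof -
    have "\<exists>y\<in>D n. dist y u < e / 4" using that e(1) unfolding closure_approachable
      by (meson divide_pos_pos zero_less_numeral)
    then show ?thesis by (auto simp: D_def)
  qed
  define C where "C = 2 * (real n + 1) / e"
  have "\<exists>v\<in>V. norm v \<le> C * norm w \<and> norm (w - f v) \<le> norm w / 2" if w: "w \<in> f ` V" for w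
  proof (cases "w = 0")
    case True
    then show ?thesis using subspace_0[OF V] by (intro bexI[of _ 0]) (auto simp: f.zero)
  next
    case False
    define t where "t = e / norm w"
    have t: "t > 0" using e False by (simp add: t_def)
    have "w0 + t *\<^sub>R w \<in> O'"
      using e by (intro subsetD[OF e(2)]) (simp add: t_def dist_norm False)
    moreover have "w0 + t *\<^sub>R w \<in> f ` V" using w w0 sW by (simp add: subspace_add subspace_scale)
    ultimately have "w0 + t *\<^sub>R w \<in> closure (D n)" using U O' by blast
    then obtain a where a: "a \<in> V" "norm a \<le> real n" "dist (f a) (w0 + t *\<^sub>R w) < e / 4"
      using approach by blast
    obtain b where b: "b \<in> V" "norm b \<le> real n" "dist (f b) w0 < e / 4"
      using approach[OF w0(1)] by blast
    \<comment> \<open>\<open>t\<close> stretches \<open>w\<close> to length \<open>e\<close>, the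
      radius of a ball around \<open>w0\<close> in which the range is approximated by
      \<open>D n\<close>. The difference of two approximate preimages moves the centre from
      \<open>w0\<close> to 0, and \<open>1 / t\<close> undoes the stretching.\<close>
    define v where "v = (1 / t) *\<^sub>R (a - b)"
    have "v \<in> V" using a b V by (simp add: v_def subspace_diff subspace_scale)
    moreover have "norm v \<le> C * norm w"
    proof -
      have "norm (a - b) \<le> 2 * (real n + 1)" using norm_triangle_ineq4[of a b] a(2) b(2) by argo
      then have "norm v \<le> 1 / t * (2 * (real n + 1))"
        unfolding v_def norm_scaleR using t by (intro mult_mono) auto
      also have "\<dots> = C * norm w" using e False by (simp add: C_def t_def)
      finally show ?thesis .
    qed
    moreover have "norm (w - f v) \<le> norm w / 2"
    proof -
      have "t *\<^sub>R (w - f v) = (w0 + t *\<^sub>R w - f a) - (w0 - f b)"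
        using t by (simp add: v_def f.scaleR f.diff scaleR_diff_right)
      then have "t * norm (w - f v) \<le> norm (w0 + t *\<^sub>R w - f a) + norm (w0 - f b)"
        using t norm_triangle_ineq4[of "w0 + t *\<^sub>R w - f a" "w0 - f b"]
        by (metis abs_of_pos norm_scaleR)
      also have "\<dots> \<le> e / 2" using a(3) b(3) by (simp add: dist_norm norm_minus_commute)
      finally have "norm (w - f v) * e \<le> norm w / 2 * e" using False by (simp add: t_def field_simps)
      then show ?thesis using e(1) by simp
    qed
    ultimately show ?thesis by blast
  qed
  moreover have "C > 0" using e by (simp add: C_def)
  ultimately show ?thesis by blast
qed

theorem closed_range_bounded_preimage:
  fixes f :: "'b::banach \<Rightarrow> 'c::banach"
  assumes f: "bounded_linear f" and V: "subspace V" "closed V" and W: "closed (f ` V)"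
  shows "\<exists>C. \<forall>w\<in>f ` V. \<exists>v\<in>V. f v = w \<and> norm v \<le> C * norm w"
proof -
  interpret f: bounded_linear f by fact
  obtain C where C: "C > 0"
      "\<And>w. w \<in> f ` V \<Longrightarrow> \<exists>v\<in>V. norm v \<le> C * norm w \<and> norm (w - f v) \<le> norm w / 2"
    using closed_range_approx_preimage[OF f V(1) W] by blast
  then obtain g where g: "\<And>w. w \<in> f ` V \<Longrightarrow> g w \<in> V" "\<And>w. w \<in> f ` V \<Longrightarrow> norm (g w) \<le> C * norm w"
      "\<And>w. w \<in> f ` V \<Longrightarrow> norm (w - f (g w)) \<le> norm w / 2" by metis
  have sW: "subspace (f ` V)" by (rule linear_subspace_image[OF f.linear_axioms V(1)])
  have "\<exists>v\<in>V. f v = w \<and> norm v \<le> (2 * C) * norm w" if w: "w \<in> f ` V" for w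
  proof -
    define r where "r = rec_nat w (\<lambda>_ u. u - f (g u))"
    have r: "r 0 = w" "\<And>k. r (Suc k) = r k - f (g (r k))" by (simp_all add: r_def)
    have rW: "r k \<in> f ` V" for k
      by (induction k) (use w g(1) sW in \<open>auto simp: r subspace_diff\<close>)
    have rn: "norm (r k) \<le> norm w * (1/2) ^ k" for k
    proof (induction k)
      case (Suc k)
      then show ?case using g(3)[OF rW[of k]] by (simp add: r)
    qed (simp add: r)
    have gn: "norm (g (r k)) \<le> C * norm w * (1/2) ^ k" for k
      using g(2)[OF rW[of k]] mult_left_mono[OF rn[of k], of C] C(1)
      by (simp only: mult.assoc) linarith
    have geo: "summable (\<lambda>k. C * norm w * (1/2::real) ^ k)" by (intro summable_mult summable_geometric) simp
    have sg: "summable (\<lambda>k. g (r k))" by (rule summable_comparison_test'[OF geo]) (use gn in auto)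
    have "(\<Sum>k. g (r k)) \<in> V"
      by (rule closed_sequentially[OF V(2) _ summable_LIMSEQ[OF sg]])
        (use g(1) rW V(1) in \<open>auto intro: subspace_sum\<close>)
    moreover have "f (\<Sum>k. g (r k)) = w"
    proof -
      have part: "f (\<Sum>k<n. g (r k)) = w - r n" for n
        by (induction n) (simp_all add: r f.add f.zero)
      have "(\<lambda>n. w - r n) \<longlonglongrightarrow> f (\<Sum>k. g (r k))"
        using f.tendsto[OF summable_LIMSEQ[OF sg]] by (simp add: part)
      moreover have "r \<longlonglongrightarrow> 0"
      proof (rule Lim_null_comparison)
        show "(\<lambda>n. norm w * (1/2::real) ^ n) \<longlonglongrightarrow> 0"
          by (intro tendsto_mult_right_zero LIMSEQ_realpow_zero) auto
      qed (use rn in auto)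
      then have "(\<lambda>n. w - r n) \<longlonglongrightarrow> w - 0" by (intro tendsto_intros)
      ultimately show ?thesis using LIMSEQ_unique by fastforce
    qed
    moreover have "norm (\<Sum>k. g (r k)) \<le> (2 * C) * norm w"
    proof -
      have "norm (\<Sum>k. g (r k)) \<le> (\<Sum>k. C * norm w * (1/2) ^ k)"
        by (rule norm_suminf_le[OF gn geo])
      also have "\<dots> = C * norm w * 2"
        by (subst suminf_mult) (simp_all add: suminf_geometric summable_geometric)
      finally show ?thesis by (simp add: mult_ac)
    qed
    ultimately show ?thesis by blast
  qed
  then show ?thesis by blast
qed

subsection \<open>Scalars, adjoints and orthogonal projections\<close>

lift_definition scal :: "complex \<Rightarrow> 'a::chilbert_space bop" is "\<lambda>z x. z *\<^sub>C x"
  by (auto simp: bounded_linear_scaleC scaleC_scaleC mult.commute)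

lemma app_scal [simp]: "scal z *\<^sub>V x = z *\<^sub>C x"
  by transfer simp

lemma scal_commute: "T * scal z = scal z * T"
  by (rule bop_eqI) simp

lemma scal_simps: "scal (z + w) = scal z + scal w" "scal (z * w) = scal z * scal w"
  "scal 1 = 1" "scal 0 = 0" "scal (- z) = - scal z" "scal (z - w) = scal z - scal w"
  by (rule bop_eqI;
      simp add: scaleC_add_left scaleC_scaleC scaleC_one cv.scale_left_diff_distrib)+

lemma scal_power: "scal (z ^ n) = scal z ^ n"
  by (induction n) (simp_all add: scal_simps)

definition adj :: "'a::chilbert_space bop \<Rightarrow> 'a bop"
  where "adj T = Bop (\<lambda>y. SOME z. \<forall>x. cinner y (T *\<^sub>V x) = cinner z x)"

lemma cmod_cinner_self: "cmod (cinner x x) = (norm (x::'a::chilbert_space))\<^sup>2"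
  by (simp add: cinner_self norm_power)

lemma cinner_left_cancel: "(\<And>x. cinner y x = cinner z x) \<Longrightarrow> y = (z::'a::chilbert_space)"
  using cinner_self_eq_0_iff[of "y - z"] by (simp add: cinner_diff)

lemma cinner_adj: "cinner (adj T *\<^sub>V y) x = cinner y (T *\<^sub>V x)"
proof -
  define A where "A y = (SOME z. \<forall>x. cinner y (T *\<^sub>V x) = cinner z x)" for y
  have A: "cinner y (T *\<^sub>V x) = cinner (A y) x" for x y
  proof -
    have "\<exists>z. \<forall>x. cinner y (T *\<^sub>V x) = cinner z x"
      by (rule riesz_representation)
        (auto simp: cinner_scaleC_right
          intro!: bounded_linear_compose[OF bounded_bilinear.bounded_linear_right[OF bounded_bilinear_cinner]
            bounded_linear_app])
    from someI_ex[OF this] show ?thesis unfolding A_def by blast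
  qed
  have sc: "A (c *\<^sub>C y) = c *\<^sub>C A y" for c y
    by (rule cinner_left_cancel) (simp add: A[symmetric] cinner_scaleC_left)
  have bd: "norm (A y) \<le> norm y * norm T" for y
  proof (cases "A y = 0")
    case False
    have "(norm (A y))\<^sup>2 = cmod (cinner y (T *\<^sub>V A y))"
      by (simp only: A cmod_cinner_self)
    also have "\<dots> \<le> norm y * (norm T * norm (A y))"
      by (rule order_trans[OF cauchy_schwarz mult_left_mono[OF norm_app]]) simp
    finally show ?thesis using False by (simp add: power2_eq_square)
  qed simp
  have ad: "A (x + y) = A x + A y" for x y
    by (rule cinner_left_cancel) (simp add: A[symmetric] cinner_add_left)
  have "bounded_linear A"
    by (rule bounded_linear_intro[OF ad _ bd]) (simp add: sc scaleR_scaleC)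
  then have "app (Bop A) = A" using sc by (simp add: Bop_inverse)
  then show ?thesis unfolding adj_def A_def[symmetric] using A by simp
qed

lemma adj_eqI: "(\<And>x y. cinner (S *\<^sub>V y) x = cinner y (T *\<^sub>V x)) \<Longrightarrow> adj T = S"
  by (intro bop_eqI cinner_left_cancel) (simp add: cinner_adj)

lemma cinner_adj': "cinner x (adj T *\<^sub>V y) = cinner (T *\<^sub>V x) y"
  by (metis cinner_adj cinner_commute)

lemma adj_adj [simp]: "adj (adj T) = T"
  by (rule adj_eqI) (simp add: cinner_adj')

lemma adj_simps: "adj (S * T) = adj T * adj S" "adj (S + T) = adj S + adj T"
  "adj (S - T) = adj S - adj T" "adj (1::'a::chilbert_space bop) = 1" "adj (0::'a bop) = 0"
  "adj (r *\<^sub>R S) = r *\<^sub>R adj S"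
  by (rule adj_eqI; simp add: cinner_adj cinner_simps scaleR_scaleC)+

lemma norm_adj_le: "norm (adj T) \<le> norm T"
proof (rule norm_bop_bound)
  fix y
  show "norm (adj T *\<^sub>V y) \<le> norm T * norm y"
  proof (cases "adj T *\<^sub>V y = 0")
    case False
    have "(norm (adj T *\<^sub>V y))\<^sup>2 = cmod (cinner y (T *\<^sub>V adj T *\<^sub>V y))"
      by (simp only: cinner_adj[of T y, symmetric] cmod_cinner_self)
    also have "\<dots> \<le> norm y * (norm T * norm (adj T *\<^sub>V y))"
      by (rule order_trans[OF cauchy_schwarz mult_left_mono[OF norm_app]]) simp
    finally show ?thesis using False by (simp add: power2_eq_square mult.commute)
  qed simp
qed simp

lemma norm_adj [simp]: "norm (adj T) = norm T"
  using norm_adj_le[of T] norm_adj_le[of "adj T"] by simp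

definition orth_proj :: "'a::chilbert_space bop \<Rightarrow> bool"
  where "orth_proj P \<longleftrightarrow> P * P = P \<and> adj P = P"

lemma orth_projD:
  assumes "orth_proj P"
  shows "P * P = P" "adj P = P" "P *\<^sub>V P *\<^sub>V x = P *\<^sub>V x" "cinner (P *\<^sub>V x) y = cinner x (P *\<^sub>V y)"
    "P * (P * T) = P * T"
proof -
  show *: "P * P = P" "adj P = P" using assms by (auto simp: orth_proj_def)
  show "P *\<^sub>V P *\<^sub>V x = P *\<^sub>V x" using *(1) by (metis app_ops(6))
  show "cinner (P *\<^sub>V x) y = cinner x (P *\<^sub>V y)" using *(2) cinner_adj[of P] by simp
  show "P * (P * T) = P * T" using *(1) by (metis mult.assoc)
qed

lemma orth_proj_0 [simp]: "orth_proj 0" and orth_proj_1 [simp]: "orth_proj 1"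
  by (auto simp: orth_proj_def adj_simps)

lemma orth_proj_compl: "orth_proj P \<Longrightarrow> orth_proj (1 - P)"
  by (simp add: orth_proj_def adj_simps algebra_simps)

lemma orth_proj_norm_sq:
  assumes "orth_proj P"
  shows "(norm x)\<^sup>2 = (norm (P *\<^sub>V x))\<^sup>2 + (norm (x - P *\<^sub>V x))\<^sup>2"
  using pythagoras[of "P *\<^sub>V x" "x - P *\<^sub>V x"] orth_projD[OF assms]
  by (simp add: cinner_diff)

lemma orth_proj_norm_le: "orth_proj P \<Longrightarrow> norm (P *\<^sub>V x) \<le> norm x"
  using orth_proj_norm_sq[of P x] by (simp add: power2_le_imp_le)

lemma norm_orth_proj: "orth_proj P \<Longrightarrow> norm P \<le> 1"
  by (rule norm_bop_bound) (auto simp: orth_proj_norm_le)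

lemma norm_mult_proj: "orth_proj P \<Longrightarrow> norm (T * P) \<le> norm T" "orth_proj P \<Longrightarrow> norm (P * T) \<le> norm T"
  using norm_mult_ineq[of T P] norm_mult_ineq[of P T] norm_orth_proj[of P]
    mult_left_mono[of "norm P" 1 "norm T"] mult_right_mono[of "norm P" 1 "norm T"]
  by auto

lemma proj_mult_swap: "orth_proj P \<Longrightarrow> orth_proj Q \<Longrightarrow> P * Q = Q \<Longrightarrow> Q * P = Q"
  by (metis adj_simps(1) orth_projD(2))

lemma proj_zero_swap: "orth_proj P \<Longrightarrow> orth_proj Q \<Longrightarrow> P * Q = 0 \<Longrightarrow> Q * P = 0"
  by (metis adj_simps(1,5) orth_projD(2))

lemma orth_proj_diff: "orth_proj P \<Longrightarrow> orth_proj Q \<Longrightarrow> P * Q = Q \<Longrightarrow> orth_proj (P - Q)"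
  using proj_mult_swap[of P Q] by (simp add: orth_proj_def adj_simps algebra_simps)

lemma orth_proj_add: "orth_proj P \<Longrightarrow> orth_proj Q \<Longrightarrow> P * Q = 0 \<Longrightarrow> orth_proj (P + Q)"
  using proj_zero_swap[of P Q] by (simp add: orth_proj_def adj_simps algebra_simps)

definition proj :: "'a::chilbert_space set \<Rightarrow> 'a bop"
  where "proj M = Bop (\<lambda>x. THE m. m \<in> M \<and> (\<forall>y\<in>M. cinner y (x - m) = 0))"

lemma proj_props:
  assumes M: "csubspace (M :: 'a::chilbert_space set)" "closed M"
  shows "proj M *\<^sub>V x \<in> M" and "y \<in> M \<Longrightarrow> cinner y (x - proj M *\<^sub>V x) = 0"
    and proj_eqI: "m \<in> M \<Longrightarrow> (\<And>y. y \<in> M \<Longrightarrow> cinner y (x - m) = 0) \<Longrightarrow> proj M *\<^sub>V x = m"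
proof -
  define p where "p x = (THE m. m \<in> M \<and> (\<forall>y\<in>M. cinner y (x - m) = 0))" for x
  note S = subspaceD[OF M(1)]
  have p: "p x \<in> M" "y \<in> M \<Longrightarrow> cinner y (x - p x) = 0" for x y
    using theI'[OF orthogonal_decomposition[OF M, of x]] unfolding p_def by blast+
  have u: "p x = m" if "m \<in> M" "\<And>y. y \<in> M \<Longrightarrow> cinner y (x - m) = 0" for x m
    unfolding p_def by (rule the1_equality[OF orthogonal_decomposition[OF M]]) (use that in blast)
  have add: "p (x + y) = p x + p y" for x y
  proof (rule u)
    fix z assume "z \<in> M"
    then have "cinner z (x - p x) + cinner z (y - p y) = 0" using p by simp
    then show "cinner z (x + y - (p x + p y)) = 0" by (simp add: cinner_simps algebra_simps)
  qed (use p S in auto)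
  have sc: "p (c *\<^sub>C x) = c *\<^sub>C p x" for c x
  proof (rule u)
    fix z assume "z \<in> M"
    then have "c * cinner z (x - p x) = 0" using p by simp
    then show "cinner z (c *\<^sub>C x - c *\<^sub>C p x) = 0" by (simp add: cinner_simps algebra_simps)
  qed (use p S in auto)
  have "norm (p x) \<le> norm x * 1" for x
  proof -
    have "(norm x)\<^sup>2 = (norm (p x))\<^sup>2 + (norm (x - p x))\<^sup>2"
      using pythagoras[OF p(2)[OF p(1)], of x x] by simp
    then show ?thesis by (simp add: power2_le_imp_le)
  qed
  then have "bounded_linear p"
    by (intro bounded_linear_intro[of p 1] add) (simp_all add: scaleR_scaleC sc)
  then have "app (Bop p) = p" using sc by (simp add: Bop_inverse)
  then have eq: "app (proj M) = p" unfolding proj_def p_def[abs_def] by simp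
  show "proj M *\<^sub>V x \<in> M" "y \<in> M \<Longrightarrow> cinner y (x - proj M *\<^sub>V x) = 0"
    "m \<in> M \<Longrightarrow> (\<And>y. y \<in> M \<Longrightarrow> cinner y (x - m) = 0) \<Longrightarrow> proj M *\<^sub>V x = m"
    unfolding eq using p u by blast+
qed

lemma proj_id: "csubspace M \<Longrightarrow> closed M \<Longrightarrow> x \<in> M \<Longrightarrow> proj M *\<^sub>V x = x"
  by (rule proj_eqI) auto

lemma orth_proj_proj:
  assumes M: "csubspace (M :: 'a::chilbert_space set)" "closed M"
  shows "orth_proj (proj M)"
  unfolding orth_proj_def
proof
  show "proj M * proj M = proj M"
    by (rule bop_eqI) (simp add: proj_id proj_props(1) M)
  show "adj (proj M) = proj M"
  proof (rule adj_eqI)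
    fix x y
    have "cinner (proj M *\<^sub>V y) (x - proj M *\<^sub>V x) = 0" "cinner (proj M *\<^sub>V x) (y - proj M *\<^sub>V y) = 0"
      using proj_props[OF M] by blast+
    then show "cinner (proj M *\<^sub>V y) x = cinner y (proj M *\<^sub>V x)"
      using cinner_commute[of "proj M *\<^sub>V x" y] cinner_commute[of "proj M *\<^sub>V x" "proj M *\<^sub>V y"]
      by (simp add: cinner_diff)
  qed
qed

lemma app_eq_csubspace: "csubspace {x. S *\<^sub>V x = T *\<^sub>V x}"
  by (auto simp: cv.subspace_def)

lemma app_eq_closed: "closed {x. S *\<^sub>V x = T *\<^sub>V x}"
  by (intro closed_Collect_eq continuous_on_app)

lemma fix_csubspace: "csubspace {x. P *\<^sub>V x = x}" and fix_closed: "closed {x. P *\<^sub>V x = x}"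
  and ker_csubspace: "csubspace {x. P *\<^sub>V x = 0}" and ker_closed: "closed {x. P *\<^sub>V x = 0}"
  using app_eq_csubspace[of P 1] app_eq_closed[of P 1] app_eq_csubspace[of P 0] app_eq_closed[of P 0]
  by simp_all

lemma range_csubspace: "csubspace N \<Longrightarrow> csubspace (app T ` N)"
  unfolding cv.subspace_def
  by (auto simp flip: app_simps(1) app_scaleC intro: image_eqI[where x = 0])

lemma csubspace_imp_subspace: "csubspace M \<Longrightarrow> subspace M"
  by (auto simp: subspace_def scaleR_scaleC intro: subspaceD)

subsection \<open>Rank one operators and orthonormal sequences\<close>

lift_definition rank1 :: "'a::chilbert_space \<Rightarrow> 'a \<Rightarrow> 'a bop" is "\<lambda>f g x. cinner g x *\<^sub>C f"
proof (intro conjI allI)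
  fix f g :: 'a
  show "bounded_linear (\<lambda>x. cinner g x *\<^sub>C f)"
  proof (rule bounded_linear_intro)
    show "norm (cinner g x *\<^sub>C f) \<le> norm x * (norm g * norm f)" for x
      using mult_right_mono[OF cauchy_schwarz[of g x], of "norm f"]
      by (simp add: norm_scaleC mult.assoc mult.left_commute)
  qed (simp_all add: cinner_simps scaleC_add_left scaleR_scaleC scaleC_scaleC)
qed (simp add: cinner_simps scaleC_scaleC)

lemma app_rank1 [simp]: "rank1 f g *\<^sub>V x = cinner g x *\<^sub>C f"
  by transfer simp

lemma adj_rank1: "adj (rank1 f g) = rank1 g f"
proof (rule adj_eqI)
  fix x y
  show "cinner (rank1 g f *\<^sub>V y) x = cinner y (rank1 f g *\<^sub>V x)"
    by (simp add: cinner_simps cinner_commute[of y f] mult.commute)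
qed

lemma orth_proj_rank1:
  assumes "norm e = 1 \<or> e = 0" shows "orth_proj (rank1 e e)"
proof -
  have "cinner e e *\<^sub>C e = e" using assms by (auto simp: cinner_self scaleC_one scaleC_zero_right)
  moreover have "rank1 e e *\<^sub>V rank1 e e *\<^sub>V x = cinner e x *\<^sub>C (cinner e e *\<^sub>C e)" for x
    by (simp add: scaleC_scaleC)
  ultimately show ?thesis unfolding orth_proj_def
    by (auto simp: adj_rank1 intro!: bop_eqI simp del: app_scaleC)
qed

text \<open>Some of the vectors may have norm less than 1, and may vanish.\<close>

definition orthonormal_seq :: "(nat \<Rightarrow> 'a::chilbert_space) \<Rightarrow> bool"
  where "orthonormal_seq e \<longleftrightarrow> (\<forall>i. norm (e i) \<le> 1) \<and> (\<forall>i j. i \<noteq> j \<longrightarrow> cinner (e i) (e j) = 0)"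

lemma norm_sum_orthogonal:
  assumes "orthonormal_seq e" "finite I"
  shows "(norm (\<Sum>i\<in>I. a i *\<^sub>C e i))\<^sup>2 = (\<Sum>i\<in>I. (cmod (a i))\<^sup>2 * (norm (e i))\<^sup>2)"
  using assms(2)
proof (induction I rule: finite_induct)
  case (insert i I)
  have "cinner (a i *\<^sub>C e i) (\<Sum>j\<in>I. a j *\<^sub>C e j) = (\<Sum>j\<in>I. cinner (a i *\<^sub>C e i) (a j *\<^sub>C e j))"
    by (rule cinner_sum)
  also have "\<dots> = 0"
  proof (rule sum.neutral, rule ballI)
    fix j assume "j \<in> I"
    then have "i \<noteq> j" using insert by auto
    then show "cinner (a i *\<^sub>C e i) (a j *\<^sub>C e j) = 0"
      using assms(1) by (simp add: cinner_simps orthonormal_seq_def)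
  qed
  finally show ?case
    using pythagoras[of "a i *\<^sub>C e i" "\<Sum>j\<in>I. a j *\<^sub>C e j"] insert
    by (simp add: norm_scaleC power_mult_distrib)
qed simp

lemma bessel:
  assumes e: "orthonormal_seq e" and I: "finite I"
  shows "(\<Sum>i\<in>I. (cmod (cinner (e i) x))\<^sup>2) \<le> (norm x)\<^sup>2"
proof -
  define s where "s = (\<Sum>i\<in>I. cinner (e i) x *\<^sub>C e i)"
  have "Re (cinner x s) = Re (cinner s x)" by (metis cinner_commute cnj.simps(1))
  also have "\<dots> = (\<Sum>i\<in>I. Re (cnj (cinner (e i) x) * cinner (e i) x))"
    by (simp only: s_def cinner_sum cinner_scaleC_left Re_sum)
  also have "\<dots> = (\<Sum>i\<in>I. (cmod (cinner (e i) x))\<^sup>2)"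
    by (rule sum.cong) (simp_all only: cmod_power2, simp add: power2_eq_square)
  finally have "Re (cinner x s) = (\<Sum>i\<in>I. (cmod (cinner (e i) x))\<^sup>2)" .
  moreover have "(norm s)\<^sup>2 \<le> (\<Sum>i\<in>I. (cmod (cinner (e i) x))\<^sup>2 * 1)"
    unfolding s_def norm_sum_orthogonal[OF e I]
    using e by (intro sum_mono mult_left_mono) (auto simp: orthonormal_seq_def power_le_one)
  moreover have "0 \<le> (norm (x - s))\<^sup>2" by simp
  ultimately show ?thesis by (simp add: norm_diff_sq)
qed

lemma orthonormal_seq_weakly_null:
  assumes "orthonormal_seq e" shows "(\<lambda>i. cinner (e i) x) \<longlonglongrightarrow> 0"
proof -
  have "summable (\<lambda>i. (cmod (cinner (e i) x))\<^sup>2)"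
    by (rule bounded_imp_summable[where B = "(norm x)\<^sup>2"]) (use bessel[OF assms] in auto)
  then have "(\<lambda>i. sqrt ((cmod (cinner (e i) x))\<^sup>2)) \<longlonglongrightarrow> sqrt 0"
    by (intro tendsto_real_sqrt summable_LIMSEQ_zero)
  then show ?thesis by (simp add: tendsto_norm_zero_iff)
qed

lemma orthonormal_seq_subseq: "orthonormal_seq e \<Longrightarrow> strict_mono r \<Longrightarrow> orthonormal_seq (e \<circ> r)"
  unfolding orthonormal_seq_def by (auto dest: strict_mono_eq)

text \<open>This covers both infinite dimension (\<open>W = {0}\<close>) and infinite codimension.\<close>

lemma infinite_codim_orthonormal_seq:
  assumes V: "csubspace (V :: 'a::chilbert_space set)" and W: "csubspace W" "closed W" "W \<subseteq> V"
    and inf: "\<not> cfinite_codim V W"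
  obtains e where "orthonormal_seq e" "\<And>k. e k \<in> V" "\<And>k. norm (e k) = 1"
    "\<And>k w. w \<in> W \<Longrightarrow> cinner w (e k) = 0"
proof -
  define Q where "Q e k v \<longleftrightarrow> v \<in> V \<and> norm v = 1 \<and> (\<forall>w\<in>W. cinner w v = 0) \<and> (\<forall>i<k. cinner (e i) v = 0)"
    for e :: "nat \<Rightarrow> 'a" and k v
  have "\<exists>f. \<forall>k. Q f k (f k)"
  proof (rule dependent_wellorder_choice)
    fix k and e :: "nat \<Rightarrow> 'a" assume e: "\<And>i. i < k \<Longrightarrow> Q e i (e i)"
    have eV: "e i \<in> V" "norm (e i) = 1" "w \<in> W \<Longrightarrow> cinner w (e i) = 0" if "i < k" for i w
      using e[OF that] by (auto simp: Q_def)
    have ee: "cinner (e i) (e j) = (if i = j then 1 else 0)" if "i < k" "j < k" for i j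
      using e[OF that(1)] e[OF that(2)] cinner_eq_0_swap[of "e i" "e j"]
      by (cases i j rule: linorder_cases) (auto simp: Q_def cinner_self)
    have "\<not> V \<subseteq> cspan (W \<union> e ` {..<k})"
      using inf eV unfolding cfinite_codim_def by (metis finite_imageI finite_lessThan image_subset_iff lessThan_iff)
    then obtain v where v: "v \<in> V" "v \<notin> cspan (W \<union> e ` {..<k})" by blast
    define s where "s = proj W *\<^sub>V v + (\<Sum>i<k. cinner (e i) v *\<^sub>C e i)"
    have s: "s \<in> cspan (W \<union> e ` {..<k})" unfolding s_def
      using proj_props(1)[OF W(1,2), of v]
      by (intro cv.span_add cv.span_sum cv.span_scale) (auto intro: cv.span_base)
    have "cspan (W \<union> e ` {..<k}) \<subseteq> V"
      using W(3) eV by (intro cv.span_minimal V) auto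
    then have sV: "v - s \<in> V" using s v(1) V csubspace_diff by blast
    have vs: "v - s \<noteq> 0" using s v by auto
    have o1: "cinner w (v - s) = 0" if "w \<in> W" for w
    proof -
      have "cinner w (v - proj W *\<^sub>V v) = 0" by (rule proj_props(2)[OF W(1,2) that])
      moreover have "(\<Sum>i<k. cinner w (cinner (e i) v *\<^sub>C e i)) = 0"
        using eV(3) that by (intro sum.neutral) (auto simp: cinner_simps)
      ultimately show ?thesis by (simp add: s_def cinner_simps cinner_sum)
    qed
    have o2: "cinner (e j) (v - s) = 0" if "j < k" for j
    proof -
      have "cinner (e j) (proj W *\<^sub>V v) = 0"
        using eV(3)[OF that proj_props(1)[OF W(1,2)]] cinner_eq_0_swap by blast
      moreover have "(\<Sum>i<k. cinner (e j) (cinner (e i) v *\<^sub>C e i)) = (\<Sum>i<k. if i = j then cinner (e j) v else 0)"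
        by (rule sum.cong) (use that in \<open>auto simp: cinner_simps ee\<close>)
      ultimately show ?thesis using that by (simp add: s_def cinner_simps cinner_sum)
    qed
    define u where "u = of_real (1 / norm (v - s)) *\<^sub>C (v - s)"
    have "Q e k u"
      using sV vs o1 o2 by (auto simp: Q_def u_def norm_scaleC norm_inverse norm_divide cinner_simps[symmetric]
          cinner_scaleC_right intro: subspaceD(3)[OF V])
    then show "\<exists>v. Q e k v" by blast
  qed (simp add: Q_def)
  then obtain f where f: "\<And>k. Q f k (f k)" by blast
  have "orthonormal_seq f" unfolding orthonormal_seq_def
  proof (intro conjI allI impI)
    fix i j :: nat assume "i \<noteq> j"
    then show "cinner (f i) (f j) = 0"
      using f[of i] f[of j] cinner_eq_0_swap[of "f i" "f j"]
      by (cases i j rule: linorder_cases) (auto simp: Q_def)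
  qed (use f in \<open>auto simp: Q_def\<close>)
  then show ?thesis using that f by (auto simp: Q_def)
qed

subsection \<open>Compact operators\<close>

definition cpt :: "'a::chilbert_space bop \<Rightarrow> bool"
  where "cpt T \<longleftrightarrow> app T \<in> \<K>"

lemma app_carrier: "app T \<in> carrier \<L>"
  using app[of T] by (simp add: carrier_operator_algebra)

lemma app_Bop: "T \<in> carrier \<L> \<Longrightarrow> app (Bop T) = T"
  by (rule Bop_inverse) (simp add: carrier_operator_algebra)

lemma app_eq_ops: "app (S + T) = app S \<oplus>\<^bsub>\<L>\<^esub> app T" "app (S * T) = app S \<otimes>\<^bsub>\<L>\<^esub> app T"
  "app 0 = \<zero>\<^bsub>\<L>\<^esub>" "app 1 = \<one>\<^bsub>\<L>\<^esub>" "app (scal z * T) = z \<odot>\<^bsub>\<L>\<^esub> app T"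
  by (auto simp: bounded_ops_simps compose_def fun_eq_iff)

lemma cpt_add: "cpt S \<Longrightarrow> cpt T \<Longrightarrow> cpt (S + T)"
  unfolding cpt_def app_eq_ops
  by (rule additive_subgroup.a_closed[OF ideal.axioms(1)[OF ideal_compact_ops]])

lemma cpt_mult_left: "cpt T \<Longrightarrow> cpt (S * T)"
  unfolding cpt_def app_eq_ops
  by (rule ideal.I_l_closed[OF ideal_compact_ops]) (simp_all add: app_carrier)

lemma cpt_mult_right: "cpt T \<Longrightarrow> cpt (T * S)"
  unfolding cpt_def app_eq_ops
  by (rule ideal.I_r_closed[OF ideal_compact_ops]) (simp_all add: app_carrier)

lemma cpt_0: "cpt 0"
  unfolding cpt_def app_eq_ops
  by (rule additive_subgroup.zero_closed[OF ideal.axioms(1)[OF ideal_compact_ops]])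

lemma cpt_uminus: "cpt T \<Longrightarrow> cpt (- T)"
  using cpt_mult_left[of T "- 1"] by simp

lemma cpt_diff: "cpt S \<Longrightarrow> cpt T \<Longrightarrow> cpt (S - T)"
  using cpt_add[of S "- T"] cpt_uminus[of T] by simp

lemma cpt_sum: "(\<And>i. i \<in> I \<Longrightarrow> cpt (f i)) \<Longrightarrow> cpt (\<Sum>i\<in>I. f i)"
  by (induction I rule: infinite_finite_induct) (auto intro: cpt_0 cpt_add)

lemma cptI: "app T ` cball 0 1 \<subseteq> S \<Longrightarrow> compact S \<Longrightarrow> cpt T"
  unfolding cpt_def by (rule compact_opsI[OF app_carrier])

lemma cpt_rank1: "cpt (rank1 f g)"
proof (rule cptI)
  have "continuous_on UNIV (\<lambda>z. z *\<^sub>C f)"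
    by (intro linear_continuous_on bounded_linear_intro[where K = "norm f"])
      (auto simp: scaleC_add_left scaleR_scaleC scaleC_scaleC norm_scaleC scaleR_conv_of_real)
  then show "compact ((\<lambda>z. z *\<^sub>C f) ` cball 0 (norm g))"
    by (intro compact_continuous_image) (auto intro: continuous_on_subset)
  have "cmod (cinner g x) \<le> norm g" if "norm x \<le> 1" for x
    using cauchy_schwarz[of g x] mult_left_mono[OF that, of "norm g"] by simp
  then show "app (rank1 f g) ` cball 0 1 \<subseteq> (\<lambda>z. z *\<^sub>C f) ` cball 0 (norm g)"
    by auto
qed

lemma cpt_convergent_subseq:
  assumes T: "cpt T" and f: "\<And>n. norm (f n) \<le> B"
  obtains l r where "strict_mono r" "(\<lambda>n. T *\<^sub>V f (r n :: nat)) \<longlonglongrightarrow> l"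
proof -
  define b where "b = \<bar>B\<bar> + 1"
  have b: "b > 0" "norm (f n) \<le> b" for n using f[of n] by (auto simp: b_def)
  have "compact (closure (app T ` cball 0 1))" using T by (simp add: cpt_def compact_ops_def)
  moreover have "T *\<^sub>V (f n /\<^sub>R b) \<in> closure (app T ` cball 0 1)" for n
    using b by (intro subsetD[OF closure_subset] imageI) (simp add: field_simps)
  ultimately obtain l r where lr: "strict_mono (r :: nat \<Rightarrow> nat)" "((\<lambda>n. T *\<^sub>V (f n /\<^sub>R b)) \<circ> r) \<longlonglongrightarrow> l"
    unfolding compact_def by (metis (no_types, lifting))
  have "(\<lambda>n. b *\<^sub>R (T *\<^sub>V (f (r n) /\<^sub>R b))) \<longlonglongrightarrow> b *\<^sub>R l"
    using lr(2) by (intro tendsto_intros) (simp add: o_def)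
  then have "(\<lambda>n. T *\<^sub>V f (r n)) \<longlonglongrightarrow> b *\<^sub>R l" using b(1) by simp
  with lr(1) show ?thesis by (rule that)
qed

text \<open>Compactness supplies norm limits of subsequences of the images, and as \<open>e\<close>
  is weakly null, each such limit is 0.\<close>

lemma cpt_orthonormal_tendsto:
  assumes T: "cpt T" and e: "orthonormal_seq e"
  shows "(\<lambda>i. T *\<^sub>V e i) \<longlonglongrightarrow> 0"
proof (rule ccontr)
  assume "\<not> ?thesis"
  then obtain d where d: "d > 0" "\<not> (\<forall>\<^sub>F i in sequentially. norm (T *\<^sub>V e i) < d)"
    by (auto simp: tendsto_iff dist_norm)
  then have "\<exists>\<^sub>F i in sequentially. norm (T *\<^sub>V e i) \<ge> d" by (simp add: frequently_def not_le)
  then have "infinite {i. norm (T *\<^sub>V e i) \<ge> d}"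
    by (simp add: frequently_cofinite[symmetric] cofinite_eq_sequentially)
  then obtain r :: "nat \<Rightarrow> nat" where r: "strict_mono r" "\<And>i. norm (T *\<^sub>V e (r i)) \<ge> d"
    using infinite_enumerate by (metis (no_types, lifting) mem_Collect_eq)
  have er: "orthonormal_seq (e \<circ> r)" by (rule orthonormal_seq_subseq[OF e r(1)])
  then obtain l s where ls: "strict_mono s" "(\<lambda>n. T *\<^sub>V (e \<circ> r) (s n)) \<longlonglongrightarrow> l"
    using cpt_convergent_subseq[OF T, of "e \<circ> r" 1] er unfolding orthonormal_seq_def by metis
  have "(\<lambda>n. cinner ((e \<circ> r \<circ> s) n) (adj T *\<^sub>V l)) \<longlonglongrightarrow> 0"
    by (rule orthonormal_seq_weakly_null[OF orthonormal_seq_subseq[OF er ls(1)]])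
  then have "(\<lambda>n. cinner (T *\<^sub>V e (r (s n))) l) \<longlonglongrightarrow> 0" by (simp add: cinner_adj')
  moreover have "(\<lambda>n. cinner (T *\<^sub>V e (r (s n))) l) \<longlonglongrightarrow> cinner l l"
    using ls(2) by (intro tendsto_intros) (simp add: o_def)
  ultimately have "l = 0" using LIMSEQ_unique cinner_self_eq_0_iff by metis
  moreover have "d \<le> norm l"
    by (rule LIMSEQ_le_const[OF tendsto_norm[OF ls(2)]]) (use r(2) in auto)
  ultimately show False using d(1) by simp
qed

lemma cpt_limit:
  assumes X: "X \<longlonglongrightarrow> T" "\<And>n. cpt (X n)"
  shows "cpt T"
proof (rule cptI[where S = "closure (app T ` cball 0 1)"])
  show "compact (closure (app T ` cball 0 1))"
    unfolding compact_eq_totally_bounded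
  proof (intro conjI allI impI)
    show "complete (closure (app T ` cball 0 1))" by (simp add: complete_eq_closed)
    fix d :: real assume d: "0 < d"
    obtain n where n: "norm (X n - T) < d / 4"
      using LIMSEQ_D[OF X(1), of "d / 4"] d by auto
    have "compact (closure (app (X n) ` cball 0 1))"
      using X(2)[of n] by (simp add: cpt_def compact_ops_def)
    then obtain k where k: "finite k" "closure (app (X n) ` cball 0 1) \<subseteq> (\<Union>x\<in>k. ball x (d / 4))"
      unfolding compact_eq_totally_bounded using d by (metis divide_pos_pos zero_less_numeral)
    have "app T ` cball 0 1 \<subseteq> (\<Union>x\<in>k. cball x (d / 2))"
    proof (clarsimp)
      fix x :: 'a assume x: "norm x \<le> 1"
      have "X n *\<^sub>V x \<in> closure (app (X n) ` cball 0 1)"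
        using x by (intro subsetD[OF closure_subset] imageI) simp
      then obtain y where y: "y \<in> k" "dist y (X n *\<^sub>V x) < d / 4" using k(2) by auto
      have "norm (X n *\<^sub>V x - T *\<^sub>V x) \<le> norm (X n - T) * norm x" using norm_app[of "X n - T" x] by simp
      also have "\<dots> \<le> norm (X n - T) * 1" using x by (intro mult_left_mono) auto
      finally have "dist (X n *\<^sub>V x) (T *\<^sub>V x) < d / 4" using n by (simp add: dist_norm)
      then have "dist y (T *\<^sub>V x) \<le> d / 2"
        using y(2) dist_triangle[of y "T *\<^sub>V x" "X n *\<^sub>V x"] by linarith
      then show "\<exists>y\<in>k. dist y (T *\<^sub>V x) * 2 \<le> d" using y(1) by (intro bexI[of _ y]) auto
    qed
    then have "closure (app T ` cball 0 1) \<subseteq> (\<Union>x\<in>k. cball x (d / 2))"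
      using k(1) by (intro closure_minimal) auto
    also have "\<dots> \<subseteq> (\<Union>x\<in>k. ball x d)" using d by auto
    finally show "\<exists>k. finite k \<and> closure (app T ` cball 0 1) \<subseteq> (\<Union>x\<in>k. ball x d)"
      using k(1) by blast
  qed
qed (rule closure_subset)

lemma finite_subset_cpt_proj:
  assumes "finite F"
  shows "\<exists>P. orth_proj P \<and> cpt P \<and> (\<forall>f\<in>F. P *\<^sub>V f = f)"
  using assms
proof (induction F rule: finite_induct)
  case empty
  then show ?case using cpt_0 orth_proj_0 by blast
next
  case (insert f F)
  then obtain P where P: "orth_proj P" "cpt P" "\<And>f. f \<in> F \<Longrightarrow> P *\<^sub>V f = f" by blast
  define u where "u = f - P *\<^sub>V f"
  \<comment> \<open>For \<open>u = 0\<close> the division gives \<open>e = 0\<close>, so the rank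
    one summand vanishes and no separate case is needed.\<close>
  define e where "e = of_real (1 / norm u) *\<^sub>C u"
  have e: "norm e = 1 \<or> e = 0" by (auto simp: e_def norm_scaleC norm_divide scaleC_zero_right)
  have Pe: "P *\<^sub>V e = 0" by (simp add: e_def u_def orth_projD[OF P(1)] scaleC_zero_right)
  have 0: "P * rank1 e e = 0" by (rule bop_eqI) (simp add: Pe scaleC_zero_right)
  define Q where "Q = P + rank1 e e"
  have Q: "orth_proj Q" "cpt Q"
    unfolding Q_def by (intro orth_proj_add orth_proj_rank1 P e 0 cpt_add cpt_rank1)+
  have eP: "cinner e (P *\<^sub>V x) = 0" for x using orth_projD(4)[OF P(1), of e x] Pe by simp
  have "cinner e f *\<^sub>C e = u"
  proof (cases "u = 0")
    case False
    have "cinner e f = cinner e u" by (simp add: u_def cinner_diff eP)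
    also have "\<dots> = of_real (norm u)"
      using False by (simp add: e_def cinner_simps cinner_self power2_eq_square)
    finally show ?thesis using False by (simp add: e_def scaleC_scaleC scaleC_one)
  qed (simp add: e_def scaleC_zero_right)
  then have "Q *\<^sub>V f = f" by (simp add: Q_def u_def)
  moreover have "Q *\<^sub>V g = g" if "g \<in> F" for g
    using P(3)[OF that] eP[of g] by (simp add: Q_def)
  ultimately show ?case using Q by blast
qed

lemma cpt_range_in_span:
  assumes "finite F" "\<And>x. T *\<^sub>V x \<in> cspan F"
  shows "cpt T"
proof -
  obtain P where P: "cpt P" "\<And>f. f \<in> F \<Longrightarrow> P *\<^sub>V f = f"
    using finite_subset_cpt_proj[OF assms(1)] by blast
  have "cspan F \<subseteq> {x. P *\<^sub>V x = x}"
    by (rule cv.span_minimal) (use P(2) in \<open>auto simp: fix_csubspace\<close>)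
  then have "P * T = T" using assms(2) by (intro bop_eqI) auto
  then show ?thesis using cpt_mult_right[OF P(1)] by metis
qed

lemma finite_dim_proj_cpt:
  assumes M: "csubspace M" "closed M" "cfinite_dim M" shows "cpt (proj M)"
proof -
  obtain F where F: "finite F" "M \<subseteq> cspan F" using M(3) by (auto simp: cfinite_dim_def)
  show ?thesis by (rule cpt_range_in_span[OF F(1)]) (use proj_props(1)[OF M(1,2)] F(2) in blast)
qed

text \<open>If no \<open>F\<close> worked, one could go on forever choosing unit vectors in the
  range of \<open>P\<close>, orthogonal to the earlier ones, on which \<open>T\<close> has norm at
  least \<open>d\<close>; a compact operator tends to 0 along such a sequence.\<close>

lemma cpt_small_off_finite_proj:
  assumes T: "cpt T" and P: "orth_proj P" and d: "d > 0"
  obtains F where "orth_proj F" "cpt F" "P * F = F" "norm (T * (P - F)) \<le> d"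
proof (rule ccontr)
  note found = that
  assume none: "\<not> thesis"
  have big: "norm (T * (P - F)) > d" if "orth_proj F" "cpt F" "P * F = F" for F
    using none found[of F] that by force
  define Q where "Q e k v \<longleftrightarrow> P *\<^sub>V v = v \<and> norm v = 1 \<and> (\<forall>i<k. cinner (e i) v = 0) \<and> norm (T *\<^sub>V v) \<ge> d"
    for e :: "nat \<Rightarrow> 'a" and k v
  have "\<exists>f. \<forall>k. Q f k (f k)"
  proof (rule dependent_wellorder_choice)
    fix k and e :: "nat \<Rightarrow> 'a" assume e: "\<And>i. i < k \<Longrightarrow> Q e i (e i)"
    define F where "F n = (\<Sum>i<n. rank1 (e i) (e i))" for n
    have F: "orth_proj (F n) \<and> cpt (F n) \<and> P * F n = F n \<and> (\<forall>i<n. F n *\<^sub>V e i = e i)" if "n \<le> k" for n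
      using that
    proof (induction n)
      case (Suc n)
      then have IH: "orth_proj (F n)" "cpt (F n)" "P * F n = F n" "\<And>i. i < n \<Longrightarrow> F n *\<^sub>V e i = e i" by auto
      have en: "norm (e n) = 1" "P *\<^sub>V e n = e n" "\<And>i. i < n \<Longrightarrow> cinner (e i) (e n) = 0"
        using e[of n] Suc.prems by (auto simp: Q_def)
      have Fn: "F n *\<^sub>V e n = 0"
      proof -
        have "app (\<Sum>i<m. rank1 (e i) (e i)) (e n) = 0" if "m \<le> n" for m
          using that by (induction m) (simp_all add: en)
        then show ?thesis by (simp add: F_def)
      qed
      then have "F n * rank1 (e n) (e n) = 0" by (intro bop_eqI) (simp add: scaleC_zero_right)
      moreover have "P * rank1 (e n) (e n) = rank1 (e n) (e n)"
        by (rule bop_eqI) (simp add: en)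
      moreover have "F (Suc n) *\<^sub>V e i = e i" if "i < Suc n" for i
      proof (cases "i = n")
        case True
        then show ?thesis using Fn en by (simp add: F_def cinner_self scaleC_one)
      next
        case False
        then have "cinner (e n) (e i) = 0" using en(3)[of i] that cinner_eq_0_swap by auto
        then show ?thesis using IH(4)[of i] that False by (simp add: F_def)
      qed
      moreover have "F (Suc n) = F n + rank1 (e n) (e n)" by (simp add: F_def)
      ultimately show ?case using IH en
        by (auto intro!: orth_proj_add orth_proj_rank1 cpt_add cpt_rank1 simp: distrib_left)
    qed (simp add: F_def cpt_0)
    have Fk: "orth_proj (F k)" "cpt (F k)" "P * F k = F k" "\<And>i. i < k \<Longrightarrow> F k *\<^sub>V e i = e i"
      using F[of k] by auto
    have PF: "orth_proj (P - F k)" by (rule orth_proj_diff[OF P Fk(1,3)])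
    obtain x where x: "norm (T *\<^sub>V (P - F k) *\<^sub>V x) > d * norm x"
      using big[OF Fk(1-3)] norm_bop_bound[of d "T * (P - F k)"] d
      by (metis app_ops(6) less_imp_le not_le)
    define y where "y = (P - F k) *\<^sub>V x"
    have y: "norm (T *\<^sub>V y) > d * norm y"
      using x orth_proj_norm_le[OF PF, of x] d unfolding y_def
      by (meson less_le_trans mult_left_mono not_le less_imp_le)
    then have y0: "norm y > 0" by (cases "y = 0") auto
    have "F k * P = F k" by (rule proj_mult_swap[OF P Fk(1,3)])
    then have FP: "F k *\<^sub>V P *\<^sub>V x = F k *\<^sub>V x" for x by (metis app_ops(6))
    have PF': "P *\<^sub>V F k *\<^sub>V x = F k *\<^sub>V x" for x using Fk(3) by (metis app_ops(6))
    have Py: "P *\<^sub>V y = y" "F k *\<^sub>V y = 0"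
      by (simp_all add: y_def orth_projD[OF P] orth_projD[OF Fk(1)] PF' FP)
    have "cinner (e i) y = 0" if "i < k" for i
      using orth_projD(4)[OF Fk(1), of "e i" y] Fk(4)[OF that] Py by simp
    moreover have "d \<le> norm (T *\<^sub>V y) / norm y" using y y0 by (simp add: field_simps)
    ultimately have "Q e k (of_real (1 / norm y) *\<^sub>C y)"
      using y0 Py by (auto simp: Q_def norm_scaleC norm_divide cinner_scaleC_right)
    then show "\<exists>v. Q e k v" by blast
  qed (simp add: Q_def)
  then obtain f where f: "\<And>k. Q f k (f k)" by blast
  have "orthonormal_seq f" unfolding orthonormal_seq_def
  proof (intro conjI allI impI)
    fix i j :: nat assume "i \<noteq> j"
    then show "cinner (f i) (f j) = 0"
      using f[of i] f[of j] cinner_eq_0_swap[of "f i" "f j"]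
      by (cases i j rule: linorder_cases) (auto simp: Q_def)
  qed (use f in \<open>auto simp: Q_def\<close>)
  then have "(\<lambda>i. norm (T *\<^sub>V f i)) \<longlonglongrightarrow> 0" using cpt_orthonormal_tendsto[OF T] tendsto_norm_zero by blast
  then have "d \<le> 0" by (rule LIMSEQ_le_const) (use f in \<open>auto simp: Q_def\<close>)
  then show False using d by simp
qed

subsection \<open>Spectral projections of positive operators\<close>

lemma app_mult_cong: "S * T = U * V \<Longrightarrow> S *\<^sub>V T *\<^sub>V x = U *\<^sub>V V *\<^sub>V x"
  by (metis app_ops(6))

lemma closed_range_bounded_below:
  assumes N: "csubspace N" "closed N" and c: "c > 0" "\<And>x. x \<in> N \<Longrightarrow> c * norm x \<le> norm (T *\<^sub>V x)"
  shows "closed (app T ` N)"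
proof -
  have "complete (app T ` N)"
    by (rule complete_isometric_image[OF c(1) csubspace_imp_subspace[OF N(1)] bounded_linear_app])
      (use c(2) N(2) in \<open>auto simp: complete_eq_closed\<close>)
  then show ?thesis by (simp add: complete_eq_closed)
qed

lemma bop_inverse:
  assumes c: "c > 0" "\<And>x. c * norm x \<le> norm (T *\<^sub>V x)" and "surj (app T)"
  obtains R where "T * R = 1" "R * T = 1"
proof -
  have inj: "x = y" if "T *\<^sub>V x = T *\<^sub>V y" for x y
    using c(2)[of "x - y"] c(1) that by (simp add: mult_le_0_iff)
  obtain g where g: "\<And>y. T *\<^sub>V g y = y" using assms(3) by (metis surjD)
  have gT: "g (T *\<^sub>V x) = x" for x using inj g by blast
  have add: "g (x + y) = g x + g y" for x y by (rule inj) (simp add: g)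
  have sc: "g (z *\<^sub>C x) = z *\<^sub>C g x" for z x by (rule inj) (simp add: g)
  have "bounded_linear g"
  proof (rule bounded_linear_intro[OF add])
    show "norm (g x) \<le> norm x * (1 / c)" for x
      using c(2)[of "g x"] c(1) by (simp add: g field_simps)
  qed (simp add: scaleR_scaleC sc)
  then have app_g: "app (Bop g) = g" using sc by (simp add: Bop_inverse)
  show ?thesis by (rule that[of "Bop g"]) (auto intro!: bop_eqI simp: app_g g gT)
qed

text \<open>The range is closed by the lower bound, and its orthogonal complement is the kernel of
  \<open>adj T = T\<close>, which is trivial.\<close>

lemma selfadjoint_bounded_below_inverse:
  assumes T: "adj T = T" and c: "c > 0" "\<And>x. c * norm x \<le> norm (T *\<^sub>V x)"
  obtains R where "T * R = 1" "R * T = 1"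
proof -
  have M: "csubspace (range (app T))" "closed (range (app T))"
    by (rule range_csubspace[OF csubspace_UNIV], rule closed_range_bounded_below[OF csubspace_UNIV])
      (use c in auto)
  have "y \<in> range (app T)" for y
  proof -
    define z where "z = y - proj (range (app T)) *\<^sub>V y"
    have "cinner (T *\<^sub>V x) z = 0" for x unfolding z_def by (rule proj_props(2)[OF M]) simp
    then have "cinner (T *\<^sub>V z) (T *\<^sub>V z) = 0" using cinner_adj'[of "T *\<^sub>V z" T z] T by simp
    then have "z = 0" using c(2)[of z] c(1) by (simp add: cinner_self_eq_0_iff mult_le_0_iff)
    then show ?thesis using proj_props(1)[OF M, of y] by (simp add: z_def)
  qed
  then have "surj (app T)" by blast
  with bop_inverse[OF c] that show ?thesis by blast
qed

lemma tendsto_adj: "X \<longlonglongrightarrow> L \<Longrightarrow> (\<lambda>n. adj (X n)) \<longlonglongrightarrow> adj L"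
  by (simp add: tendsto_iff dist_norm adj_simps(3)[symmetric])

text \<open>The iterates are polynomials in \<open>a\<close> with nonnegative coefficients, so they are
  dominated by the scalar iterates for \<open>a = 1\<close>; the square root of \<open>1 - a\<close> is \<open>1 - b\<close>.\<close>

lemma sqrt_iteration:
  fixes a :: "'a::chilbert_space bop"
  assumes a: "norm a \<le> 1"
  obtains b where "2 *\<^sub>R b = a + b * b" "norm b \<le> 1" "adj a = a \<Longrightarrow> adj b = b"
    "\<And>Z. Z * a = a * Z \<Longrightarrow> Z * b = b * Z"
proof -
  define s where "s = rec_nat 0 (\<lambda>_ b. (1/2) *\<^sub>R (a + b * b))"
  define t where "t = rec_nat (0::real) (\<lambda>_ b. (1 + b * b) / 2)"
  have s: "s 0 = 0" "\<And>n. s (Suc n) = (1/2) *\<^sub>R (a + s n * s n)" by (simp_all add: s_def)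
  have t: "t 0 = 0" "\<And>n. t (Suc n) = (1 + t n * t n) / 2" by (simp_all add: t_def)
  have t01: "0 \<le> t n \<and> t n \<le> 1" for n
  proof (induction n)
    case (Suc n)
    then have "t n * t n \<le> 1 * 1" by (intro mult_mono) auto
    then show ?case by (simp add: t)
  qed (simp add: t)
  have st: "norm (s n) \<le> t n" for n
  proof (induction n)
    case (Suc n)
    have "norm (s n * s n) \<le> t n * t n"
      by (rule order_trans[OF norm_mult_ineq]) (use Suc t01 in \<open>auto intro: mult_mono\<close>)
    then show ?case using norm_triangle_ineq[of a "s n * s n"] a by (simp add: s t)
  qed (simp add: s t)
  have diff: "norm (s (Suc n) - s n) \<le> t (Suc n) - t n" for n
  proof (induction n)
    case 0
    then show ?case using a by (simp add: s t)
  next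
    case (Suc n)
    let ?d = "s (Suc n) - s n" and ?e = "t (Suc n) - t n"
    have e: "0 \<le> ?e" using order_trans[OF norm_ge_zero Suc] .
    have "norm (s (Suc n) * ?d) \<le> t (Suc n) * ?e" "norm (?d * s n) \<le> ?e * t n"
      by (rule order_trans[OF norm_mult_ineq], rule mult_mono; use Suc st t01 e in auto)+
    then have "norm (s (Suc n) * ?d + ?d * s n) \<le> t (Suc n) * ?e + ?e * t n"
      using norm_triangle_ineq[of "s (Suc n) * ?d" "?d * s n"] by linarith
    \<comment> \<open>The factorization of a difference of squares in its noncommutative form; the
      scalar iterates obey the same identity, so the bound is inherited.\<close>
    moreover have "s (Suc (Suc n)) - s (Suc n) = (1/2) *\<^sub>R (s (Suc n) * ?d + ?d * s n)"
      unfolding s(2)[of "Suc n"] by (subst (3) s(2)) (simp add: algebra_simps)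
    moreover have "t (Suc (Suc n)) - t (Suc n) = (1/2) * (t (Suc n) * ?e + ?e * t n)"
      unfolding t(2)[of "Suc n"] by (subst (3) t(2)) (simp add: algebra_simps add_divide_distrib diff_divide_distrib)
    ultimately show ?case by simp
  qed
  have diff': "norm (s (n + k) - s n) \<le> t (n + k) - t n" for n k
  proof (induction k)
    case (Suc k)
    then show ?case
      using norm_triangle_ineq[of "s (n + Suc k) - s (n + k)" "s (n + k) - s n"] diff[of "n + k"] by simp
  qed simp
  have "incseq t"
  proof (rule incseq_SucI)
    show "t n \<le> t (Suc n)" for n using diff[of n] norm_ge_zero[of "s (Suc n) - s n"] by linarith
  qed
  then obtain L where "t \<longlonglongrightarrow> L" using incseq_convergent[of t 1] t01 by metis
  then have "Cauchy t" using convergent_Cauchy convergent_def by blast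
  have "Cauchy s"
  proof (rule metric_CauchyI)
    fix d :: real assume "0 < d"
    then obtain N where N: "\<And>m n. m \<ge> N \<Longrightarrow> n \<ge> N \<Longrightarrow> norm (t m - t n) < d"
      using CauchyD[OF \<open>Cauchy t\<close>] by metis
    have "dist (s m) (s n) < d" if "m \<ge> N" "n \<ge> N" for m n
    proof (cases "m \<le> n")
      case True
      then show ?thesis using N[of n m] diff'[of m "n - m"] that by (simp add: dist_norm norm_minus_commute)
    next
      case False
      then show ?thesis using N[of m n] diff'[of n "m - n"] that by (simp add: dist_norm)
    qed
    then show "\<exists>M. \<forall>m\<ge>M. \<forall>n\<ge>M. dist (s m) (s n) < d" by blast
  qed
  then obtain b where b: "s \<longlonglongrightarrow> b" by (metis Cauchy_convergent_iff convergent_def)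
  show ?thesis
  proof
    have "(\<lambda>n. (1/2) *\<^sub>R (a + s n * s n)) \<longlonglongrightarrow> (1/2) *\<^sub>R (a + b * b)" by (intro tendsto_intros b)
    moreover have "(\<lambda>n. (1/2) *\<^sub>R (a + s n * s n)) \<longlonglongrightarrow> b" using LIMSEQ_Suc[OF b] by (simp add: s)
    ultimately have "b = (1/2) *\<^sub>R (a + b * b)" using LIMSEQ_unique by blast
    then have "2 *\<^sub>R b = 2 *\<^sub>R ((1/2) *\<^sub>R (a + b * b))" by simp
    then show "2 *\<^sub>R b = a + b * b" by simp
    show "norm b \<le> 1"
      by (rule LIMSEQ_le_const2[OF tendsto_norm[OF b]]) (use st t01 order_trans in blast)
    show "adj b = b" if "adj a = a"
    proof -
      have "adj (s n) = s n" for n by (induction n) (simp_all add: s adj_simps that)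
      then have "s \<longlonglongrightarrow> adj b" using tendsto_adj[OF b] by simp
      then show ?thesis using LIMSEQ_unique[OF b] by metis
    qed
    show "Z * b = b * Z" if Z: "Z * a = a * Z" for Z
    proof -
      have *: "Z * s n = s n * Z" for n
      proof (induction n)
        case (Suc n)
        then have "Z * (s n * s n) = s n * s n * Z" by (metis mult.assoc)
        then show ?case by (simp add: s Z distrib_left distrib_right)
      qed (simp add: s)
      have "(\<lambda>n. Z * s n) \<longlonglongrightarrow> Z * b" "(\<lambda>n. s n * Z) \<longlonglongrightarrow> b * Z"
        by (intro tendsto_intros b)+
      then show ?thesis unfolding * using LIMSEQ_unique by blast
    qed
  qed
qed

text \<open>\<open>C\<close> is the absolute value of \<open>X\<close>, obtained as
  \<open>1 - b\<close> from the square root iteration for \<open>1 - X * X\<close>; it is positive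
  because \<open>norm b \<le> 1\<close>.\<close>

lemma selfadjoint_abs:
  fixes X :: "'a::chilbert_space bop"
  assumes X: "adj X = X" "norm X \<le> 1"
  obtains C where "C * C = X * X" "adj C = C" "\<And>x. 0 \<le> Re (cinner x (C *\<^sub>V x))"
    "\<And>Z. Z * X = X * Z \<Longrightarrow> Z * C = C * Z"
proof -
  have "norm (1 - X * X) \<le> 1"
  proof (rule norm_bop_bound)
    fix x
    have "norm (X *\<^sub>V X *\<^sub>V x) \<le> norm X * norm (X *\<^sub>V x)" by (rule norm_app)
    also have "\<dots> \<le> 1 * norm (X *\<^sub>V x)" using X(2) by (intro mult_right_mono) auto
    finally have "(norm (X *\<^sub>V X *\<^sub>V x))\<^sup>2 \<le> (norm (X *\<^sub>V x))\<^sup>2" by (simp add: power_mono)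
    moreover have "Re (cinner x (X *\<^sub>V X *\<^sub>V x)) = (norm (X *\<^sub>V x))\<^sup>2"
      using cinner_adj[of X x "X *\<^sub>V x"] X(1) Re_cinner_self[of "X *\<^sub>V x"] by simp
    ultimately have "(norm (x - X *\<^sub>V X *\<^sub>V x))\<^sup>2 \<le> (norm x)\<^sup>2"
      unfolding norm_diff_sq using zero_le_power2[of "norm (X *\<^sub>V x)"] by linarith
    then have "norm (x - X *\<^sub>V X *\<^sub>V x) \<le> norm x" by (rule power2_le_imp_le) simp
    then show "norm ((1 - X * X) *\<^sub>V x) \<le> 1 * norm x" by simp
  qed simp
  then obtain b where b: "2 *\<^sub>R b = 1 - X * X + b * b" "norm b \<le> 1"
    "adj (1 - X * X) = 1 - X * X \<Longrightarrow> adj b = b"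
    "\<And>Z. Z * (1 - X * X) = (1 - X * X) * Z \<Longrightarrow> Z * b = b * Z"
    by (rule sqrt_iteration) blast
  show ?thesis
  proof (rule that[of "1 - b"])
    have "(1 - b) * (1 - b) = 1 - 2 *\<^sub>R b + b * b" by (simp add: algebra_simps scaleR_2)
    then show "(1 - b) * (1 - b) = X * X" by (simp add: b(1))
    show "adj (1 - b) = 1 - b" using b(3) X(1) by (simp add: adj_simps)
    show "0 \<le> Re (cinner x ((1 - b) *\<^sub>V x))" for x
    proof -
      have "Re (cinner x (b *\<^sub>V x)) \<le> norm x * norm (b *\<^sub>V x)"
        using cauchy_schwarz[of x "b *\<^sub>V x"] complex_Re_le_cmod order_trans by blast
      also have "\<dots> \<le> norm x * (1 * norm x)"
        using b(2) by (intro mult_left_mono order_trans[OF norm_app] mult_right_mono) auto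
      finally show ?thesis by (simp add: cinner_diff Re_cinner_self power2_eq_square)
    qed
    show "Z * (1 - b) = (1 - b) * Z" if Z: "Z * X = X * Z" for Z
    proof -
      have "Z * (X * X) = X * X * Z" using Z by (metis mult.assoc)
      then have "Z * b = b * Z" by (intro b(4)) (simp add: left_diff_distrib right_diff_distrib)
      then show ?thesis by (simp add: left_diff_distrib right_diff_distrib)
    qed
  qed
qed

text \<open>\<open>P\<close> is the spectral projection of \<open>B * adj B\<close> for the interval from \<open>d\<^sup>2\<close> to infinity.\<close>

lemma spectral_projection:
  fixes B :: "'a::chilbert_space bop"
  assumes d: "d > 0"
  obtains P R where "orth_proj P" "P = B * R" "norm ((1 - P) * B) \<le> d"
proof -
  define S where "S = B * adj B"
  \<comment> \<open>Normalizes \<open>X\<close> for \<open>selfadjoint_abs\<close>; the summand 1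
    keeps \<open>r\<close> positive.\<close>
  define r where "r = norm (S - d\<^sup>2 *\<^sub>R 1) + 1"
  define X where "X = (1 / r) *\<^sub>R (S - d\<^sup>2 *\<^sub>R 1)"
  have r: "r > 0" by (simp add: r_def add_nonneg_pos)
  have Sadj: "adj S = S" by (simp add: S_def adj_simps)
  have X: "adj X = X" "norm X \<le> 1" using r by (simp_all add: X_def adj_simps Sadj divide_le_eq r_def)
  have rX: "S = r *\<^sub>R X + d\<^sup>2 *\<^sub>R 1" using r by (simp add: X_def)
  obtain C where C: "C * C = X * X" "adj C = C" "\<And>x. 0 \<le> Re (cinner x (C *\<^sub>V x))"
    "\<And>Z. Z * X = X * Z \<Longrightarrow> Z * C = C * Z"
    using selfadjoint_abs[OF X] by blast
  have XC: "X * C = C * X" by (rule C(4)) simp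
  have SC: "S * C = C * S" by (rule C(4)) (simp add: rX algebra_simps)
  have SX: "S * X = X * S" by (simp add: rX algebra_simps)
  \<comment> \<open>As \<open>C\<close> is the absolute value of \<open>X\<close>, the operator
    \<open>X\<close> is nonnegative on \<open>Y\<close>, which means that \<open>S\<close> is at
    least \<open>d\<^sup>2\<close> there.\<close>
  define Y where "Y = {y. C *\<^sub>V y = X *\<^sub>V y}"
  have Y: "csubspace Y" "closed Y" unfolding Y_def by (rule app_eq_csubspace app_eq_closed)+
  define P where "P = proj Y"
  have P: "orth_proj P" unfolding P_def by (rule orth_proj_proj[OF Y])
  have PY: "P *\<^sub>V x \<in> Y" for x unfolding P_def by (rule proj_props(1)[OF Y])
  have Pid: "P *\<^sub>V y = y" if "y \<in> Y" for y unfolding P_def by (rule proj_id[OF Y that])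
  have SY: "S *\<^sub>V y \<in> Y" if "y \<in> Y" for y
    using that app_mult_cong[OF SC, of y] app_mult_cong[OF SX, of y] by (simp add: Y_def)
  have PSP: "P * S * P = S * P" by (rule bop_eqI) (simp add: Pid SY PY)
  have "adj (P * S * P) = P * S * P" "adj (S * P) = P * S"
    by (simp_all add: adj_simps orth_projD(2)[OF P] Sadj mult.assoc)
  then have PS: "P * S = S * P" using PSP by metis
  have low: "d\<^sup>2 * norm y \<le> norm (S *\<^sub>V y)" if y: "y \<in> Y" for y
  proof (cases "y = 0")
    case False
    have "0 \<le> Re (cinner y (X *\<^sub>V y))" using C(3)[of y] y by (simp add: Y_def)
    then have "d\<^sup>2 * (norm y)\<^sup>2 \<le> Re (cinner y (S *\<^sub>V y))"
      using r by (simp add: rX cinner_add_right scaleR_scaleC cinner_scaleC_right Re_cinner_self)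
    also have "\<dots> \<le> norm y * norm (S *\<^sub>V y)"
      using cauchy_schwarz complex_Re_le_cmod order_trans by blast
    finally show ?thesis using False by (simp add: power2_eq_square)
  qed simp
  \<comment> \<open>\<open>T\<close> acts as \<open>S\<close> on the range of \<open>P\<close> and
    as the identity on its complement. It is bounded below, and its inverse makes \<open>P\<close>
    factor through \<open>S\<close>, hence through \<open>B\<close>.\<close>
  define T where "T = (1 - P) + S * P"
  have "adj T = T" by (simp add: T_def adj_simps Sadj orth_projD[OF P] PS)
  moreover have "min 1 (d\<^sup>2) * norm x \<le> norm (T *\<^sub>V x)" for x
  proof -
    let ?m = "min 1 (d\<^sup>2)"
    have "P *\<^sub>V S *\<^sub>V P *\<^sub>V x = S *\<^sub>V P *\<^sub>V x" by (simp add: Pid SY PY)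
    then have "P *\<^sub>V T *\<^sub>V x = S *\<^sub>V P *\<^sub>V x" by (simp add: T_def orth_projD[OF P])
    then have eq: "(norm (T *\<^sub>V x))\<^sup>2 = (norm (S *\<^sub>V P *\<^sub>V x))\<^sup>2 + (norm (x - P *\<^sub>V x))\<^sup>2"
      using orth_proj_norm_sq[OF P, of "T *\<^sub>V x"] by (simp add: T_def)
    have "?m * norm (P *\<^sub>V x) \<le> norm (S *\<^sub>V P *\<^sub>V x)"
      using low[OF PY, of x] mult_right_mono[of ?m "d\<^sup>2" "norm (P *\<^sub>V x)"] by simp
    then have 1: "(?m * norm (P *\<^sub>V x))\<^sup>2 \<le> (norm (S *\<^sub>V P *\<^sub>V x))\<^sup>2" by (intro power_mono) auto
    have "?m * norm (x - P *\<^sub>V x) \<le> 1 * norm (x - P *\<^sub>V x)" by (intro mult_right_mono) auto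
    then have 2: "(?m * norm (x - P *\<^sub>V x))\<^sup>2 \<le> (norm (x - P *\<^sub>V x))\<^sup>2" by (intro power_mono) auto
    have "(?m * norm x)\<^sup>2 = (?m * norm (P *\<^sub>V x))\<^sup>2 + (?m * norm (x - P *\<^sub>V x))\<^sup>2"
      using orth_proj_norm_sq[OF P, of x] by (simp add: power_mult_distrib distrib_left)
    then have "(?m * norm x)\<^sup>2 \<le> (norm (T *\<^sub>V x))\<^sup>2" using 1 2 eq by linarith
    then show ?thesis by (rule power2_le_imp_le) simp
  qed
  moreover have "min 1 (d\<^sup>2) > 0" using d by simp
  ultimately obtain R where R: "T * R = 1" by (metis selfadjoint_bounded_below_inverse)
  have "P * T = S * P" by (simp add: T_def distrib_left right_diff_distrib orth_projD[OF P] PSP mult.assoc[symmetric])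
  then have "P = S * P * R" using R by (metis mult.assoc mult.right_neutral)
  then have PB: "P = B * (adj B * P * R)" by (simp add: S_def mult.assoc)
  have up: "norm (adj B *\<^sub>V z) \<le> d * norm z" if z: "P *\<^sub>V z = 0" for z
  proof -
    \<comment> \<open>\<open>(C - X) * (C + X) = 0\<close>, so \<open>C + X\<close> maps into
      \<open>Y\<close>; being selfadjoint it vanishes on the complement of \<open>Y\<close>, where
      therefore \<open>X = - C\<close> is nonpositive.\<close>
    have CXY: "(C + X) *\<^sub>V u \<in> Y" for u
    proof -
      have "C * (C + X) = X * (C + X)" by (simp add: distrib_left C(1) XC)
      then show ?thesis unfolding Y_def using app_mult_cong by blast
    qed
    have "cinner y z = 0" if "y \<in> Y" for y using proj_props(2)[OF Y that, of z] z by (simp add: P_def)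
    then have "cinner ((C + X) *\<^sub>V ((C + X) *\<^sub>V z)) z = 0" using CXY by blast
    moreover have "adj (C + X) = C + X" by (simp add: adj_simps C X)
    ultimately have "cinner ((C + X) *\<^sub>V z) ((C + X) *\<^sub>V z) = 0" by (metis cinner_adj')
    then have "(C + X) *\<^sub>V z = 0" by (simp only: cinner_self_eq_0_iff)
    then have "X *\<^sub>V z = - (C *\<^sub>V z)" by (simp add: add_eq_0_iff)
    then have "Re (cinner z (X *\<^sub>V z)) \<le> 0" using C(3)[of z] by simp
    then have "r * Re (cinner z (X *\<^sub>V z)) \<le> 0" using r by (simp add: mult_le_0_iff)
    then have "Re (cinner z (S *\<^sub>V z)) \<le> d\<^sup>2 * (norm z)\<^sup>2"
      by (simp add: rX cinner_add_right scaleR_scaleC cinner_scaleC_right Re_cinner_self)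
    also have "Re (cinner z (S *\<^sub>V z)) = (norm (adj B *\<^sub>V z))\<^sup>2"
      using cinner_adj[of B z "adj B *\<^sub>V z"] by (simp add: S_def flip: Re_cinner_self)
    finally have "(norm (adj B *\<^sub>V z))\<^sup>2 \<le> (d * norm z)\<^sup>2" by (simp add: power_mult_distrib)
    then show ?thesis by (rule power2_le_imp_le) (use d in simp)
  qed
  have "norm ((1 - P) * B) = norm (adj B * (1 - P))"
    using norm_adj[of "(1 - P) * B"] by (simp add: adj_simps orth_projD[OF P])
  also have "\<dots> \<le> d"
  proof (rule norm_bop_bound)
    fix x
    have "norm (adj B *\<^sub>V (1 - P) *\<^sub>V x) \<le> d * norm ((1 - P) *\<^sub>V x)"
      by (rule up) (simp add: orth_projD[OF P])
    also have "\<dots> \<le> d * norm x"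
      using d by (intro mult_left_mono orth_proj_norm_le orth_proj_compl P) auto
    finally show "norm ((adj B * (1 - P)) *\<^sub>V x) \<le> d * norm x" by simp
  qed (use d in simp)
  finally show ?thesis using that[OF P PB] by blast
qed

subsection \<open>Lifting idempotents and nilpotents from the Calkin algebra\<close>

text \<open>The range of \<open>P\<close> is a sum of orthogonal pieces \<open>P k - F k\<close>, where \<open>P k\<close> peels off the part of the
  remainder of \<open>B\<close> that is not small (and that \<open>A\<close> therefore maps compactly), and the finite-dimensional
  \<open>F k\<close> is discarded to make the sum of the \<open>A * (P k - F k)\<close> converge in norm.\<close>

lemma compact_product_projection:
  fixes A B :: "'a::chilbert_space bop"
  assumes AB: "cpt (A * B)"
  obtains P where "orth_proj P" "cpt (A * P)" "cpt ((1 - P) * B)"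
    "\<And>P0. orth_proj P0 \<Longrightarrow> P0 * B = B \<Longrightarrow> P0 * P = P"
proof -
  have "\<exists>P R. orth_proj P \<and> P = B * R \<and> norm ((1 - P) * B) \<le> (1/2) ^ k" for k and B :: "'a bop"
    using spectral_projection[of "(1/2) ^ k" B] by (metis zero_less_divide_1_iff zero_less_numeral zero_less_power)
  then have "\<forall>q :: nat \<times> 'a bop. \<exists>PR. orth_proj (fst PR) \<and> fst PR = snd q * snd PR \<and>
      norm ((1 - fst PR) * snd q) \<le> (1/2) ^ fst q"
    by (metis fst_conv snd_conv)
  then obtain pr where pr: "\<And>q. orth_proj (fst (pr q)) \<and> fst (pr q) = snd q * snd (pr q) \<and>
      norm ((1 - fst (pr q)) * snd q) \<le> (1/2) ^ fst (q :: nat \<times> 'a bop)"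
    by (rule choice[THEN exE]) blast
  define pf where "pf k B = fst (pr (k, B))" for k B
  define rf where "rf k B = snd (pr (k, B))" for k B
  have pf: "orth_proj (pf k B)" "pf k B = B * rf k B" "norm ((1 - pf k B) * B) \<le> (1/2) ^ k" for k B
    using pr[of "(k, B)"] unfolding pf_def rf_def fst_conv snd_conv by blast+
  \<comment> \<open>The remainders of \<open>B\<close>. The step number is also the precision, so
    they tend to 0 geometrically.\<close>
  define Bs where "Bs = rec_nat B (\<lambda>k C. (1 - pf k C) * C)"
  define Ps where "Ps k = pf k (Bs k)" for k
  define Rs where "Rs k = rf k (Bs k)" for k
  have Bs: "Bs 0 = B" "\<And>k. Bs (Suc k) = (1 - Ps k) * Bs k" by (simp_all add: Bs_def Ps_def)
  have Ps: "\<And>k. orth_proj (Ps k)" "\<And>k. Ps k = Bs k * Rs k" "\<And>k. norm (Bs (Suc k)) \<le> (1/2) ^ k"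
    using pf unfolding Bs(2) unfolding Ps_def Rs_def by blast+
  note PD = orth_projD[OF Ps(1)]
  \<comment> \<open>A remainder stays annihilated by all earlier projections. Since
    \<open>Ps k\<close> factors through \<open>Bs k\<close>, the pieces are mutually
    orthogonal.\<close>
  have PB: "Ps j * Bs (Suc j + i) = 0" for i j
  proof (induction i)
    case 0
    show ?case by (simp add: Bs algebra_simps PD)
  next
    case (Suc i)
    have "Ps j * Ps (Suc j + i) = 0" unfolding Ps(2)[of "Suc j + i"]
      using Suc by (metis mult.assoc mult_zero_left)
    then have "Ps j * (Ps (Suc j + i) * Bs (Suc j + i)) = 0" by (metis mult.assoc mult_zero_left)
    moreover have "Bs (Suc j + Suc i) = (1 - Ps (Suc j + i)) * Bs (Suc j + i)" by (simp add: Bs)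
    ultimately show ?case using Suc by (simp only: right_diff_distrib left_diff_distrib) simp
  qed
  have PP0: "Ps j * Ps k = 0" if "j < k" for j k
  proof -
    have "Ps j * Bs k = 0" using PB[of j "k - Suc j"] that by simp
    then show ?thesis unfolding Ps(2)[of k] by (metis mult.assoc mult_zero_left)
  qed
  have PP: "Ps j * Ps k = 0" if "j \<noteq> k" for j k
    using PP0[of j k] PP0[of k j] proj_zero_swap[OF Ps(1) Ps(1)] that by (meson linorder_neqE_nat)
  have ABk: "cpt (A * Bs k)" for k
  proof (induction k)
    case (Suc k)
    have "A * Bs (Suc k) = A * Bs k - A * Bs k * (Rs k * Bs k)"
      using arg_cong[OF Ps(2)[of k], of "\<lambda>P. A * (P * Bs k)"] by (simp add: Bs algebra_simps)
    then show ?case using cpt_diff[OF Suc cpt_mult_right[OF Suc]] by metis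
  qed (simp add: Bs AB)
  have "cpt (A * Ps k)" for k
    unfolding Ps(2)[of k] using cpt_mult_right[OF ABk] by (simp add: mult.assoc)
  then have "\<exists>F. orth_proj F \<and> cpt F \<and> Ps k * F = F \<and> norm (A * Ps k * (Ps k - F)) \<le> (1/2) ^ k" for k
    using cpt_small_off_finite_proj[of "A * Ps k" "Ps k" "(1/2) ^ k"] Ps(1)[of k]
    by (metis zero_less_divide_1_iff zero_less_numeral zero_less_power)
  then obtain F where F: "\<And>k. orth_proj (F k)" "\<And>k. cpt (F k)" "\<And>k. Ps k * F k = F k"
      "\<And>k. norm (A * Ps k * (Ps k - F k)) \<le> (1/2) ^ k" by metis
  define E where "E k = Ps k - F k" for k
  have E: "orth_proj (E k)" for k unfolding E_def by (rule orth_proj_diff[OF Ps(1) F(1) F(3)])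
  have PE: "Ps k * E k = E k" for k by (simp add: E_def right_diff_distrib PD F)
  have FP: "F k * Ps k = F k" for k by (rule proj_mult_swap[OF Ps(1) F(1) F(3)])
  have EP: "E k * Ps k = E k" for k by (rule proj_mult_swap[OF Ps(1) E PE])
  have EE: "E j * E k = (if j = k then E k else 0)" for j k
  proof (cases "j = k")
    case False
    have "E j * E k = E j * (Ps j * Ps k) * E k" using EP PE by (metis mult.assoc)
    then show ?thesis using PP False by simp
  qed (simp add: orth_projD[OF E])
  have AE: "norm (A * E k) \<le> (1/2) ^ k" "cpt (A * E k)" for k
    using F(4)[of k] \<open>\<And>k. cpt (A * Ps k)\<close>[of k] cpt_mult_right[of "A * Ps k" "E k"] PE[of k]
    by (simp_all add: mult.assoc E_def[symmetric])
  \<comment> \<open>The sum of the \<open>E k\<close> need not converge in norm, so the limit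
    projection is defined through the closed span of their ranges, and identities for it are checked
    on the \<open>E k\<close> by density.\<close>
  define M where "M = closure {x. \<exists>n. (\<Sum>k<n. E k) *\<^sub>V x = x}"
  have sE: "(\<Sum>k<n. E k) * E j = (if j < n then E j else 0)" for n j
    by (simp add: sum_distrib_right EE)
  have sEE: "(\<Sum>k<n. E k) * (\<Sum>j<m. E j) = (\<Sum>j<m. E j)" if "m \<le> n" for m n
    using that by (simp add: sum_distrib_left sE)
  have fix_mono: "(\<Sum>k<n. E k) *\<^sub>V x = x" if "(\<Sum>k<m. E k) *\<^sub>V x = x" "m \<le> n" for m n x
    using that(1) sEE[OF that(2)] by (metis app_ops(6))
  have M0: "csubspace {x. \<exists>n. (\<Sum>k<n. E k) *\<^sub>V x = x}"
    unfolding cv.subspace_def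
  proof (intro conjI ballI allI, goal_cases)
    case (2 x y)
    then obtain m n where mn: "(\<Sum>k<m. E k) *\<^sub>V x = x" "(\<Sum>k<n. E k) *\<^sub>V y = y" by blast
    then have "(\<Sum>k<max m n. E k) *\<^sub>V x = x" "(\<Sum>k<max m n. E k) *\<^sub>V y = y"
      by (auto intro: fix_mono)
    then show ?case by (auto intro!: exI[of _ "max m n"])
  qed auto
  have M: "csubspace M" "closed M" unfolding M_def by (auto intro: csubspace_closure M0)
  define P where "P = proj M"
  have P: "orth_proj P" unfolding P_def by (rule orth_proj_proj[OF M])
  have PEk: "P * E k = E k" for k
  proof (rule bop_eqI)
    fix x
    have "(\<Sum>i<Suc k. E i) *\<^sub>V E k *\<^sub>V x = E k *\<^sub>V x" using sE[of "Suc k" k] by (metis app_ops(6) lessI)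
    then have "E k *\<^sub>V x \<in> M" unfolding M_def by (intro subsetD[OF closure_subset]) blast
    then show "(P * E k) *\<^sub>V x = E k *\<^sub>V x" using proj_id[OF M] by (simp add: P_def)
  qed
  have EkP: "E k * P = E k" for k by (rule proj_mult_swap[OF P E PEk])
  have M_eqI: "S * P = T * P" if "\<And>k. S * E k = T * E k" for S T
  proof -
    have "M \<subseteq> {x. S *\<^sub>V x = T *\<^sub>V x}"
      unfolding M_def
    proof (rule closure_minimal[OF _ app_eq_closed], safe)
      fix x n assume x: "(\<Sum>k<n. E k) *\<^sub>V x = x"
      have "S * (\<Sum>k<n. E k) = T * (\<Sum>k<n. E k)" using that by (simp add: sum_distrib_left)
      then show "S *\<^sub>V x = T *\<^sub>V x" using x by (metis app_ops(6))
    qed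
    then show ?thesis using proj_props(1)[OF M] by (intro bop_eqI) (auto simp: P_def)
  qed
  have sm: "summable (\<lambda>k. A * E k)"
    by (rule summable_comparison_test'[of "\<lambda>k. (1/2::real) ^ k"]) (use AE in auto)
  then have lim: "(\<lambda>n. \<Sum>k<n. A * E k) \<longlonglongrightarrow> (\<Sum>k. A * E k)" by (rule summable_LIMSEQ)
  have cptA: "cpt (\<Sum>k. A * E k)" by (rule cpt_limit[OF lim]) (intro cpt_sum AE)
  have "(\<Sum>k. A * E k) * E j = A * E j" for j
  proof -
    have "(\<lambda>n. (\<Sum>k<n. A * E k) * E j) \<longlonglongrightarrow> (\<Sum>k. A * E k) * E j" by (intro tendsto_intros lim)
    moreover have sA: "(\<Sum>k<n. A * E k) * E j = (if j < n then A * E j else 0)" for n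
      using arg_cong[OF sE[of n j], of "\<lambda>T. A * T"] by (simp add: sum_distrib_left mult.assoc[symmetric])
    have "\<forall>\<^sub>F n in sequentially. (\<Sum>k<n. A * E k) * E j = A * E j"
      by (rule eventually_sequentiallyI[of "Suc j"]) (simp add: sA)
    then have "(\<lambda>n. (\<Sum>k<n. A * E k) * E j) \<longlonglongrightarrow> A * E j" by (rule tendsto_eventually)
    ultimately show ?thesis using LIMSEQ_unique by blast
  qed
  then have "(\<Sum>k. A * E k) * P = A * P" by (intro M_eqI) auto
  then have AP: "cpt (A * P)" using cpt_mult_right[OF cptA] by metis
  have PsBs: "Ps k * Bs j = Ps k * B" if "j \<le> k" for j k
    using that
  proof (induction j)
    case (Suc j)
    have "Ps k * (Ps j * Bs j) = 0" using PP[of k j] Suc.prems by (metis mult.assoc mult_zero_left Suc_n_not_le_n)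
    then show ?case using Suc by (simp add: Bs(2) algebra_simps)
  qed (simp add: Bs)
  have "B = Bs n + (\<Sum>k<n. Ps k * B)" for n
  proof (induction n)
    case (Suc n)
    then show ?case using PsBs[of n n] by (simp add: Bs(2) algebra_simps)
  qed (simp add: Bs)
  \<comment> \<open>\<open>1 - P\<close> annihilates \<open>E k\<close>, so only the compact
    \<open>F k\<close> survives of each piece. Up to a remainder of norm at most
    \<open>(1/2) ^ n\<close>, the operator \<open>(1 - P) * B\<close> is thus a finite sum of
    compact ones.\<close>
  moreover have "(1 - P) * (Ps k * B) = (1 - P) * F k * B" for k
  proof -
    have "Ps k = E k + F k" by (simp add: E_def)
    then have "(1 - P) * Ps k = (1 - P) * F k"
      by (simp add: distrib_left left_diff_distrib PEk)
    then show ?thesis by (metis mult.assoc)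
  qed
  ultimately have BB: "(1 - P) * B - (1 - P) * Bs n = (\<Sum>k<n. (1 - P) * F k * B)" for n
    by (metis (no_types, lifting) add_diff_cancel_left' distrib_left sum.cong sum_distrib_left)
  have "(\<lambda>n. (1 - P) * B - (1 - P) * Bs (Suc n)) \<longlonglongrightarrow> (1 - P) * B - 0"
  proof (rule tendsto_diff[OF tendsto_const Lim_null_comparison])
    show "\<forall>\<^sub>F n in sequentially. norm ((1 - P) * Bs (Suc n)) \<le> (1/2) ^ n"
      using order_trans[OF norm_mult_proj(2)[OF orth_proj_compl[OF P]] Ps(3)] by simp
    show "(\<lambda>n. (1/2::real) ^ n) \<longlonglongrightarrow> 0" by (rule LIMSEQ_realpow_zero) auto
  qed
  then have "cpt ((1 - P) * B - 0)"
    by (rule cpt_limit)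
      (unfold BB, intro cpt_sum cpt_mult_right[OF cpt_mult_left[OF F(2)]])
  then have "cpt ((1 - P) * B)" by simp
  \<comment> \<open>Every piece factors through a remainder of \<open>B\<close>, so a projection
    fixing the range of \<open>B\<close> fixes all pieces.\<close>
  moreover have "P0 * P = P" if P0: "orth_proj P0" "P0 * B = B" for P0
  proof -
    have Pk: "P0 * Bs k = Bs k \<and> P0 * Ps k = Ps k" for k
    proof (induction k)
      case 0
      then show ?case using P0(2) Ps(2)[of 0] by (metis Bs(1) mult.assoc)
    next
      case (Suc k)
      then have "P0 * Bs (Suc k) = Bs (Suc k)"
        by (simp add: Bs algebra_simps) (metis mult.assoc)
      then show ?case using Ps(2)[of "Suc k"] by (metis mult.assoc)
    qed
    have "P0 * E k = 1 * E k" for k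
    proof -
      have "P0 * F k = F k" using F(3)[of k] Pk[of k] by (metis mult.assoc)
      then show ?thesis using Pk[of k] by (simp add: E_def right_diff_distrib)
    qed
    then show ?thesis using M_eqI[of P0 1] by simp
  qed
  ultimately show ?thesis using that[OF P AP] by blast
qed

text \<open>The projection principle for \<open>(1 - T) * T\<close> gives \<open>Q\<close> with
  \<open>T * Q = Q\<close> and \<open>Q * T = T\<close> modulo compact operators, so
  \<open>Q\<close> has the right range. The off-diagonal term \<open>Q * T * (1 - Q)\<close>
  corrects the kernel and costs orthogonality, but not idempotence.\<close>

lemma lift_idempotent:
  fixes T :: "'a::chilbert_space bop"
  assumes T: "cpt (T * T - T)"
  obtains P where "P * P = P" "cpt (P - T)"
proof -
  have "cpt ((1 - T) * T)" using cpt_uminus[OF T] by (simp add: algebra_simps)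
  then obtain Q where Q: "orth_proj Q" "cpt ((1 - T) * Q)" "cpt ((1 - Q) * T)"
    using compact_product_projection[of "1 - T" T] by metis
  define P where "P = Q + Q * T * (1 - Q)"
  have "P * P = P" by (simp add: P_def algebra_simps orth_projD[OF Q(1)])
  moreover have "P - T = (1 - T) * Q - (1 - Q) * T + (1 - Q) * T * Q"
    by (simp add: P_def algebra_simps)
  then have "cpt (P - T)" using Q by (auto intro!: cpt_add cpt_diff cpt_mult_right)
  ultimately show ?thesis by (rule that)
qed

subsection \<open>The Calkin algebra as a type\<close>

quotient_type (overloaded) 'a calkin = "'a::chilbert_space bop" / "\<lambda>S T. cpt (S - T)"
  morphisms rep_calkin ck
proof (rule equivpI)
  show "reflp (\<lambda>S T :: 'a bop. cpt (S - T))" by (rule reflpI) (simp add: cpt_0)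
  show "symp (\<lambda>S T :: 'a bop. cpt (S - T))" by (rule sympI) (metis cpt_uminus minus_diff_eq)
  show "transp (\<lambda>S T :: 'a bop. cpt (S - T))"
  proof (rule transpI)
    fix S T U :: "'a bop" assume "cpt (S - T)" "cpt (T - U)"
    from cpt_add[OF this] show "cpt (S - U)" by simp
  qed
qed

text \<open>\<open>ring_1\<close> would demand \<open>0 \<noteq> 1\<close>, which fails when all
  operators are compact.\<close>

instantiation calkin :: (chilbert_space) "{ring, monoid_mult}"
begin
lift_definition zero_calkin :: "'a calkin" is 0 .
lift_definition one_calkin :: "'a calkin" is 1 .
lift_definition plus_calkin :: "'a calkin \<Rightarrow> 'a calkin \<Rightarrow> 'a calkin" is "(+)"
  using cpt_add by (fastforce simp: add_diff_add)
lift_definition minus_calkin :: "'a calkin \<Rightarrow> 'a calkin \<Rightarrow> 'a calkin" is "(-)"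
proof -
  fix S S' T T' :: "'a bop" assume "cpt (S - S')" "cpt (T - T')"
  from cpt_diff[OF this] show "cpt (S - T - (S' - T'))" by (simp add: algebra_simps)
qed
lift_definition uminus_calkin :: "'a calkin \<Rightarrow> 'a calkin" is uminus
  using cpt_uminus by fastforce
lift_definition times_calkin :: "'a calkin \<Rightarrow> 'a calkin \<Rightarrow> 'a calkin" is "(*)"
proof -
  fix S S' T T' :: "'a bop" assume "cpt (S - S')" "cpt (T - T')"
  then have "cpt ((S - S') * T + S' * (T - T'))" by (intro cpt_add cpt_mult_left cpt_mult_right)
  then show "cpt (S * T - S' * T')" by (simp add: algebra_simps)
qed
instance
  by standard (transfer; simp add: cpt_0 algebra_simps)+
end

lemma ck_ops: "ck (S + T) = ck S + ck T" "ck (S - T) = ck S - ck T" "ck (- S) = - ck S"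
    "ck (S * T) = ck S * ck T" "ck 0 = 0" "ck 1 = 1"
  by (transfer; simp add: cpt_0)+

lemma ck_power: "ck (S ^ n) = ck S ^ n"
  by (induction n) (simp_all add: ck_ops)

lemma ck_eq_iff: "ck S = ck T \<longleftrightarrow> cpt (S - T)"
  by (rule calkin.abs_eq_iff)

lemma ck_eq_0_iff: "ck S = 0 \<longleftrightarrow> cpt S"
  using ck_eq_iff[of S 0] by (simp add: ck_ops)

lemma ck_surj: obtains S where "x = ck S"
  by (metis Quotient3_abs_rep Quotient3_calkin)

text \<open>The projection principle for \<open>A ^ Suc m * A\<close> gives \<open>P\<close> that
  contains the range of \<open>A\<close> modulo compact operators, while \<open>A ^ Suc m\<close>
  vanishes on it. So the compression \<open>P * A * P\<close> has nilpotency index one less, and the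
  induction hypothesis applies in the corner of \<open>P\<close>; this is the reason for the general
  \<open>P0\<close>.\<close>

lemma lift_nilpotent:
  fixes A :: "'a::chilbert_space bop"
  assumes "orth_proj P0" "P0 * A = A" "A * P0 = A" "ck A ^ Suc m = 0"
  shows "\<exists>N. P0 * N = N \<and> N * P0 = N \<and> ck N = ck A \<and> N ^ Suc m = 0"
  using assms
proof (induction m arbitrary: P0 A)
  case 0
  then show ?case by (intro exI[of _ 0]) (simp add: ck_ops)
next
  case (Suc m)
  have "ck (A ^ Suc m * A) = 0" using Suc.prems(4) by (simp only: power_Suc2 ck_ops ck_power)
  then obtain P where P: "orth_proj P" "cpt (A ^ Suc m * P)" "cpt ((1 - P) * A)" "P0 * P = P"
    using compact_product_projection[of "A ^ Suc m" A] Suc.prems(1,2) by (metis ck_eq_0_iff)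
  have pa: "ck P * ck A = ck A" using P(3) by (simp flip: ck_eq_0_iff add: ck_ops algebra_simps)
  have ap: "ck A ^ Suc m * ck P = 0" using P(2) by (simp only: ck_ops ck_power flip: ck_eq_0_iff)
  have PP0: "P * P0 = P" by (rule proj_mult_swap[OF Suc.prems(1) P(1,4)])
  have pow: "ck (P * A * P) ^ Suc k = ck A ^ Suc k * ck P" for k
  proof (induction k)
    case 0
    then show ?case by (simp add: ck_ops pa)
  next
    case (Suc k)
    have "ck (P * A * P) ^ Suc (Suc k) = ck P * ck A * (ck P * ck A) * (ck A ^ k * ck P)"
      using Suc by (simp add: ck_ops mult.assoc)
    then show ?case by (simp add: pa mult.assoc)
  qed
  have "\<exists>N. P * N = N \<and> N * P = N \<and> ck N = ck (P * A * P) \<and> N ^ Suc m = 0"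
  proof (rule Suc.IH[OF P(1)])
    show "ck (P * A * P) ^ Suc m = 0" using pow[of m] ap by metis
  qed (simp_all add: orth_projD[OF P(1)] mult.assoc)
  then obtain N where N: "P * N = N" "N * P = N" "ck N = ck (P * A * P)" "N ^ Suc m = 0" by blast
  define R where "R = P0 - P"
  \<comment> \<open>The missing block maps the complement of \<open>P\<close> in \<open>P0\<close>
    into \<open>P\<close>. Hence \<open>R * L = 0\<close>, and each power of \<open>L\<close> is a
    power of \<open>N\<close> times \<open>L\<close>: the index grows by one only.\<close>
  define L where "L = N + P * A * R"
  have RP: "R * P = 0" by (simp add: R_def left_diff_distrib P orth_projD[OF P(1)])
  then have RN: "R * N = 0" by (metis N(1) mult.assoc mult_zero_left)
  have RL: "R * L = 0" by (simp add: L_def distrib_left RN mult.assoc[symmetric] RP)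
  have LL: "L * L = N * L" by (subst (1) L_def) (simp add: distrib_right mult.assoc RL)
  have LN: "L * N = N * N" by (simp add: L_def distrib_right mult.assoc RN)
  have "L ^ k * L = N ^ k * L" for k
  proof (induction k)
    case (Suc k)
    have "L * (N ^ k * L) = N * (N ^ k * L)"
      by (cases k) (simp_all add: LL mult.assoc[symmetric] LN)
    then show ?case using Suc by (simp add: mult.assoc)
  qed simp
  from this[of "Suc m"] have "L ^ Suc (Suc m) = 0" by (simp only: N(4) power_Suc2[of L "Suc m"]) simp
  moreover have "P0 * L = L"
    using N(1) P(4) by (simp add: L_def distrib_left mult.assoc[symmetric]) (metis mult.assoc)
  moreover have "L * P0 = L"
  proof -
    have "N * P0 = N" using N(2) PP0 by (metis mult.assoc)
    moreover have "R * P0 = R" by (simp add: R_def left_diff_distrib PP0 orth_projD[OF Suc.prems(1)])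
    ultimately show ?thesis by (simp add: L_def distrib_right mult.assoc)
  qed
  moreover have "ck L = ck A"
  proof -
    have "ck L = ck A * ck P + ck A * (ck P0 - ck P)" by (simp add: L_def R_def ck_ops N(3) pa)
    also have "\<dots> = ck (A * P0)" by (simp add: algebra_simps ck_ops)
    finally show ?thesis by (simp add: Suc.prems)
  qed
  ultimately show ?case by blast
qed

subsection \<open>The spectral radius in the Calkin algebra\<close>

text \<open>The quotient norm, that is, the distance from the compact operators, as a plain function
  beside the purely algebraic type \<open>calkin\<close>.\<close>

definition ess_norm :: "'a::chilbert_space calkin \<Rightarrow> real"
  where "ess_norm x = Inf {norm S |S. ck S = x}"

lemma ess_norm_le: "ess_norm (ck S) \<le> norm S"
  unfolding ess_norm_def by (rule cInf_lower) (auto intro: bdd_belowI[of _ 0])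

lemma ess_norm_less:
  assumes "ess_norm x < c" obtains S where "ck S = x" "norm S < c"
proof -
  obtain S0 where "x = ck S0" by (rule ck_surj)
  then have ne: "{norm S |S. ck S = x} \<noteq> {}" by blast
  obtain r where "r \<in> {norm S |S. ck S = x}" "r < c"
    using cInf_lessD[OF ne assms[unfolded ess_norm_def]] by blast
  then show ?thesis using that by blast
qed

lemma ess_norm_nonneg [simp]: "0 \<le> ess_norm x"
proof (rule ccontr)
  assume "\<not> ?thesis"
  then have "ess_norm x < 0" by simp
  then obtain S where "ck S = x" "norm S < 0" by (rule ess_norm_less)
  then show False by simp
qed

lemma ess_norm_add: "ess_norm (x + y) \<le> ess_norm x + ess_norm y"
proof (rule field_le_epsilon)
  fix d :: real assume "0 < d"
  then have "ess_norm x < ess_norm x + d / 2" "ess_norm y < ess_norm y + d / 2" by auto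
  then obtain S T where "ck S = x" "norm S < ess_norm x + d / 2" "ck T = y" "norm T < ess_norm y + d / 2"
    using ess_norm_less by metis
  then show "ess_norm (x + y) \<le> ess_norm x + ess_norm y + d"
    using ess_norm_le[of "S + T"] norm_triangle_ineq[of S T] by (simp add: ck_ops)
qed

lemma ess_norm_mult: "ess_norm (x * y) \<le> ess_norm x * ess_norm y"
proof (rule field_le_epsilon)
  fix d :: real assume d: "0 < d"
  define m where "m = ess_norm x + ess_norm y + 1"
  \<comment> \<open>For \<open>t \<le> 1\<close> the excess of
    \<open>(ess_norm x + t) * (ess_norm y + t)\<close> over the product is at most
    \<open>t * m\<close>, hence at most \<open>d\<close>.\<close>
  define t where "t = min 1 (d / m)"
  have m: "m > 0" by (simp add: m_def add_nonneg_pos)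
  have t: "0 < t" "t \<le> 1" "t * m \<le> d" using d m by (auto simp: t_def min_def field_simps)
  have "ess_norm x < ess_norm x + t" "ess_norm y < ess_norm y + t" using t by auto
  then obtain S T where ST: "ck S = x" "norm S < ess_norm x + t" "ck T = y" "norm T < ess_norm y + t"
    using ess_norm_less by metis
  have "ess_norm (x * y) \<le> norm S * norm T"
    using order_trans[OF ess_norm_le norm_mult_ineq, of S T] ST by (simp add: ck_ops)
  also have "\<dots> \<le> (ess_norm x + t) * (ess_norm y + t)"
    using ST t ess_norm_nonneg[of x] by (intro mult_mono) auto
  also have "\<dots> = ess_norm x * ess_norm y + t * (ess_norm x + ess_norm y + t)" by (simp add: algebra_simps)
  also have "t * (ess_norm x + ess_norm y + t) \<le> t * m"
    using t by (intro mult_left_mono) (auto simp: m_def)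
  finally show "ess_norm (x * y) \<le> ess_norm x * ess_norm y + d" using t by linarith
qed

lemma ess_norm_0: "ess_norm (0 :: 'a::chilbert_space calkin) = 0"
  using ess_norm_le[of "0 :: 'a bop"] ess_norm_nonneg[of "0 :: 'a calkin"] by (simp add: ck_ops)

lemma ess_norm_1: "ess_norm (1 :: 'a::chilbert_space calkin) \<le> 1"
  using order_trans[OF ess_norm_le norm_one_bop[where 'a = 'a]] by (simp add: ck_ops)

definition csc :: "complex \<Rightarrow> 'a::chilbert_space calkin"
  where "csc z = ck (scal z)"

lemma csc_simps: "csc (z + w) = csc z + csc w" "csc (z * w) = csc z * csc w"
  "csc 1 = 1" "csc 0 = 0" "csc (- z) = - csc z" "csc (z - w) = csc z - csc w"
  by (simp_all add: csc_def scal_simps ck_ops)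

lemma csc_commute: "x * csc z = csc z * x"
  using ck_surj[of x] by (metis csc_def ck_ops(4) scal_commute)

lemma csc_commute': "x * (csc z * y) = csc z * (x * y)"
  by (metis csc_commute mult.assoc)

lemma csc_power: "(csc z * x) ^ n = csc (z ^ n) * x ^ n"
  by (induction n) (simp_all add: csc_simps(2,3) mult.assoc csc_commute'[of x])

lemma csc_cancel: "z \<noteq> 0 \<Longrightarrow> csc z * (csc (1 / z) * x) = x"
  by (simp add: mult.assoc[symmetric] csc_simps(2)[symmetric] csc_simps(3))

lemma ess_norm_csc: "ess_norm (csc z * x) \<le> cmod z * ess_norm x"
proof (rule order_trans[OF ess_norm_mult mult_right_mono[OF _ ess_norm_nonneg]])
  show "ess_norm (csc z :: 'a calkin) \<le> cmod z"
    unfolding csc_def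
    by (rule order_trans[OF ess_norm_le norm_bop_bound]) (auto simp: norm_scaleC)
qed

lemma ess_norm_uminus: "ess_norm (- x) = ess_norm x"
  using ess_norm_csc[of "-1" x] ess_norm_csc[of "-1" "- x"] by (simp add: csc_simps)

lemma ess_norm_diff: "ess_norm (x - y) \<le> ess_norm x + ess_norm y"
  using ess_norm_add[of x "- y"] by (simp add: ess_norm_uminus)

text \<open>Rickart's elementary proof of the spectral radius formula. The inverses of \<open>1 - (u a)^2^k\<close>, as
  averages of values of \<open>V\<close> on a circle, are Lipschitz in \<open>u\<close> uniformly in \<open>k\<close>; so if the powers tend
  to 0 at some \<open>u\<close>, they are bounded at slightly larger values.\<close>

lemma ess_resolvent_powers_tendsto_0:
  fixes a :: "'a::chilbert_space calkin"
  assumes V: "\<And>u. V u * (1 - csc u * a) = 1" "\<And>u. (1 - csc u * a) * V u = 1"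
    and t: "t > 0"
  shows "(\<lambda>k. ess_norm ((csc (of_real t) * a) ^ (2 ^ k))) \<longlonglongrightarrow> 0"
proof -
  let ?q = "ess_norm :: 'a calkin \<Rightarrow> real"
  note q0 = ess_norm_nonneg
  have Vdiff: "V u - V v = csc (u - v) * (V u * (a * V v))" for u v
  proof -
    have "V u * ((1 - csc v * a) - (1 - csc u * a)) * V v = V u * ((1 - csc v * a) * V v) - V u * (1 - csc u * a) * V v"
      by (simp add: algebra_simps)
    also have "\<dots> = V u - V v" by (simp add: V)
    finally have "V u - V v = V u * (csc (u - v) * a) * V v" by (simp add: csc_simps algebra_simps)
    then show ?thesis by (simp add: mult.assoc csc_commute')
  qed
  have Vd: "?q (V u - V v) \<le> cmod (u - v) * (?q (V u) * (?q a * ?q (V v)))" for u v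
    unfolding Vdiff
    by (intro order_trans[OF ess_norm_csc] mult_left_mono order_trans[OF ess_norm_mult] ess_norm_mult q0) auto
  \<comment> \<open>Otherwise points with unbounded values cluster at some \<open>l\<close>, while
    near \<open>l\<close> the resolvent identity bounds the norm of \<open>V\<close> by twice its
    value at \<open>l\<close>.\<close>
  have "\<exists>M. \<forall>u\<in>cball 0 (2 * t). ?q (V u) \<le> M"
  proof (rule ccontr)
    assume "\<not> ?thesis"
    then have "\<forall>n::nat. \<exists>u\<in>cball 0 (2 * t). ?q (V u) > real n" by (meson not_le)
    then obtain u where u: "\<And>n. u n \<in> cball 0 (2 * t)" "\<And>n::nat. ?q (V (u n)) > real n" by metis
    obtain l r where lr: "strict_mono (r :: nat \<Rightarrow> nat)" "(u \<circ> r) \<longlonglongrightarrow> l"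
      using compact_cball[of "0::complex" "2 * t"] u(1) unfolding compact_def by metis
    have c: "0 \<le> ?q a * ?q (V l)" by simp
    define d where "d = 1 / (2 * (?q a * ?q (V l) + 1))"
    have "e * (1 / (2 * (e + 1))) \<le> 1/2" if "0 \<le> e" for e :: real using that by (simp add: field_simps)
    from this[OF c] have d: "d > 0" "d * (?q a * ?q (V l)) \<le> 1/2"
      using c by (simp_all add: d_def add_nonneg_pos mult.commute)
    have "\<forall>\<^sub>F n in sequentially. dist ((u \<circ> r) n) l < d" by (rule tendstoD[OF lr(2) d(1)])
    then obtain N where N: "\<And>n. n \<ge> N \<Longrightarrow> cmod (u (r n) - l) < d"
      by (auto simp: eventually_sequentially dist_norm)
    have bd: "?q (V (u (r n))) \<le> 2 * ?q (V l)" if "n \<ge> N" for n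
    proof -
      let ?w = "u (r n)"
      have "cmod (?w - l) * (?q (V ?w) * (?q a * ?q (V l))) \<le> d * (?q (V ?w) * (?q a * ?q (V l)))"
        using N[OF that] c q0 by (intro mult_right_mono) auto
      also have "\<dots> = ?q (V ?w) * (d * (?q a * ?q (V l)))" by (simp add: mult_ac)
      also have "\<dots> \<le> ?q (V ?w) * (1/2)" using d q0 by (intro mult_left_mono) auto
      finally have "?q (V ?w - V l) \<le> ?q (V ?w) / 2" using Vd[of ?w l] by simp
      then show ?thesis using ess_norm_add[of "V ?w - V l" "V l"] by simp
    qed
    obtain n where n: "n \<ge> N" "real n \<ge> 2 * ?q (V l)"
      using real_arch_simple[of "2 * ?q (V l)"] by (metis max.cobounded1 max.cobounded2 of_nat_mono order_trans)
    have "n \<le> r n" using lr(1) by (rule seq_suble)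
    then show False using bd[OF n(1)] n(2) u(2)[of "r n"] by linarith
  qed
  then obtain M where "\<forall>u\<in>cball 0 (2 * t). ?q (V u) \<le> M" by blast
  then have M: "?q (V u) \<le> M" if "cmod u \<le> 2 * t" for u using that by simp
  have M0: "0 \<le> M" using order_trans[OF q0 M[of 0]] t by simp
  define L where "L = M * (?q a * M)"
  have L0: "0 \<le> L" using M0 q0 by (simp add: L_def)
  have Lip: "?q (V u - V v) \<le> L * cmod (u - v)" if "cmod u \<le> 2 * t" "cmod v \<le> 2 * t" for u v
  proof -
    have "?q (V u) * (?q a * ?q (V v)) \<le> L"
      unfolding L_def using M that M0 q0 by (intro mult_mono) auto
    then show ?thesis using Vd[of u v] mult_left_mono[of _ L "cmod (u - v)"] by (metis mult.commute norm_ge_zero order_trans)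
  qed
  \<comment> \<open>A rotation of \<open>u\<close> by \<open>w k\<close> changes the sign of the
    power with exponent \<open>2 ^ k\<close>.\<close>
  define w where "w k = cis (pi / 2 ^ k)" for k :: nat
  have w: "cmod (w k) = 1" "w k ^ (2 ^ k) = -1" for k
  proof -
    have "w k ^ (2 ^ k) = cis (real (2 ^ k) * (pi / 2 ^ k))" unfolding w_def by (rule Complex.DeMoivre)
    also have "real (2 ^ k) * (pi / 2 ^ k) = pi" by simp
    finally show "w k ^ (2 ^ k) = -1" by simp
  qed (simp add: w_def)
  \<comment> \<open>Since \<open>1/(1 - b^2)\<close> is the mean of \<open>1/(1 - b)\<close> and
    \<open>1/(1 + b)\<close>, the value \<open>G k u\<close> inverts
    \<open>1 - (csc u * a) ^ (2 ^ k)\<close>. Averaging preserves the bound \<open>M\<close> and the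
    Lipschitz constant \<open>L\<close>.\<close>
  define G where "G = rec_nat V (\<lambda>k g u. csc (1/2) * (g u + g (w k * u)))"
  have G: "G 0 = V" "\<And>k u. G (Suc k) u = csc (1/2) * (G k u + G k (w k * u))" by (simp_all add: G_def)
  have Ginv: "G k u * (1 - (csc u * a) ^ (2 ^ k)) = 1" for k u
  proof (induction k arbitrary: u)
    case (Suc k)
    define b where "b = (csc u * a) ^ (2 ^ k)"
    have "(csc (w k * u) * a) ^ (2 ^ k) = - b"
      by (simp add: b_def csc_power power_mult_distrib w csc_simps(5))
    then have 1: "G k u * (1 - b) = 1" "G k (w k * u) * (1 + b) = 1"
      using Suc[of u] Suc[of "w k * u"] by (simp_all add: b_def)
    have "(csc u * a) ^ (2 ^ Suc k) = b * b" by (simp add: b_def mult_2 power_add)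
    then have "G (Suc k) u * (1 - (csc u * a) ^ (2 ^ Suc k))
        = csc (1/2) * (G k u * (1 - b) * (1 + b) + G k (w k * u) * (1 + b) * (1 - b))"
      by (simp add: G algebra_simps)
    also have "\<dots> = csc (1/2) * (csc 1 + csc 1)" by (simp add: 1 csc_simps(3))
    also have "\<dots> = 1" by (simp only: csc_simps(1,2)[symmetric]) (simp add: csc_simps(3))
    finally show ?case .
  qed (simp add: G V)
  have half: "?q (csc (1/2) * (x + y)) \<le> (?q x + ?q y) / 2" for x y
    using ess_norm_csc[of "1/2" "x + y"] ess_norm_add[of x y] by simp
  have GM: "?q (G k u) \<le> M" if "cmod u \<le> 2 * t" for k u
    using that
  proof (induction k arbitrary: u)
    case (Suc k)
    have "?q (G k u) \<le> M" "?q (G k (w k * u)) \<le> M"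
      by (rule Suc.IH; use Suc.prems in \<open>simp add: norm_mult w\<close>)+
    then show ?case using half[of "G k u" "G k (w k * u)"] unfolding G(2) by argo
  qed (simp add: G M)
  have GL: "?q (G k u - G k v) \<le> L * cmod (u - v)" if "cmod u \<le> 2 * t" "cmod v \<le> 2 * t" for k u v
    using that
  proof (induction k arbitrary: u v)
    case (Suc k)
    have eq1: "G (Suc k) u - G (Suc k) v = csc (1/2) * ((G k u - G k v) + (G k (w k * u) - G k (w k * v)))"
      by (simp add: G algebra_simps)
    have eq2: "cmod (w k * u - w k * v) = cmod (u - v)"
      by (metis mult.left_neutral norm_mult right_diff_distrib w(1))
    have IH: "?q (G k u - G k v) \<le> L * cmod (u - v)"
        "?q (G k (w k * u) - G k (w k * v)) \<le> L * cmod (w k * u - w k * v)"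
      by (rule Suc.IH; use Suc.prems in \<open>simp add: norm_mult w\<close>)+
    show ?case unfolding eq1
      by (rule order_trans[OF half]) (use add_mono[OF IH(1) IH(2)[unfolded eq2]] in simp)
  qed (simp add: G Lip)
  \<comment> \<open>\<open>J\<close> steps of length \<open>h\<close> lead from 0 to
    \<open>t\<close>, and over a distance \<open>2 * h\<close> the Lipschitz constant allows a
    change of at most 1/4.\<close>
  obtain J :: nat where J: "real J \<ge> 8 * L * t + 1" using real_arch_simple by blast
  define h where "h = t / real J"
  have J1: "real J \<ge> 1" using J L0 t by (smt (verit) mult_nonneg_nonneg)
  have h: "h > 0" "h \<le> t" "real J * h = t" "8 * L * h \<le> 1"
    using J J1 t by (auto simp: h_def field_simps)
  define p where "p s k = ?q ((csc (of_real s) * a) ^ (2 ^ k))" for s :: real and k :: nat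
  have step: "p (s + h) \<longlonglongrightarrow> 0" if s: "p s \<longlonglongrightarrow> 0" "0 \<le> s" "s + 2 * h \<le> 2 * t" for s
  proof -
    \<comment> \<open>Eventually \<open>G k\<close> is within 1/4 of 1 at \<open>s\<close>, hence
      within 1/2 at \<open>v\<close>, which forces the powers at \<open>v\<close> to have norm at
      most 1. Retreating from \<open>v\<close> to \<open>s + h\<close> scales the base by a ratio
      below 1, so the powers tend to 0 again.\<close>
    define v where "v = s + 2 * h"
    have "\<forall>\<^sub>F k in sequentially. p s k < 1 / (4 * (M + 1))"
      by (rule order_tendstoD(2)[OF s(1)]) (use M0 in simp)
    then have bd: "\<forall>\<^sub>F k in sequentially. p v k \<le> 1"
    proof (rule eventually_mono)
      fix k assume k: "p s k < 1 / (4 * (M + 1))"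
      let ?F = "G k (of_real s)" and ?H = "G k (of_real v)"
      have nv: "cmod (of_real s) \<le> 2 * t" "cmod (of_real v) \<le> 2 * t"
        unfolding norm_of_real using s h by (auto simp: v_def)
      have "?F - 1 = ?F * (csc (of_real s) * a) ^ (2 ^ k)"
        using Ginv[of k "of_real s"] by (simp add: algebra_simps)
      then have "?q (?F - 1) \<le> M * p s k"
        using order_trans[OF ess_norm_mult mult_right_mono[OF GM[OF nv(1)] q0]] by (metis p_def)
      also have "\<dots> \<le> (M + 1) * (1 / (4 * (M + 1)))" using k M0 q0 by (intro mult_mono) (auto simp: p_def)
      also have "\<dots> = 1/4" using M0 by simp
      finally have 1: "?q (?F - 1) \<le> 1/4" .
      have "?q (?H - ?F) \<le> L * cmod (of_real v - of_real s)" by (rule GL[OF nv(2,1)])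
      also have "cmod (of_real v - of_real s) = 2 * h"
        using h(1) by (simp only: norm_of_real of_real_diff[symmetric]) (simp add: v_def)
      finally have "?q (?H - ?F) \<le> 1/4" using h by simp
      then have 2: "?q (?H - 1) \<le> 1/2" using 1 ess_norm_add[of "?H - ?F" "?F - 1"] by simp
      define X where "X = (csc (of_real v) * a) ^ (2 ^ k)"
      have "X = (?H - 1) * (1 - X)" using Ginv[of k "of_real v"] by (simp add: X_def algebra_simps)
      then have "?q X \<le> 1/2 * ?q (1 - X)"
        using order_trans[OF ess_norm_mult mult_right_mono[OF 2 q0]] by metis
      moreover have "?q (1 - X) \<le> 1 + ?q X" using ess_norm_diff[of 1 X] ess_norm_1 by (smt (verit))
      ultimately show "p v k \<le> 1" by (simp add: p_def X_def)
    qed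
    have v: "v > 0" "(s + h) / v < 1" "(s + h) / v \<ge> 0" using s h by (auto simp: v_def field_simps)
    show ?thesis
    proof (rule Lim_null_comparison)
      show "\<forall>\<^sub>F k in sequentially. norm (p (s + h) k) \<le> ((s + h) / v) ^ k"
        using bd
      proof (rule eventually_mono)
        fix k assume k: "p v k \<le> 1"
        have "csc (of_real (s + h)) * a = csc (of_real ((s + h) / v)) * (csc (of_real v) * a)"
          using v(1) by (simp add: mult.assoc[symmetric] csc_simps(2)[symmetric] flip: of_real_mult del: of_real_add of_real_divide)
        then have "p (s + h) k \<le> cmod (of_real ((s + h) / v) ^ (2 ^ k)) * p v k"
          unfolding p_def using ess_norm_csc csc_power by metis
        also have "\<dots> \<le> ((s + h) / v) ^ (2 ^ k) * 1"
          unfolding norm_power norm_of_real abs_of_nonneg[OF v(3)] using k v by (intro mult_left_mono) auto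
        also have "\<dots> \<le> ((s + h) / v) ^ k"
          using v by (simp only: mult_1_right) (intro power_decreasing, auto simp: less_imp_le)
        finally show "norm (p (s + h) k) \<le> ((s + h) / v) ^ k" using q0 by (simp add: p_def)
      qed
      show "(\<lambda>k. ((s + h) / v) ^ k) \<longlonglongrightarrow> 0" by (rule LIMSEQ_realpow_zero[OF v(3,2)])
    qed
  qed
  have "p (real j * h) \<longlonglongrightarrow> 0" if "j \<le> J" for j
    using that
  proof (induction j)
    case 0
    have "p 0 k = 0" for k
    proof -
      obtain m where "(2::nat) ^ k = Suc m" by (metis not0_implies_Suc power_not_zero zero_neq_numeral)
      then show ?thesis by (simp add: p_def csc_simps ess_norm_0)
    qed
    then show ?case by (simp add: tendsto_const[of 0])
  next
    case (Suc j)
    have "real (Suc j) * h \<le> real J * h" using Suc.prems h by (intro mult_right_mono) auto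
    then have "real j * h + 2 * h \<le> 2 * t" using h by (simp add: algebra_simps)
    from step[OF _ _ this] show ?case using Suc h by (simp add: algebra_simps)
  qed
  from this[of J] show ?thesis using h(3) by (simp add: p_def[abs_def])
qed

text \<open>The class of \<open>A\<close> in the Calkin algebra has spectral radius 0.\<close>

definition riesz :: "'a::chilbert_space bop \<Rightarrow> bool"
  where "riesz A \<longleftrightarrow> (\<forall>d>0. \<exists>n>0. \<exists>K. cpt K \<and> norm (A ^ n - K) < d ^ n)"

text \<open>For the class scaled by \<open>1 / d\<close> some power with exponent
  \<open>n = 2 ^ k\<close> has norm below 1. Scaling back gives \<open>d ^ n\<close>, and a
  representative of nearly minimal norm provides \<open>K\<close>.\<close>

lemma rieszI:
  fixes A :: "'a::chilbert_space bop"
  assumes inv: "\<And>z. z \<noteq> 0 \<Longrightarrow> \<exists>v. v * (csc z - ck A) = 1 \<and> (csc z - ck A) * v = 1"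
  shows "riesz A"
  unfolding riesz_def
proof (intro allI impI)
  fix d :: real assume d: "0 < d"
  have "\<exists>v. v * (1 - csc u * ck A) = 1 \<and> (1 - csc u * ck A) * v = 1" for u
  proof (cases "u = 0")
    case False
    then obtain v where v: "v * (csc (1 / u) - ck A) = 1" "(csc (1 / u) - ck A) * v = 1"
      using inv[of "1 / u"] by auto
    define W where "W = csc (1 / u) - ck A"
    have eq: "1 - csc u * ck A = csc u * W"
      using csc_cancel[OF False, of "1 :: 'a calkin"] by (simp add: W_def right_diff_distrib)
    have W: "v * W = 1" "W * v = 1" using v by (simp_all add: W_def)
    show ?thesis
    proof (intro exI[of _ "csc (1 / u) * v"] conjI)
      have "csc (1 / u) * v * (csc u * W) = csc (1 / u) * (csc u * (v * W))"
        by (simp only: mult.assoc csc_commute'[of v])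
      then show "csc (1 / u) * v * (1 - csc u * ck A) = 1"
        unfolding eq using W csc_cancel[of "1 / u" 1] False by simp
      have "csc u * W * (csc (1 / u) * v) = csc u * (csc (1 / u) * (W * v))"
        by (simp only: mult.assoc csc_commute'[of W])
      then show "(1 - csc u * ck A) * (csc (1 / u) * v) = 1"
        unfolding eq using W csc_cancel[of u 1] False by simp
    qed
  qed (auto simp: csc_simps intro: exI[of _ 1])
  then obtain V where V: "\<And>u. V u * (1 - csc u * ck A) = 1" "\<And>u. (1 - csc u * ck A) * V u = 1" by metis
  have "\<forall>\<^sub>F k in sequentially. ess_norm ((csc (of_real (1 / d)) * ck A) ^ (2 ^ k)) < 1"
    by (rule order_tendstoD(2)[OF ess_resolvent_powers_tendsto_0[OF V]]) (use d in auto)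
  then obtain k where k: "ess_norm ((csc (of_real (1 / d)) * ck A) ^ (2 ^ k)) < 1"
    by (auto simp: eventually_sequentially)
  define n where "n = (2::nat) ^ k"
  have "ck A ^ n = csc (of_real d ^ n) * (csc (of_real (1 / d)) * ck A) ^ n"
    using csc_cancel[of "of_real d" "ck A"] d by (simp flip: csc_power)
  then have "ess_norm (ck A ^ n) \<le> cmod (of_real d ^ n) * ess_norm ((csc (of_real (1 / d)) * ck A) ^ n)"
    using ess_norm_csc by metis
  also have "\<dots> < d ^ n * 1"
    using k d by (simp only: norm_power norm_of_real n_def) (simp add: abs_of_pos)
  finally have "ess_norm (ck A ^ n) < d ^ n" by simp
  then obtain S where S: "ck S = ck A ^ n" "norm S < d ^ n" using ess_norm_less by blast
  then have "cpt (A ^ n - S)" by (metis ck_eq_iff ck_power)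
  moreover have "norm (A ^ n - (A ^ n - S)) < d ^ n" using S by simp
  moreover have "n > 0" by (simp add: n_def)
  ultimately show "\<exists>n>0. \<exists>K. cpt K \<and> norm (A ^ n - K) < d ^ n" by blast
qed

subsection \<open>Operators that are proper on bounded sets\<close>

text \<open>Properness on bounded sets amounts to closed range and finite-dimensional kernel.\<close>

definition proper_on :: "'a::chilbert_space set \<Rightarrow> 'a bop \<Rightarrow> bool"
  where "proper_on N G \<longleftrightarrow> (\<forall>x B y. (\<forall>j::nat. x j \<in> N \<and> norm (x j) \<le> B) \<longrightarrow> (\<lambda>j. G *\<^sub>V x j) \<longlonglongrightarrow> y \<longrightarrow>
    (\<exists>r l. strict_mono r \<and> (\<lambda>j. x (r j)) \<longlonglongrightarrow> l))"

lemma proper_onE: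
  assumes "proper_on N G" "\<And>j. x j \<in> N" "\<And>j::nat. norm (x j) \<le> B" "(\<lambda>j. G *\<^sub>V x j) \<longlonglongrightarrow> y"
  obtains r l where "strict_mono r" "(\<lambda>j. x (r j)) \<longlonglongrightarrow> l"
  using assms unfolding proper_on_def by metis

text \<open>The left half of Atkinson's theorem: a left inverse modulo compact operators recovers
  \<open>x\<close> from its image up to \<open>K\<close>, which converges along a
  subsequence.\<close>

lemma proper_on_compact_perturbation:
  assumes L: "\<And>x. x \<in> N \<Longrightarrow> L *\<^sub>V G *\<^sub>V x = x + K *\<^sub>V x" and K: "cpt K"
  shows "proper_on N G"
  unfolding proper_on_def
proof (intro allI impI)
  fix x :: "nat \<Rightarrow> 'a" and B y
  assume x: "\<forall>j. x j \<in> N \<and> norm (x j) \<le> B" and y: "(\<lambda>j. G *\<^sub>V x j) \<longlonglongrightarrow> y"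
  obtain l r where lr: "strict_mono r" "(\<lambda>j. K *\<^sub>V x (r j)) \<longlonglongrightarrow> l"
    using cpt_convergent_subseq[OF K, of x B] x by blast
  have "(\<lambda>j. L *\<^sub>V G *\<^sub>V x (r j) - K *\<^sub>V x (r j)) \<longlonglongrightarrow> L *\<^sub>V y - l"
    using LIMSEQ_subseq_LIMSEQ[OF y lr(1)] by (intro tendsto_intros lr) (simp add: o_def)
  moreover have "(\<lambda>j. L *\<^sub>V G *\<^sub>V x (r j) - K *\<^sub>V x (r j)) = (\<lambda>j. x (r j))"
    using L x by auto
  ultimately show "\<exists>r l. strict_mono r \<and> (\<lambda>j. x (r j)) \<longlonglongrightarrow> l" using lr(1) by metis
qed

lemma proper_bounded_below:
  assumes N: "csubspace N" "closed N" and G: "proper_on N G"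
    and inj: "\<And>x. x \<in> N \<Longrightarrow> G *\<^sub>V x = 0 \<Longrightarrow> x = 0"
  obtains c where "c > 0" "\<And>x. x \<in> N \<Longrightarrow> c * norm x \<le> norm (G *\<^sub>V x)"
proof (rule ccontr)
  note found = that
  assume no: "\<not> thesis"
  have "\<exists>x\<in>N. norm x = 1 \<and> norm (G *\<^sub>V x) \<le> 1 / real (Suc j)" for j
  proof -
    obtain x where x: "x \<in> N" "1 / real (Suc j) * norm x > norm (G *\<^sub>V x)"
      using no found[of "1 / real (Suc j)"] by (metis not_le of_nat_0_less_iff zero_less_Suc zero_less_divide_1_iff)
    then have x0: "norm x > 0" by (cases "x = 0") auto
    define u where "u = (1 / norm x) *\<^sub>R x"
    have "u \<in> N" using x(1) subspaceD(3)[OF N(1)] by (simp add: u_def scaleR_scaleC)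
    moreover have "norm u = 1" using x0 by (simp add: u_def)
    moreover have "norm (G *\<^sub>V u) = norm (G *\<^sub>V x) / norm x" by (simp add: u_def)
    then have "norm (G *\<^sub>V u) \<le> 1 / real (Suc j)"
      using x(2) x0 by (simp add: divide_le_eq del: of_nat_Suc)
    ultimately show ?thesis by blast
  qed
  then obtain x where x: "\<And>j. x j \<in> N" "\<And>j. norm (x j) = 1" "\<And>j. norm (G *\<^sub>V x j) \<le> 1 / real (Suc j)"
    by metis
  have G0: "(\<lambda>j. G *\<^sub>V x j) \<longlonglongrightarrow> 0"
    by (rule Lim_null_comparison[OF _ LIMSEQ_inverse_real_of_nat]) (use x(3) in \<open>auto simp: inverse_eq_divide\<close>)
  obtain r l where rl: "strict_mono r" "(\<lambda>j. x (r j)) \<longlonglongrightarrow> l"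
    using proper_onE[OF G x(1) _ G0, of 1] x(2) by auto
  have "l \<in> N" by (rule closed_sequentially[OF N(2) _ rl(2)]) (rule x(1))
  moreover have "G *\<^sub>V l = 0"
    using LIMSEQ_unique[OF tendsto_app[OF rl(2)]] LIMSEQ_subseq_LIMSEQ[OF G0 rl(1)] by (simp add: o_def)
  moreover have "norm l = 1"
    using LIMSEQ_unique[OF tendsto_norm[OF rl(2)]] x(2) by simp
  ultimately show False using inj by fastforce
qed

text \<open>On the orthogonal complement of the kernel within \<open>N\<close> the operator is
  injective, hence bounded below, and its range is unchanged.\<close>

lemma proper_closed_range:
  assumes N: "csubspace N" "closed N" and G: "proper_on N G"
  shows "closed (app G ` N)"
proof -
  define Z where "Z = N \<inter> {x. G *\<^sub>V x = 0}"
  have Z: "csubspace Z" "closed Z"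
    unfolding Z_def by (rule cv.subspace_inter[OF N(1) ker_csubspace] closed_Int[OF N(2) ker_closed])+
  define N' where "N' = N \<inter> {x. proj Z *\<^sub>V x = 0}"
  have N': "csubspace N'" "closed N'"
    unfolding N'_def by (rule cv.subspace_inter[OF N(1) ker_csubspace] closed_Int[OF N(2) ker_closed])+
  have pr: "proper_on N' G" using G unfolding proper_on_def N'_def by blast
  have inj: "x = 0" if "x \<in> N'" "G *\<^sub>V x = 0" for x
    using that proj_id[OF Z, of x] by (auto simp: N'_def Z_def)
  obtain c where "c > 0" "\<And>x. x \<in> N' \<Longrightarrow> c * norm x \<le> norm (G *\<^sub>V x)"
    using proper_bounded_below[OF N' pr inj] by metis
  then have "closed (app G ` N')" by (rule closed_range_bounded_below[OF N'])
  moreover have "app G ` N' = app G ` N"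
  proof (intro equalityI subsetI)
    fix y assume "y \<in> app G ` N"
    then obtain x where x: "x \<in> N" "y = G *\<^sub>V x" by blast
    have p: "proj Z *\<^sub>V x \<in> Z" by (rule proj_props(1)[OF Z])
    then have pN: "proj Z *\<^sub>V x \<in> N" "G *\<^sub>V proj Z *\<^sub>V x = 0" unfolding Z_def by blast+
    have "proj Z *\<^sub>V proj Z *\<^sub>V x = proj Z *\<^sub>V x" by (rule proj_id[OF Z p])
    then have "x - proj Z *\<^sub>V x \<in> N'"
      using csubspace_diff[OF N(1) x(1) pN(1)] by (simp add: N'_def)
    moreover have "G *\<^sub>V (x - proj Z *\<^sub>V x) = y" using pN x(2) by simp
    ultimately show "y \<in> app G ` N'" by blast
  qed (auto simp: N'_def)
  ultimately show ?thesis by simp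
qed

text \<open>An orthonormal sequence in the kernel would have a norm convergent subsequence, but it
  is weakly null.\<close>

lemma proper_finite_dim_ker:
  assumes N: "csubspace N" and G: "proper_on N G"
  shows "cfinite_dim {x \<in> N. G *\<^sub>V x = 0}"
proof (rule ccontr)
  assume inf: "\<not> ?thesis"
  have V: "csubspace {x \<in> N. G *\<^sub>V x = 0}"
    using cv.subspace_inter[OF N ker_csubspace[of G]] by (simp add: Int_def)
  have "\<not> cfinite_codim {x \<in> N. G *\<^sub>V x = 0} {0}"
    using inf by (simp add: cfinite_dim_def cfinite_codim_def cv.span_insert_0)
  then obtain e where e: "orthonormal_seq e" "\<And>k. e k \<in> {x \<in> N. G *\<^sub>V x = 0}" "\<And>k. norm (e k) = 1"
    using infinite_codim_orthonormal_seq[OF V, of "{0}"] subspaceD(1)[OF V] by auto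
  have "e k \<in> N" "norm (e k) \<le> 1" for k using e by auto
  moreover have "(\<lambda>k. G *\<^sub>V e k) \<longlonglongrightarrow> 0" using e(2) by simp
  ultimately obtain r l where rl: "strict_mono r" "(\<lambda>j. e (r j)) \<longlonglongrightarrow> l"
    by (rule proper_onE[OF G])
  have "(\<lambda>j. cinner (e (r j)) l) \<longlonglongrightarrow> 0"
    using orthonormal_seq_weakly_null[OF orthonormal_seq_subseq[OF e(1) rl(1)]] by (simp add: o_def)
  moreover have "(\<lambda>j. cinner (e (r j)) l) \<longlonglongrightarrow> cinner l l" by (intro tendsto_intros rl)
  ultimately have "l = 0" using LIMSEQ_unique cinner_self_eq_0_iff by metis
  moreover have "norm l = 1" using LIMSEQ_unique[OF tendsto_norm[OF rl(2)]] e(3) by simp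
  ultimately show False by simp
qed

lemma proper_mult:
  assumes F: "proper_on N F" and G: "proper_on N G" and N: "\<And>x. x \<in> N \<Longrightarrow> G *\<^sub>V x \<in> N"
  shows "proper_on N (F * G)"
  unfolding proper_on_def
proof (intro allI impI)
  fix x :: "nat \<Rightarrow> 'a" and B y
  assume x: "\<forall>j. x j \<in> N \<and> norm (x j) \<le> B" and y: "(\<lambda>j. (F * G) *\<^sub>V x j) \<longlonglongrightarrow> y"
  have b: "G *\<^sub>V x j \<in> N" "norm (G *\<^sub>V x j) \<le> norm G * B" for j
    using order_trans[OF norm_app mult_left_mono, of "x j" B G] x N by simp_all
  have "(\<lambda>j. F *\<^sub>V G *\<^sub>V x j) \<longlonglongrightarrow> y" using y by simp
  then obtain r l where rl: "strict_mono r" "(\<lambda>j. G *\<^sub>V x (r j)) \<longlonglongrightarrow> l"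
    by (rule proper_onE[OF F b])
  have b': "x (r j) \<in> N" "norm (x (r j)) \<le> B" for j using x by blast+
  obtain s l' where sl: "strict_mono s" "(\<lambda>j. x (r (s j))) \<longlonglongrightarrow> l'"
    by (rule proper_onE[OF G b' rl(2)])
  show "\<exists>r l. strict_mono r \<and> (\<lambda>j. x (r j)) \<longlonglongrightarrow> l"
    by (rule exI[of _ "r \<circ> s"], rule exI[of _ l']) (use strict_mono_o[OF rl(1) sl(1)] sl(2) in simp)
qed

lemma power_invariant: "(\<And>x. x \<in> N \<Longrightarrow> G *\<^sub>V x \<in> N) \<Longrightarrow> x \<in> N \<Longrightarrow> (G ^ k) *\<^sub>V x \<in> N"
  by (induction k) auto

lemma proper_power:
  assumes "proper_on N G" "\<And>x. x \<in> N \<Longrightarrow> G *\<^sub>V x \<in> N"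
  shows "proper_on N (G ^ k)"
proof (induction k)
  case 0
  show ?case by (rule proper_on_compact_perturbation[where L = 1 and K = 0]) (auto simp: cpt_0)
next
  case (Suc k)
  then show ?case unfolding power_Suc by (intro proper_mult assms power_invariant)
qed

subsection \<open>Riesz operators\<close>

text \<open>The compact part \<open>K\<close> of \<open>A ^ n\<close> tends to 0 along
  \<open>e\<close>, so eventually \<open>A ^ n\<close> has norm below \<open>d ^ n\<close> on
  \<open>e k\<close>. The case \<open>n = 0\<close> is left out of the assumption because
  \<open>e k\<close> may be 0.\<close>

lemma riesz_orthonormal_tendsto_0:
  assumes A: "riesz A" and e: "orthonormal_seq e"
    and l: "\<And>k n. n > 0 \<Longrightarrow> cinner (e k) ((A ^ n) *\<^sub>V e k) = l k ^ n"
  shows "l \<longlonglongrightarrow> 0"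
proof (rule tendstoI)
  fix d :: real assume d: "0 < d"
  obtain n K where nK: "n > 0" "cpt K" "norm (A ^ n - K) < d ^ n"
    using A d unfolding riesz_def by blast
  have "(\<lambda>k. norm (K *\<^sub>V e k)) \<longlonglongrightarrow> 0"
    using cpt_orthonormal_tendsto[OF nK(2) e] tendsto_norm_zero by blast
  then have "\<forall>\<^sub>F k in sequentially. norm (K *\<^sub>V e k) < d ^ n - norm (A ^ n - K)"
    by (rule order_tendstoD(2)) (use nK in simp)
  then show "\<forall>\<^sub>F k in sequentially. dist (l k) 0 < d"
  proof (rule eventually_mono)
    fix k assume k: "norm (K *\<^sub>V e k) < d ^ n - norm (A ^ n - K)"
    have ek: "norm (e k) \<le> 1" using e by (simp add: orthonormal_seq_def)
    have "norm ((A ^ n - K) *\<^sub>V e k) \<le> norm (A ^ n - K) * 1"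
      by (rule order_trans[OF norm_app mult_left_mono[OF ek]]) simp
    then have "norm ((A ^ n) *\<^sub>V e k) < d ^ n"
      using k norm_triangle_ineq[of "(A ^ n - K) *\<^sub>V e k" "K *\<^sub>V e k"] by simp
    moreover have "cmod (cinner (e k) ((A ^ n) *\<^sub>V e k)) \<le> 1 * norm ((A ^ n) *\<^sub>V e k)"
      by (rule order_trans[OF cauchy_schwarz mult_right_mono[OF ek]]) simp
    ultimately have "cmod (l k) ^ n < d ^ n" using l[OF nK(1), of k] by (simp add: norm_power)
    then show "dist (l k) 0 < d" using d by (simp add: power_less_imp_less_base)
  qed
qed

text \<open>Passes from \<open>A - \<mu>\<close> to the power that \<open>riesz\<close> controls;
  commutation of the cofactor \<open>S\<close> is what later keeps ranges and kernels of powers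
  invariant under it.\<close>

lemma power_diff_factor:
  "\<exists>S. A ^ n - scal \<mu> ^ n = S * (A - scal \<mu>) \<and> S * (A - scal \<mu>) = (A - scal \<mu>) * S"
proof (induction n)
  case (Suc n)
  define G where "G = A - scal \<mu>"
  obtain S where S: "A ^ n - scal \<mu> ^ n = S * G" "S * G = G * S" using Suc G_def by blast
  have c: "scal \<mu> ^ n * T = T * scal \<mu> ^ n" for T :: "'a bop" by (metis scal_commute scal_power)
  have AG: "A * G = G * A" by (simp add: G_def algebra_simps scal_commute)
  have "A ^ Suc n - scal \<mu> ^ Suc n = A * (A ^ n - scal \<mu> ^ n) + G * scal \<mu> ^ n"
    by (simp add: G_def algebra_simps)
  also have "\<dots> = (A * S + scal \<mu> ^ n) * G" by (simp add: S(1) distrib_right mult.assoc c)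
  finally have 1: "A ^ Suc n - scal \<mu> ^ Suc n = (A * S + scal \<mu> ^ n) * G" .
  have "A * S * G = G * (A * S)" by (metis AG S(2) mult.assoc)
  then have "(A * S + scal \<mu> ^ n) * G = G * (A * S + scal \<mu> ^ n)"
    by (simp add: distrib_right distrib_left c)
  with 1 show ?case unfolding G_def by blast
qed (auto intro: exI[of _ 0])

text \<open>\<open>A ^ n - K - \<mu> ^ n\<close> is bounded below as soon as
  \<open>norm (A ^ n - K)\<close> is less than the modulus of \<open>\<mu> ^ n\<close>, and on
  \<open>x j\<close> it is computed from the values of \<open>A - \<mu>\<close> and
  \<open>K\<close>.\<close>

lemma riesz_proper:
  assumes A: "riesz A" and mu: "\<mu> \<noteq> 0"
  shows "proper_on UNIV (A - scal \<mu>)"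
  unfolding proper_on_def
proof (intro allI impI)
  fix x :: "nat \<Rightarrow> 'a" and B y
  assume x: "\<forall>j. x j \<in> UNIV \<and> norm (x j) \<le> B" and y: "(\<lambda>j. (A - scal \<mu>) *\<^sub>V x j) \<longlonglongrightarrow> y"
  have "cmod \<mu> > 0" using mu by simp
  then obtain n K where nK: "n > 0" "cpt K" "norm (A ^ n - K) < cmod \<mu> ^ n"
    using A unfolding riesz_def by blast
  obtain S where S: "A ^ n - scal \<mu> ^ n = S * (A - scal \<mu>)" using power_diff_factor by blast
  obtain l r where lr: "strict_mono r" "(\<lambda>j. K *\<^sub>V x (r j)) \<longlonglongrightarrow> l"
    using cpt_convergent_subseq[OF nK(2), of x B] x by blast
  define D where "D = A ^ n - K - scal (\<mu> ^ n)"
  define c where "c = cmod \<mu> ^ n - norm (A ^ n - K)"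
  have c: "c > 0" "c * norm u \<le> norm (D *\<^sub>V u)" for u
  proof -
    have "norm (\<mu> ^ n *\<^sub>C u) \<le> norm ((A ^ n - K) *\<^sub>V u) + norm (D *\<^sub>V u)"
      using norm_triangle_ineq4[of "(A ^ n - K) *\<^sub>V u" "D *\<^sub>V u"] by (simp add: D_def)
    then show "c * norm u \<le> norm (D *\<^sub>V u)"
      using norm_app[of "A ^ n - K" u] by (simp add: c_def norm_scaleC norm_power algebra_simps)
  qed (use nK in \<open>simp add: c_def\<close>)
  have Dx: "D *\<^sub>V x (r j) = S *\<^sub>V (A - scal \<mu>) *\<^sub>V x (r j) - K *\<^sub>V x (r j)" for j
  proof -
    have "D = S * (A - scal \<mu>) - K" by (simp add: D_def S[symmetric] scal_power)
    then show ?thesis by simp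
  qed
  have "(\<lambda>j. S *\<^sub>V (A - scal \<mu>) *\<^sub>V x (r j) - K *\<^sub>V x (r j)) \<longlonglongrightarrow> S *\<^sub>V y - l"
    using LIMSEQ_subseq_LIMSEQ[OF y lr(1)] by (intro tendsto_intros lr) (simp add: o_def)
  then have CD: "Cauchy (\<lambda>j. D *\<^sub>V x (r j))" unfolding Dx by (rule LIMSEQ_imp_Cauchy)
  have "Cauchy (\<lambda>j. x (r j))"
  proof (rule CauchyI)
    fix d :: real assume "0 < d"
    then obtain M where M: "\<And>i j. i \<ge> M \<Longrightarrow> j \<ge> M \<Longrightarrow> norm (D *\<^sub>V x (r i) - D *\<^sub>V x (r j)) < c * d"
      using CauchyD[OF CD, of "c * d"] c(1) by (metis mult_pos_pos)
    have "norm (x (r i) - x (r j)) < d" if "i \<ge> M" "j \<ge> M" for i j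
    proof -
      have "c * norm (x (r i) - x (r j)) < c * d"
        using c(2)[of "x (r i) - x (r j)"] M[OF that] by simp
      then show ?thesis using c(1) by simp
    qed
    then show "\<exists>M. \<forall>m\<ge>M. \<forall>n\<ge>M. norm (x (r m) - x (r n)) < d" by blast
  qed
  then show "\<exists>r l. strict_mono r \<and> (\<lambda>j. x (r j)) \<longlonglongrightarrow> l"
    using lr(1) by (metis Cauchy_convergent_iff convergent_def)
qed

text \<open>Both implications of the Riesz alternative: if one fails, the ranges, respectively the kernels, of
  the powers of \<open>A - \<mu>\<close> form a strictly monotone chain \<open>W\<close>, and normalizing the components of the \<open>x k\<close>
  orthogonal to \<open>W k\<close> contradicts \<open>riesz_orthonormal_tendsto_0\<close> with \<open>l k = \<mu>\<close>.\<close>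

lemma riesz_chain:
  fixes W :: "nat \<Rightarrow> 'a::chilbert_space set"
  assumes A: "riesz A" and mu: "\<mu> \<noteq> 0"
    and W: "\<And>k. csubspace (W k)" "\<And>k. closed (W k)"
    and AW: "\<And>k x S. x \<in> W k \<Longrightarrow> S * (A - scal \<mu>) = (A - scal \<mu>) * S \<Longrightarrow> S *\<^sub>V x \<in> W k"
    and x: "\<And>k. x k \<notin> W k" "\<And>k. (A - scal \<mu>) *\<^sub>V (x k - proj (W k) *\<^sub>V x k) \<in> W k"
    and mono: "\<And>i j. i \<noteq> j \<Longrightarrow> x i - proj (W i) *\<^sub>V x i \<in> W j \<or> x j - proj (W j) *\<^sub>V x j \<in> W i"
  shows False
proof -
  define u where "u k = x k - proj (W k) *\<^sub>V x k" for k
  define e where "e k = of_real (1 / norm (u k)) *\<^sub>C u k" for k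
  have pW: "proj (W k) *\<^sub>V x k \<in> W k" for k by (rule proj_props(1)[OF W])
  have u0: "u k \<noteq> 0" for k
    using x(1)[of k] pW[of k] by (auto simp: u_def)
  have uo: "cinner w (u k) = 0" if "w \<in> W k" for w k
    unfolding u_def by (rule proj_props(2)[OF W that])
  have o: "cinner w (e k) = 0" "cinner (e k) w = 0" if "w \<in> W k" for w k
    using uo[OF that] by (simp_all add: e_def cinner_simps cinner_eq_0_swap[of "u k" w])
  have n1: "norm (e k) = 1" for k using u0 by (simp add: e_def norm_scaleC norm_divide)
  have Ge: "(A - scal \<mu>) *\<^sub>V e k \<in> W k" for k
    using x(2)[of k] by (simp only: e_def app_scaleC u_def[symmetric]) (rule subspaceD(3)[OF W(1)])
  have eW: "e i \<in> W j \<or> e j \<in> W i" if "i \<noteq> j" for i j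
    using mono[OF that] subspaceD(3)[OF W(1)] by (auto simp: e_def u_def[symmetric])
  have os: "orthonormal_seq e" unfolding orthonormal_seq_def
    using n1 eW o by (metis order_refl)
  have "(\<lambda>k::nat. \<mu>) \<longlonglongrightarrow> 0"
  proof (rule riesz_orthonormal_tendsto_0[OF A os])
    fix k n :: nat
    \<comment> \<open>\<open>S\<close> keeps \<open>W k\<close>, so \<open>A ^ n\<close> acts on
      \<open>e k\<close> as \<open>\<mu> ^ n\<close> up to a vector of \<open>W k\<close>, which is
      orthogonal to \<open>e k\<close>.\<close>
    obtain S where S: "A ^ n - scal \<mu> ^ n = S * (A - scal \<mu>)" "S * (A - scal \<mu>) = (A - scal \<mu>) * S"
      using power_diff_factor by blast
    have "(A ^ n - scal \<mu> ^ n) *\<^sub>V e k \<in> W k" unfolding S(1) app_ops(6) by (rule AW[OF Ge S(2)])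
    then have "cinner (e k) ((A ^ n - scal \<mu> ^ n) *\<^sub>V e k) = 0" by (rule o)
    then show "cinner (e k) ((A ^ n) *\<^sub>V e k) = \<mu> ^ n"
      using n1[of k] by (simp add: cinner_simps cinner_self flip: scal_power)
  qed
  then show False using mu by (simp add: LIMSEQ_const_iff)
qed

lemma riesz_inj_imp_surj:
  assumes A: "riesz A" and mu: "\<mu> \<noteq> 0" and inj: "\<And>x. (A - scal \<mu>) *\<^sub>V x = 0 \<Longrightarrow> x = 0"
  shows "surj (app (A - scal \<mu>))"
proof (rule ccontr)
  define G where "G = A - scal \<mu>"
  assume "\<not> surj (app (A - scal \<mu>))"
  then obtain u where u: "u \<notin> range (app G)" unfolding G_def by blast
  \<comment> \<open>The shift by one matters: for \<open>u\<close> outside the range of the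
    injective \<open>G\<close>, the vector \<open>(G ^ k) u\<close> lies in the range of
    \<open>G ^ k\<close> but not in that of \<open>G ^ Suc k\<close>.\<close>
  define W where "W k = range (app (G ^ Suc k))" for k
  have W: "csubspace (W k)" "closed (W k)" for k
    unfolding W_def
    by (rule range_csubspace[OF csubspace_UNIV],
        rule proper_closed_range[OF csubspace_UNIV closed_UNIV proper_power])
      (use riesz_proper[OF A mu] G_def in auto)
  have pinj: "v = w" if "(G ^ k) *\<^sub>V v = (G ^ k) *\<^sub>V w" for k v w
    using that
  proof (induction k)
    case (Suc k)
    then have "G *\<^sub>V ((G ^ k) *\<^sub>V v - (G ^ k) *\<^sub>V w) = 0" by simp
    then show ?case using inj Suc.IH unfolding G_def by fastforce
  qed simp
  have Gran: "(G ^ j) *\<^sub>V v \<in> W i" if "i < j" for i j v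
  proof -
    have "G ^ j = G ^ Suc i * G ^ (j - Suc i)" using that by (metis Suc_leI le_add_diff_inverse power_add)
    then show ?thesis by (simp add: W_def del: power_Suc)
  qed
  have Wran: "W j \<subseteq> W i" if "i \<le> j" for i j
    using Gran[of i "Suc j"] that by (auto simp: W_def[of j] simp del: power_Suc)
  show False
  proof (rule riesz_chain[OF A mu W, where x = "\<lambda>k. (G ^ k) *\<^sub>V u"])
    fix k x S assume x: "x \<in> W k" and S: "S * (A - scal \<mu>) = (A - scal \<mu>) * S"
    have SG: "S * G ^ n = G ^ n * S" for n
      using power_commuting_commutes[of G S n] S by (simp add: G_def)
    obtain v where "x = (G ^ Suc k) *\<^sub>V v" using x unfolding W_def by blast
    then have "S *\<^sub>V x = (G ^ Suc k) *\<^sub>V S *\<^sub>V v" by (simp only: app_mult_cong[OF SG])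
    then show "S *\<^sub>V x \<in> W k" unfolding W_def by blast
  next
    fix k
    show "(G ^ k) *\<^sub>V u \<notin> W k"
    proof
      assume "(G ^ k) *\<^sub>V u \<in> W k"
      then obtain v where "(G ^ k) *\<^sub>V u = (G ^ Suc k) *\<^sub>V v" unfolding W_def by blast
      then have "(G ^ k) *\<^sub>V u = (G ^ k) *\<^sub>V G *\<^sub>V v" by (simp only: power_Suc2 app_ops)
      then show False using pinj u by blast
    qed
    define p where "p = proj (W k) *\<^sub>V (G ^ k) *\<^sub>V u"
    have "p \<in> W k" unfolding p_def by (rule proj_props(1)[OF W])
    then obtain v where v: "p = (G ^ Suc k) *\<^sub>V v" unfolding W_def by blast
    have "(G ^ k) *\<^sub>V u - p = (G ^ k) *\<^sub>V (u - G *\<^sub>V v)" unfolding v by (simp only: power_Suc2 app_ops app_simps)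
    then have "G *\<^sub>V ((G ^ k) *\<^sub>V u - p) = (G ^ Suc k) *\<^sub>V (u - G *\<^sub>V v)" by (simp only: power_Suc app_ops)
    then have "G *\<^sub>V ((G ^ k) *\<^sub>V u - p) \<in> W k" unfolding W_def by (metis rangeI)
    then show "(A - scal \<mu>) *\<^sub>V ((G ^ k) *\<^sub>V u - proj (W k) *\<^sub>V (G ^ k) *\<^sub>V u) \<in> W k"
      by (simp only: p_def G_def)
  next
    have *: "(G ^ j) *\<^sub>V u - proj (W j) *\<^sub>V (G ^ j) *\<^sub>V u \<in> W i" if "i < j" for i j
      using Gran[OF that] proj_props(1)[OF W, of j] Wran[of i j] that
      by (intro csubspace_diff W(1)) auto
    fix i j :: nat assume "i \<noteq> j"
    then show "(G ^ i) *\<^sub>V u - proj (W i) *\<^sub>V (G ^ i) *\<^sub>V u \<in> W j \<or>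
        (G ^ j) *\<^sub>V u - proj (W j) *\<^sub>V (G ^ j) *\<^sub>V u \<in> W i"
      using *[of i j] *[of j i] by (metis linorder_neqE_nat)
  qed
qed

lemma riesz_surj_imp_inj:
  assumes A: "riesz A" and mu: "\<mu> \<noteq> 0" and surj: "surj (app (A - scal \<mu>))"
    and z: "(A - scal \<mu>) *\<^sub>V z = 0"
  shows "z = 0"
proof (rule ccontr)
  assume z0: "z \<noteq> 0"
  define G where "G = A - scal \<mu>"
  define W where "W k = {x. (G ^ k) *\<^sub>V x = 0}" for k
  have W: "csubspace (W k)" "closed (W k)" for k unfolding W_def by (rule ker_csubspace, rule ker_closed)
  have "\<exists>y. (G ^ k) *\<^sub>V y = z" for k
  proof (induction k)
    case (Suc k)
    then obtain y where "(G ^ k) *\<^sub>V y = z" by blast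
    moreover obtain v where "G *\<^sub>V v = y" using surj unfolding G_def by (metis surjD)
    ultimately have "(G ^ Suc k) *\<^sub>V v = z" by (simp only: power_Suc2 app_ops)
    then show ?case by blast
  qed simp
  \<comment> \<open>Iterated preimages of a kernel vector: \<open>y k\<close> is annihilated by
    \<open>G ^ Suc k\<close>, but not by \<open>G ^ k\<close>.\<close>
  then obtain y where y: "\<And>k. (G ^ k) *\<^sub>V y k = z" by metis
  have Wmono: "W i \<subseteq> W j" if "i \<le> j" for i j
  proof -
    have "G ^ j = G ^ (j - i) * G ^ i" using that by (metis le_add_diff_inverse2 power_add)
    then show ?thesis by (auto simp: W_def)
  qed
  have yW: "y k \<in> W (Suc k)" for k using y[of k] z by (simp add: W_def G_def)
  show False
  proof (rule riesz_chain[OF A mu W, where x = y])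
    fix k x S assume x: "x \<in> W k" and S: "S * (A - scal \<mu>) = (A - scal \<mu>) * S"
    have SG: "S * G ^ n = G ^ n * S" for n
      using power_commuting_commutes[of G S n] S by (simp add: G_def)
    have "(G ^ k) *\<^sub>V S *\<^sub>V x = S *\<^sub>V (G ^ k) *\<^sub>V x" by (rule app_mult_cong[OF SG[symmetric]])
    then show "S *\<^sub>V x \<in> W k" using x by (simp add: W_def)
  next
    have *: "y k - proj (W k) *\<^sub>V y k \<in> W (Suc k)" for k
      using yW[of k] proj_props(1)[OF W, of k] Wmono[of k "Suc k"] by (intro csubspace_diff W(1)) auto
    fix k
    show "y k \<notin> W k" using y[of k] z0 by (simp add: W_def)
    have "(G ^ Suc k) *\<^sub>V (y k - proj (W k) *\<^sub>V y k) = 0" using * by (simp add: W_def del: power_Suc)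
    then have "(G ^ k) *\<^sub>V G *\<^sub>V (y k - proj (W k) *\<^sub>V y k) = 0" by (simp only: power_Suc2 app_ops)
    then show "(A - scal \<mu>) *\<^sub>V (y k - proj (W k) *\<^sub>V y k) \<in> W k" by (simp only: W_def G_def mem_Collect_eq)
    fix i j :: nat assume "i \<noteq> j"
    then show "y i - proj (W i) *\<^sub>V y i \<in> W j \<or> y j - proj (W j) *\<^sub>V y j \<in> W i"
      using *[of i] *[of j] Wmono[of "Suc i" j] Wmono[of "Suc j" i]
      by (metis Suc_leI linorder_neqE_nat subsetD)
  qed
qed

section \<open>Stability of the Riesz property under compact perturbation and compression\<close>

lemma riesz_cong:
  assumes A: "riesz A" and AB: "ck A = ck B" shows "riesz B"
  unfolding riesz_def
proof (intro allI impI)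
  fix d :: real assume "0 < d"
  then obtain n K where nK: "n > 0" "cpt K" "norm (A ^ n - K) < d ^ n" using A unfolding riesz_def by blast
  have "cpt (A ^ n - B ^ n)" using AB by (metis ck_eq_iff ck_power)
  then have "cpt (K - (A ^ n - B ^ n))" by (rule cpt_diff[OF nK(2)])
  moreover have "norm (B ^ n - (K - (A ^ n - B ^ n))) < d ^ n" using nK(3) by simp
  ultimately show "\<exists>n>0. \<exists>K. cpt K \<and> norm (B ^ n - K) < d ^ n" using nK(1) by blast
qed

text \<open>The assumption says that the kernel of \<open>Q\<close> is invariant under
  \<open>A\<close>, so \<open>Q * A\<close> acts like the induced quotient operator and its positive
  powers are \<open>Q * A ^ n\<close>.\<close>

lemma riesz_compress:
  assumes A: "riesz A" and Q: "orth_proj Q" and inv: "Q * A * Q = Q * A"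
  shows "riesz (Q * A)"
  unfolding riesz_def
proof (intro allI impI)
  fix d :: real assume "0 < d"
  then obtain n K where nK: "n > 0" "cpt K" "norm (A ^ n - K) < d ^ n" using A unfolding riesz_def by blast
  have "(Q * A) ^ Suc m = Q * A ^ Suc m" for m
  proof (induction m)
    case (Suc m)
    have "(Q * A) ^ Suc (Suc m) = Q * A * (Q * A ^ Suc m)" using Suc by (metis power_Suc)
    also have "\<dots> = Q * A * Q * A ^ Suc m" by (simp only: mult.assoc)
    also have "\<dots> = Q * (A * A ^ Suc m)" unfolding inv by (simp only: mult.assoc)
    finally show ?case by (simp only: power_Suc)
  qed simp
  then have "(Q * A) ^ n = Q * A ^ n" using nK(1) by (metis gr0_conv_Suc)
  then have "norm ((Q * A) ^ n - Q * K) < d ^ n"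
    using norm_mult_proj(2)[OF Q, of "A ^ n - K"] nK(3) by (simp add: right_diff_distrib)
  then show "\<exists>n>0. \<exists>K. cpt K \<and> norm ((Q * A) ^ n - K) < d ^ n"
    using nK(1) cpt_mult_left[OF nK(2)] by blast
qed

lemma riesz_restrict:
  assumes A: "riesz A" and Q: "orth_proj Q" and inv: "Q * A = A"
  shows "riesz (A * Q)"
  unfolding riesz_def
proof (intro allI impI)
  fix d :: real assume "0 < d"
  then obtain n K where nK: "n > 0" "cpt K" "norm (A ^ n - K) < d ^ n" using A unfolding riesz_def by blast
  have "(A * Q) ^ Suc m = A ^ Suc m * Q" for m
  proof (induction m)
    case (Suc m)
    have "(A * Q) ^ Suc (Suc m) = A * (Q * A) * (A ^ m * Q)"
      using Suc by (simp add: mult.assoc)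
    then show ?case by (simp add: inv mult.assoc)
  qed simp
  then have "(A * Q) ^ n = A ^ n * Q" using nK(1) by (metis gr0_conv_Suc)
  then have "norm ((A * Q) ^ n - K * Q) < d ^ n"
    using norm_mult_proj(1)[OF Q, of "A ^ n - K"] nK(3) by (simp add: left_diff_distrib)
  then show "\<exists>n>0. \<exists>K. cpt K \<and> norm ((A * Q) ^ n - K) < d ^ n"
    using nK(1) cpt_mult_right[OF nK(2)] by blast
qed

subsection \<open>The West decomposition\<close>

definition rank1_sum :: "(nat \<Rightarrow> 'a::chilbert_space) \<Rightarrow> nat \<Rightarrow> 'a bop"
  where "rank1_sum e k = (\<Sum>i<k. rank1 (e i) (e i))"

definition deflation :: "'a::chilbert_space bop \<Rightarrow> (nat \<Rightarrow> 'a) \<Rightarrow> nat \<Rightarrow> 'a bop"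
  where "deflation A e k = (1 - rank1_sum e k) * A * (1 - rank1_sum e k)"

text \<open>\<open>e k\<close> is an eigenvector of what remains of \<open>A\<close> after \<open>e 0, \<dots>, e (k - 1)\<close> are split off, for an
  eigenvalue of nearly maximal modulus. The value \<open>0\<close> signals that no nonzero eigenvalue is left.\<close>

definition greedy_eigenvector :: "'a::chilbert_space bop \<Rightarrow> (nat \<Rightarrow> 'a) \<Rightarrow> nat \<Rightarrow> 'a \<Rightarrow> bool"
  where "greedy_eigenvector A e k v \<longleftrightarrow>
    (v = 0 \<and> (\<forall>\<mu> x. \<mu> \<noteq> 0 \<longrightarrow> deflation A e k *\<^sub>V x = \<mu> *\<^sub>C x \<longrightarrow> x = 0)) \<or>
    (norm v = 1 \<and> (\<exists>l. l \<noteq> 0 \<and> deflation A e k *\<^sub>V v = l *\<^sub>C v \<and>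
      (\<forall>\<mu> x. deflation A e k *\<^sub>V x = \<mu> *\<^sub>C x \<longrightarrow> x \<noteq> 0 \<longrightarrow> cmod \<mu> \<le> 2 * cmod l)))"

text \<open>The moduli of eigenvalues are bounded by the norm. Some eigenvalue exceeds half of their
  supremum, whence the factor 2.\<close>

lemma exists_greedy_eigenvector: "\<exists>v. greedy_eigenvector A e k v"
proof -
  define C where "C = deflation A e k"
  define S where "S = {cmod \<mu> |\<mu> x. \<mu> \<noteq> 0 \<and> x \<noteq> 0 \<and> C *\<^sub>V x = \<mu> *\<^sub>C x}"
  show ?thesis
  proof (cases "S = {}")
    case True
    then show ?thesis by (intro exI[of _ 0]) (auto simp: greedy_eigenvector_def S_def C_def)
  next
    case False
    have bd: "bdd_above S"
    proof (rule bdd_aboveI[of _ "norm C"])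
      fix s assume "s \<in> S"
      then obtain \<mu> x where x: "s = cmod \<mu>" "x \<noteq> 0" "C *\<^sub>V x = \<mu> *\<^sub>C x" unfolding S_def by blast
      have "s * norm x \<le> norm C * norm x" using norm_app[of C x] x by (simp add: norm_scaleC)
      then show "s \<le> norm C" using x(2) by simp
    qed
    obtain s0 where s0: "s0 \<in> S" using False by blast
    then have "s0 > 0" by (auto simp: S_def)
    then have "Sup S > 0" using cSup_upper[OF s0 bd] by linarith
    then have "Sup S / 2 < Sup S" by simp
    then obtain s where s: "s \<in> S" "Sup S / 2 < s" using less_cSup_iff[OF False bd] by blast
    then obtain l x where x: "s = cmod l" "l \<noteq> 0" "x \<noteq> 0" "C *\<^sub>V x = l *\<^sub>C x" unfolding S_def by blast
    define v where "v = of_real (1 / norm x) *\<^sub>C x"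
    have "norm v = 1" using x(3) by (simp add: v_def norm_scaleC norm_divide)
    moreover have "C *\<^sub>V v = l *\<^sub>C v" by (simp add: v_def x(4) scaleC_scaleC mult.commute)
    moreover have "cmod \<mu> \<le> 2 * cmod l" if "C *\<^sub>V y = \<mu> *\<^sub>C y" "y \<noteq> 0" for \<mu> y
    proof (cases "\<mu> = 0")
      case False
      then have "cmod \<mu> \<le> Sup S" using that by (intro cSup_upper[OF _ bd]) (auto simp: S_def)
      then show ?thesis using s x(1) by simp
    qed simp
    ultimately show ?thesis using x(2) unfolding greedy_eigenvector_def C_def by blast
  qed
qed

lemma exists_greedy_sequence: "\<exists>e. \<forall>k. greedy_eigenvector A e k (e k)"
proof (rule dependent_wellorder_choice)
  fix r :: 'a and f g :: "nat \<Rightarrow> 'a" and k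
  assume "\<And>i. i < k \<Longrightarrow> f i = g i"
  then have "deflation A f k = deflation A g k" by (simp add: deflation_def rank1_sum_def)
  then show "greedy_eigenvector A f k r = greedy_eigenvector A g k r" by (simp add: greedy_eigenvector_def)
qed (rule exists_greedy_eigenvector)

text \<open>Let \<open>E\<close> be the closed span of the \<open>e k\<close> and \<open>Q\<close>
  the projection onto its complement. A nonzero eigenvalue \<open>\<mu>\<close> of
  \<open>Q * A\<close> would be one of every deflation, so by greediness its modulus would be at
  most twice that of each \<open>l k\<close>, which tend to 0. Hence \<open>Q * A - \<mu>\<close> is
  onto. On \<open>E\<close> the operator \<open>A - D\<close> is strictly triangular, so the range
  of \<open>A - D - \<mu>\<close> contains \<open>E\<close> and then everything; the Riesz
  alternative gives injectivity.\<close>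

lemma west_decomposition:
  fixes A :: "'a::chilbert_space bop"
  assumes A: "riesz A"
  obtains D where "cpt D" "\<And>P0. orth_proj P0 \<Longrightarrow> P0 * A = A \<Longrightarrow> P0 * D = D \<and> D * P0 = D"
    "\<And>\<mu>. \<mu> \<noteq> 0 \<Longrightarrow> \<exists>R. (A - D - scal \<mu>) * R = 1 \<and> R * (A - D - scal \<mu>) = 1"
proof -
  obtain e where e: "\<And>k. greedy_eigenvector A e k (e k)" using exists_greedy_sequence by metis
  define P where "P = rank1_sum e"
  define C where "C k = deflation A e k" for k
  have C: "C k = (1 - P k) * A * (1 - P k)" for k by (simp add: C_def P_def deflation_def)
  have P0: "P 0 = 0" and PS: "P (Suc k) = P k + rank1 (e k) (e k)" for k
    by (simp_all add: P_def rank1_sum_def)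
  have e01: "norm (e k) = 1 \<or> e k = 0" for k using e[of k] by (auto simp: greedy_eigenvector_def)
  have ev: "\<exists>l. C k *\<^sub>V e k = l *\<^sub>C e k \<and> (e k \<noteq> 0 \<longrightarrow> l \<noteq> 0)" for k
    using e[of k] by (auto simp: greedy_eigenvector_def C_def scaleC_zero_right)
  \<comment> \<open>An eigenvector of \<open>C k\<close> for a nonzero eigenvalue lies in the range
    of \<open>C k\<close>, which \<open>P k\<close> annihilates.\<close>
  have Pe0: "P k *\<^sub>V e k = 0" if "orth_proj (P k)" for k
  proof -
    obtain l where l: "C k *\<^sub>V e k = l *\<^sub>C e k" "e k \<noteq> 0 \<longrightarrow> l \<noteq> 0" using ev by blast
    have "P k *\<^sub>V C k *\<^sub>V e k = 0" by (simp add: C orth_projD(3)[OF that])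
    then have "l *\<^sub>C (P k *\<^sub>V e k) = 0" using l(1) by simp
    then show ?thesis using l(2) by auto
  qed
  have eek: "cinner (e k) (e k) *\<^sub>C e k = e k" for k
    using e01[of k] by (auto simp: cinner_self scaleC_one scaleC_zero_right)
  have P: "orth_proj (P k) \<and> (\<forall>i<k. P k *\<^sub>V e i = e i)" for k
  proof (induction k)
    case (Suc k)
    then have IH: "orth_proj (P k)" "\<And>i. i < k \<Longrightarrow> P k *\<^sub>V e i = e i" by auto
    note z = Pe0[OF IH(1)]
    have "P k * rank1 (e k) (e k) = 0" by (rule bop_eqI) (simp add: z scaleC_zero_right)
    then have "orth_proj (P (Suc k))" unfolding PS by (rule orth_proj_add[OF IH(1) orth_proj_rank1[OF e01]])
    moreover have "P (Suc k) *\<^sub>V e i = e i" if "i < Suc k" for i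
    proof (cases "i = k")
      case True
      then show ?thesis by (simp add: PS z eek)
    next
      case False
      then have "P k *\<^sub>V e i = e i" using IH(2) that by simp
      moreover from this have "cinner (e k) (e i) = 0" using orth_projD(4)[OF IH(1), of "e k" "e i"] z by simp
      ultimately show ?thesis by (simp add: PS)
    qed
    ultimately show ?case by blast
  qed (simp add: P0)
  have Po: "orth_proj (P k)" for k using P by blast
  have Pe: "P k *\<^sub>V e i = e i" if "i < k" for i k using P that by blast
  note PD = orth_projD[OF Po]
  have Pek: "P k *\<^sub>V e k = 0" for k by (rule Pe0[OF Po])
  have e_orth: "cinner (e i) (e j) = 0" if "i < j" for i j
    using PD(4)[of j "e i" "e j"] Pe[OF that] Pek[of j] by simp
  have os: "orthonormal_seq e" unfolding orthonormal_seq_def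
  proof (intro conjI allI impI)
    fix i j :: nat assume "i \<noteq> j"
    then show "cinner (e i) (e j) = 0" using e_orth[of i j] e_orth[of j i] cinner_eq_0_swap
      by (metis linorder_neqE_nat)
  next
    show "norm (e i) \<le> 1" for i using e01[of i] by auto
  qed
  have P_mono: "P k *\<^sub>V P j *\<^sub>V x = P j *\<^sub>V x" if "j \<le> k" for j k x
    using that by (induction j) (simp_all add: P0 PS Pe)
  define l where "l k = cinner (e k) (A *\<^sub>V e k)" for k
  have Ce: "C k *\<^sub>V e k = l k *\<^sub>C e k" for k
  proof -
    obtain m where m: "C k *\<^sub>V e k = m *\<^sub>C e k" using ev by blast
    have "cinner (e k) (C k *\<^sub>V e k) = l k"
      using PD(4)[of k "e k", symmetric] by (simp add: C Pek l_def cinner_diff)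
    then have "l k = m * cinner (e k) (e k)" using m by (simp add: cinner_simps)
    then show ?thesis using m eek[of k] by (metis scaleC_scaleC)
  qed
  have Ae: "A *\<^sub>V e k = l k *\<^sub>C e k + P k *\<^sub>V A *\<^sub>V e k" for k
    using Ce[of k] by (simp add: C Pek algebra_simps)
  \<comment> \<open>Triangularity: \<open>A\<close> sends \<open>e k\<close> to a multiple of
    \<open>e k\<close> plus a vector in the range of \<open>P k\<close>, so all these ranges are
    invariant.\<close>
  have PAP: "P k *\<^sub>V A *\<^sub>V P k *\<^sub>V x = A *\<^sub>V P k *\<^sub>V x" for k x
  proof (induction k)
    case (Suc k)
    have "P (Suc k) *\<^sub>V A *\<^sub>V e k = A *\<^sub>V e k"
      by (subst (1 2) Ae) (simp add: Pe P_mono)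
    moreover have "P (Suc k) *\<^sub>V A *\<^sub>V P k *\<^sub>V x = A *\<^sub>V P k *\<^sub>V x"
      using Suc P_mono[of k "Suc k" "A *\<^sub>V P k *\<^sub>V x"] by simp
    moreover have "P (Suc k) *\<^sub>V x = P k *\<^sub>V x + cinner (e k) x *\<^sub>C e k" by (simp add: PS)
    ultimately show ?case by simp
  qed (simp add: P0)
  have Apow: "(A ^ n) *\<^sub>V e k = l k ^ n *\<^sub>C e k + P k *\<^sub>V (A ^ n) *\<^sub>V e k" for n k
  proof (induction n)
    case (Suc n)
    have "A *\<^sub>V (A ^ n) *\<^sub>V e k = l k ^ n *\<^sub>C (A *\<^sub>V e k) + A *\<^sub>V P k *\<^sub>V (A ^ n) *\<^sub>V e k"
      by (subst Suc) simp
    moreover have "l k ^ n *\<^sub>C (A *\<^sub>V e k) = l k ^ Suc n *\<^sub>C e k + P k *\<^sub>V (l k ^ n *\<^sub>C (A *\<^sub>V e k))"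
      by (subst Ae) (simp add: scaleC_add_right scaleC_scaleC mult.commute)
    ultimately show ?case
      by (simp add: PAP PD(3) Pek scaleC_zero_right)
  qed (simp add: Pek scaleC_one)
  have l0: "l \<longlonglongrightarrow> 0"
  proof (rule riesz_orthonormal_tendsto_0[OF A os])
    fix k n :: nat assume n: "n > 0"
    have "cinner (e k) (P k *\<^sub>V y) = 0" for y using PD(4)[of k "e k" y] Pek[of k] by simp
    then have "cinner (e k) ((A ^ n) *\<^sub>V e k) = l k ^ n * cinner (e k) (e k)"
      by (subst Apow) (simp add: cinner_simps)
    then show "cinner (e k) ((A ^ n) *\<^sub>V e k) = l k ^ n"
      using e01[of k] n by (auto simp: cinner_self l_def)
  qed
  define Ds where "Ds n = (\<Sum>i<n. scal (l i) * rank1 (e i) (e i))" for n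
  \<comment> \<open>By orthogonality a block of the diagonal sum is bounded by its largest
    coefficient; summability of the \<open>l i\<close> plays no part.\<close>
  have Ds_diff: "norm (Ds m - Ds n) \<le> d" if "n \<le> m" "0 \<le> d" "\<And>i. i \<ge> n \<Longrightarrow> cmod (l i) \<le> d" for m n d
  proof (rule norm_bop_bound[OF \<open>0 \<le> d\<close>])
    fix x
    have "Ds m = Ds n + (\<Sum>i=n..<m. scal (l i) * rank1 (e i) (e i))"
      unfolding Ds_def lessThan_atLeast0 using that(1) by (simp add: sum.atLeastLessThan_concat)
    moreover have "(\<Sum>i\<in>I. scal (l i) * rank1 (e i) (e i)) *\<^sub>V x = (\<Sum>i\<in>I. (l i * cinner (e i) x) *\<^sub>C e i)"
      if "finite I" for I using that by (induction I rule: finite_induct) (simp_all add: scaleC_scaleC)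
    ultimately have "(Ds m - Ds n) *\<^sub>V x = (\<Sum>i=n..<m. (l i * cinner (e i) x) *\<^sub>C e i)" by simp
    then have "(norm ((Ds m - Ds n) *\<^sub>V x))\<^sup>2 = (\<Sum>i=n..<m. (cmod (l i * cinner (e i) x))\<^sup>2 * (norm (e i))\<^sup>2)"
      by (simp only: norm_sum_orthogonal[OF os finite_atLeastLessThan])
    also have "\<dots> \<le> (\<Sum>i=n..<m. d\<^sup>2 * (cmod (cinner (e i) x))\<^sup>2)"
    proof (rule sum_mono)
      fix i assume "i \<in> {n..<m}"
      then have "(cmod (l i))\<^sup>2 \<le> d\<^sup>2" using that(3)[of i] by (simp add: power_mono)
      moreover have "(norm (e i))\<^sup>2 \<le> 1" using e01[of i] by auto
      ultimately have "(cmod (l i))\<^sup>2 * (cmod (cinner (e i) x))\<^sup>2 * (norm (e i))\<^sup>2 \<le> d\<^sup>2 * (cmod (cinner (e i) x))\<^sup>2 * 1"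
        by (intro mult_mono) auto
      then show "(cmod (l i * cinner (e i) x))\<^sup>2 * (norm (e i))\<^sup>2 \<le> d\<^sup>2 * (cmod (cinner (e i) x))\<^sup>2"
        by (simp add: norm_mult power_mult_distrib)
    qed
    also have "\<dots> \<le> d\<^sup>2 * (norm x)\<^sup>2"
      unfolding sum_distrib_left[symmetric] by (intro mult_left_mono bessel[OF os]) auto
    finally have "(norm ((Ds m - Ds n) *\<^sub>V x))\<^sup>2 \<le> (d * norm x)\<^sup>2" by (simp add: power_mult_distrib)
    then show "norm ((Ds m - Ds n) *\<^sub>V x) \<le> d * norm x"
      by (rule power2_le_imp_le) (use that in simp)
  qed
  have "Cauchy Ds"
  proof (rule metric_CauchyI)
    fix d :: real assume d: "0 < d"
    have "\<forall>\<^sub>F i in sequentially. dist (l i) 0 < d / 2" by (rule tendstoD[OF l0]) (use d in simp)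
    then obtain N where "\<forall>i\<ge>N. dist (l i) 0 < d / 2" unfolding eventually_sequentially by blast
    then have N: "cmod (l i) \<le> d / 2" if "i \<ge> N" for i
      using that by (simp add: dist_norm less_imp_le)
    have *: "dist (Ds m) (Ds n) < d" if "n \<ge> N" "m \<ge> n" for m n
      using Ds_diff[OF that(2), of "d / 2"] N that d by (simp add: dist_norm)
    have "dist (Ds m) (Ds n) < d" if "m \<ge> N" "n \<ge> N" for m n
      using *[of n m] *[of m n] that by (metis dist_commute nle_le)
    then show "\<exists>M. \<forall>m\<ge>M. \<forall>n\<ge>M. dist (Ds m) (Ds n) < d" by blast
  qed
  then obtain D where D: "Ds \<longlonglongrightarrow> D" by (metis Cauchy_convergent_iff convergent_def)
  have Dx: "(\<lambda>n. Ds n *\<^sub>V x) \<longlonglongrightarrow> D *\<^sub>V x" for x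
  proof -
    have "(\<lambda>n. Ds n *\<^sub>V x - D *\<^sub>V x) \<longlonglongrightarrow> 0"
    proof (rule Lim_null_comparison)
      show "\<forall>\<^sub>F n in sequentially. norm (Ds n *\<^sub>V x - D *\<^sub>V x) \<le> norm (Ds n - D) * norm x"
        using norm_app[of "Ds _ - D" x] by simp
      show "(\<lambda>n. norm (Ds n - D) * norm x) \<longlonglongrightarrow> 0"
        using D by (intro tendsto_mult_left_zero tendsto_norm_zero) (simp add: LIM_zero)
    qed
    then show ?thesis by (simp add: LIM_zero_cancel)
  qed
  have De: "D *\<^sub>V e k = l k *\<^sub>C e k" for k
  proof -
    have "Ds n *\<^sub>V e k = (if k < n then l k *\<^sub>C e k else 0)" for n
    proof (induction n)
      case (Suc n)
      have "cinner (e n) (e k) = 0" if "n \<noteq> k" using os that by (simp add: orthonormal_seq_def)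
      then show ?case using Suc by (cases "n = k") (auto simp: Ds_def eek)
    qed (simp add: Ds_def)
    then have "\<forall>\<^sub>F n in sequentially. Ds n *\<^sub>V e k = l k *\<^sub>C e k"
      by (intro eventually_sequentiallyI[of "Suc k"]) auto
    then have "(\<lambda>n. Ds n *\<^sub>V e k) \<longlonglongrightarrow> l k *\<^sub>C e k" by (rule tendsto_eventually)
    then show ?thesis using Dx LIMSEQ_unique by blast
  qed
  have cD: "cpt D"
    by (rule cpt_limit[OF D]) (auto simp: Ds_def intro!: cpt_sum cpt_mult_left[OF cpt_rank1])
  define E0 where "E0 = {x. \<exists>k. P k *\<^sub>V x = x}"
  have E0: "csubspace E0"
    unfolding cv.subspace_def
  proof (intro conjI ballI allI)
    fix x y assume "x \<in> E0" "y \<in> E0"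
    then obtain i j where ij: "P i *\<^sub>V x = x" "P j *\<^sub>V y = y" unfolding E0_def by blast
    then have "P (max i j) *\<^sub>V x = x" "P (max i j) *\<^sub>V y = y"
      using P_mono[of i "max i j" x] P_mono[of j "max i j" y] by auto
    then show "x + y \<in> E0" unfolding E0_def by (auto intro!: exI[of _ "max i j"])
  qed (auto simp: E0_def)
  define E where "E = closure E0"
  have E: "csubspace E" "closed E" unfolding E_def by (rule csubspace_closure[OF E0], rule closed_closure)
  define R where "R = proj E"
  define Q where "Q = 1 - R"
  have R: "orth_proj R" unfolding R_def by (rule orth_proj_proj[OF E])
  have Q: "orth_proj Q" unfolding Q_def by (rule orth_proj_compl[OF R])
  have Rid: "R *\<^sub>V x = x" if "x \<in> E" for x unfolding R_def by (rule proj_id[OF E that])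
  have RE: "R *\<^sub>V x \<in> E" for x unfolding R_def by (rule proj_props(1)[OF E])
  have PE: "P k *\<^sub>V x \<in> E" for k x
    unfolding E_def E0_def
    by (intro subsetD[OF closure_subset] CollectI exI[of _ k]) (rule PD(3))
  have eE: "e k \<in> E" for k using PE[of "Suc k" "e k"] Pe[of k "Suc k"] by simp
  have "E \<subseteq> {x. R *\<^sub>V A *\<^sub>V x = A *\<^sub>V x}"
  proof -
    have "closed {x. (R * A) *\<^sub>V x = A *\<^sub>V x}" by (rule app_eq_closed)
    moreover have "R *\<^sub>V A *\<^sub>V x = A *\<^sub>V x" if "x \<in> E0" for x
    proof -
      obtain k where "P k *\<^sub>V x = x" using \<open>x \<in> E0\<close> unfolding E0_def by blast
      then have "P k *\<^sub>V A *\<^sub>V x = A *\<^sub>V x" using PAP[of k x] by simp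
      then show ?thesis using Rid PE by metis
    qed
    ultimately show ?thesis unfolding E_def by (intro closure_minimal) auto
  qed
  then have RAR: "R *\<^sub>V A *\<^sub>V R *\<^sub>V x = A *\<^sub>V R *\<^sub>V x" for x using RE by blast
  have QAR: "Q *\<^sub>V A *\<^sub>V R *\<^sub>V x = 0" for x by (simp add: Q_def RAR)
  have QAQ: "Q * A * Q = Q * A" by (rule bop_eqI) (simp add: Q_def RAR)
  have DQ: "D *\<^sub>V Q *\<^sub>V x = 0" for x
  proof -
    have "cinner (e i) (Q *\<^sub>V x) = 0" for i
      using orth_projD(4)[OF R, of "e i" "x"] Rid[OF eE, of i] by (simp add: Q_def cinner_diff)
    then have "Ds n *\<^sub>V Q *\<^sub>V x = 0" for n by (induction n) (simp_all add: Ds_def scaleC_zero_right)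
    then show ?thesis using Dx[of "Q *\<^sub>V x"] LIMSEQ_unique[OF tendsto_const] by fastforce
  qed
  have rA': "riesz (Q * A)" by (rule riesz_compress[OF A Q QAQ])
  have cP: "cpt (P k)" for k unfolding P_def rank1_sum_def by (intro cpt_sum cpt_rank1)
  have rC: "riesz (C k)" for k
  proof (rule riesz_cong[OF A])
    have "ck (P k) = 0" using cP by (simp add: ck_eq_0_iff)
    then show "ck A = ck (C k)" by (simp add: C ck_ops)
  qed
  have rT: "riesz (A - D)"
    by (rule riesz_cong[OF A]) (use cD in \<open>simp add: ck_ops flip: ck_eq_0_iff\<close>)
  \<comment> \<open>If \<open>C k - \<mu>\<close> were injective for some \<open>k\<close>, it would
    be onto, hence so would \<open>Q * A - \<mu>\<close>, and the converse half of the alternative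
    would exclude the eigenvector \<open>x\<close>.\<close>
  have A'inj: "x = 0" if mu: "\<mu> \<noteq> 0" and x: "(Q * A - scal \<mu>) *\<^sub>V x = 0" for \<mu> x
  proof (rule ccontr)
    assume x0: "x \<noteq> 0"
    have "\<exists>u. u \<noteq> 0 \<and> C k *\<^sub>V u = \<mu> *\<^sub>C u" for k
    proof (rule ccontr)
      assume "\<not> ?thesis"
      then have "surj (app (C k - scal \<mu>))" by (intro riesz_inj_imp_surj[OF rC mu]) auto
      then obtain g where g: "\<And>y. (C k - scal \<mu>) *\<^sub>V g y = y" by (metis surjD)
      have "surj (app (Q * A - scal \<mu>))"
      proof (rule surjI)
        fix y
        define u where "u = g y"
        have u: "C k *\<^sub>V u - \<mu> *\<^sub>C u = y"
          using g[of y] by (simp add: u_def)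
        have QP: "Q *\<^sub>V P k *\<^sub>V z = 0" for z by (simp add: Q_def Rid[OF PE])
        have QAP: "Q *\<^sub>V A *\<^sub>V P k *\<^sub>V z = 0" for z using QAR[of "P k *\<^sub>V z"] Rid[OF PE] by simp
        have "Q *\<^sub>V C k *\<^sub>V u = Q *\<^sub>V A *\<^sub>V u" by (simp add: C QP QAP)
        then have "Q *\<^sub>V A *\<^sub>V u - \<mu> *\<^sub>C (Q *\<^sub>V u) = Q *\<^sub>V y" using arg_cong[OF u, of "app Q"] by simp
        moreover have "Q *\<^sub>V A *\<^sub>V Q *\<^sub>V u = Q *\<^sub>V A *\<^sub>V u" using app_mult_cong[of "Q * A" Q Q A] QAQ by simp
        \<comment> \<open>\<open>Q u\<close> settles the component of \<open>y\<close> in the range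
          of \<open>Q\<close>. As \<open>Q * A\<close> vanishes on \<open>E\<close>, the operator is
          \<open>- \<mu>\<close> there, which explains the second summand.\<close>
        ultimately show "(Q * A - scal \<mu>) *\<^sub>V (Q *\<^sub>V g y - (1 / \<mu>) *\<^sub>C (R *\<^sub>V y)) = y"
          using mu QAR[of y] unfolding u_def[symmetric]
          by (simp add: cv.scale_right_diff_distrib scaleC_scaleC scaleC_one scaleC_zero_right Q_def)
            (simp add: algebra_simps)
      qed
      then show False using riesz_surj_imp_inj[OF rA' mu _ x] x0 by blast
    qed
    then have bd: "cmod \<mu> \<le> 2 * cmod (l k)" for k
    proof -
      obtain u where u: "u \<noteq> 0" "C k *\<^sub>V u = \<mu> *\<^sub>C u" using \<open>\<And>k. \<exists>u. u \<noteq> 0 \<and> C k *\<^sub>V u = \<mu> *\<^sub>C u\<close> by blast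
      then obtain m where m: "norm (e k) = 1" "C k *\<^sub>V e k = m *\<^sub>C e k" "cmod \<mu> \<le> 2 * cmod m"
        using e[of k] mu unfolding greedy_eigenvector_def C_def by blast
      have "m *\<^sub>C e k = l k *\<^sub>C e k" using Ce[of k] m(2) by (simp only:)
      then have "m = l k" using m(1) by auto
      with m(3) show ?thesis by simp
    qed
    have "(\<lambda>k. 2 * cmod (l k)) \<longlonglongrightarrow> 0"
      using tendsto_mult_right_zero[OF tendsto_norm_zero[OF l0]] by blast
    then have "cmod \<mu> \<le> 0" by (rule LIMSEQ_le_const) (use bd in blast)
    then show False using mu by simp
  qed
  have "\<exists>S. (A - D - scal \<mu>) * S = 1 \<and> S * (A - D - scal \<mu>) = 1" if mu: "\<mu> \<noteq> 0" for \<mu>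
  proof -
    define G where "G = A - D - scal \<mu>"
    have Gp: "proper_on UNIV G" unfolding G_def by (rule riesz_proper[OF rT mu])
    have rng: "csubspace (range (app G))" "closed (range (app G))"
      by (rule range_csubspace[OF csubspace_UNIV], rule proper_closed_range[OF csubspace_UNIV closed_UNIV Gp])
    \<comment> \<open>Back substitution in the triangular system: \<open>D\<close> has removed the
      diagonal entry, so \<open>G\<close> sends \<open>e k\<close> to \<open>- \<mu>\<close> times
      \<open>e k\<close> plus a vector already known to lie in the range.\<close>
    have Pr: "P k *\<^sub>V x \<in> range (app G)" for k x
    proof (induction k arbitrary: x)
      case (Suc k)
      have "G *\<^sub>V e k = P k *\<^sub>V A *\<^sub>V e k - \<mu> *\<^sub>C e k"
        using diff_eq_eq[of "A *\<^sub>V e k" "l k *\<^sub>C e k"] Ae[of k]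
        by (simp add: G_def De add.commute)
      then have "e k = (1 / \<mu>) *\<^sub>C (P k *\<^sub>V A *\<^sub>V e k - G *\<^sub>V e k)"
        using mu by (simp add: scaleC_scaleC scaleC_one)
      then have "e k \<in> range (app G)"
        using subspaceD(3)[OF rng(1) csubspace_diff[OF rng(1) Suc]] by (metis rangeI)
      then show ?case using Suc subspaceD[OF rng(1)] by (simp add: PS)
    qed (use subspaceD(1)[OF rng(1)] in \<open>simp add: P0\<close>)
    have Er: "E \<subseteq> range (app G)" unfolding E_def
      by (rule closure_minimal[OF _ rng(2)]) (use Pr in \<open>auto simp: E0_def simp del: range_eqI, metis\<close>)
    have "y \<in> range (app G)" for y
    proof -
      have "surj (app (Q * A - scal \<mu>))" by (rule riesz_inj_imp_surj[OF rA' mu A'inj[OF mu]])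
      then obtain z where z: "(Q * A - scal \<mu>) *\<^sub>V z = Q *\<^sub>V y" by (metis surjD)
      have "Q *\<^sub>V A *\<^sub>V z - \<mu> *\<^sub>C (Q *\<^sub>V z) = Q *\<^sub>V y"
        using arg_cong[OF z, of "app Q"] by (simp add: orth_projD[OF Q])
      moreover have "Q *\<^sub>V A *\<^sub>V Q *\<^sub>V z = Q *\<^sub>V A *\<^sub>V z" using app_mult_cong[of "Q * A" Q Q A] QAQ by simp
      \<comment> \<open>\<open>D\<close> vanishes on the range of \<open>Q\<close>, so
        \<open>Q z\<close> solves the equation up to a vector of \<open>E\<close>.\<close>
      ultimately have "y - G *\<^sub>V Q *\<^sub>V z = R *\<^sub>V (y - A *\<^sub>V Q *\<^sub>V z)"
        using DQ[of z] by (simp add: G_def) (simp add: Q_def algebra_simps)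
      then have "y - G *\<^sub>V Q *\<^sub>V z \<in> range (app G)" using RE Er by (metis subsetD)
      from subspaceD(2)[OF rng(1) this rangeI[of "app G" "Q *\<^sub>V z"]] show ?thesis by simp
    qed
    then have surj: "surj (app G)" by blast
    have "x = 0" if "G *\<^sub>V x = 0" for x
      using riesz_surj_imp_inj[OF rT mu] surj that by (simp add: G_def)
    then obtain c where "c > 0" "\<And>x. c * norm x \<le> norm (G *\<^sub>V x)"
      using proper_bounded_below[OF csubspace_UNIV closed_UNIV Gp] by (metis UNIV_I)
    then show ?thesis using bop_inverse[OF _ _ surj] unfolding G_def by metis
  qed
  moreover have "S * D = D \<and> D * S = D" if S: "orth_proj S" "S * A = A" for S
  proof -
    \<comment> \<open>A projection fixing the range of \<open>A\<close> and the earlier vectors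
      fixes the range of \<open>C k\<close>, hence each eigenvector for a nonzero
      eigenvalue.\<close>
    have Se: "S *\<^sub>V e k = e k" for k
    proof (induction k rule: less_induct)
      case (less k)
      have SP: "S *\<^sub>V P j *\<^sub>V x = P j *\<^sub>V x" if "j \<le> k" for j x
        using that by (induction j) (simp_all add: P0 PS less)
      have "S *\<^sub>V A *\<^sub>V y = A *\<^sub>V y" for y using S(2) by (metis app_ops(6))
      then have "S *\<^sub>V C k *\<^sub>V e k = C k *\<^sub>V e k" by (simp add: C SP)
      then have "l k *\<^sub>C (S *\<^sub>V e k - e k) = 0" by (simp add: Ce cv.scale_right_diff_distrib)
      then show ?case using ev[of k] Ce[of k] by (cases "e k = 0") auto
    qed
    have "S * Ds n = Ds n" for n
      by (rule bop_eqI, induction n) (simp_all add: Ds_def Se)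
    moreover have "Ds n * S = Ds n" for n
    proof (rule bop_eqI)
      have "cinner (e i) (S *\<^sub>V x) = cinner (e i) x" for i x using orth_projD(4)[OF S(1), of "e i" x] Se by simp
      then show "(Ds n * S) *\<^sub>V x = Ds n *\<^sub>V x" for x by (induction n) (simp_all add: Ds_def)
    qed
    moreover have "(\<lambda>n. S * Ds n) \<longlonglongrightarrow> S * D" "(\<lambda>n. Ds n * S) \<longlonglongrightarrow> D * S" by (intro tendsto_intros D)+
    ultimately show ?thesis using D LIMSEQ_unique by (metis (no_types, lifting) ext)
  qed
  ultimately show ?thesis using that[OF cD] by blast
qed

subsection \<open>Generalized inverses and Fredholm operators on subspaces\<close>

text \<open>\<open>g\<close> is the Moore-Penrose inverse of \<open>T\<close> on \<open>N\<close>: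
  on the complement of the kernel within \<open>N\<close> the operator is injective, and the open
  mapping theorem bounds its inverse.\<close>

lemma closed_range_generalized_inverse:
  assumes N: "csubspace (N :: 'a::chilbert_space set)" "closed N" and cl: "closed (app T ` N)"
  obtains g where "\<And>x. g *\<^sub>V x \<in> N" "T * g = proj (app T ` N)"
    "\<And>x. x \<in> N \<Longrightarrow> g *\<^sub>V T *\<^sub>V x = x - proj {x \<in> N. T *\<^sub>V x = 0} *\<^sub>V x"
proof -
  define W where "W = app T ` N"
  have W: "csubspace W" "closed W" using range_csubspace[OF N(1)] cl by (simp_all add: W_def)
  define Z where "Z = {x \<in> N. T *\<^sub>V x = 0}"
  have "Z = N \<inter> {x. T *\<^sub>V x = 0}" by (auto simp: Z_def)
  then have Z: "csubspace Z" "closed Z"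
    using cv.subspace_inter[OF N(1) ker_csubspace] closed_Int[OF N(2) ker_closed] by metis+
  define N' where "N' = N \<inter> {x. proj Z *\<^sub>V x = 0}"
  have N': "csubspace N'" "closed N'"
    unfolding N'_def by (rule cv.subspace_inter[OF N(1) ker_csubspace] closed_Int[OF N(2) ker_closed])+
  have red: "x - proj Z *\<^sub>V x \<in> N' \<and> T *\<^sub>V (x - proj Z *\<^sub>V x) = T *\<^sub>V x" if "x \<in> N" for x
  proof -
    have p: "proj Z *\<^sub>V x \<in> Z" by (rule proj_props(1)[OF Z])
    then have pN: "proj Z *\<^sub>V x \<in> N" "T *\<^sub>V proj Z *\<^sub>V x = 0" unfolding Z_def by blast+
    have "proj Z *\<^sub>V proj Z *\<^sub>V x = proj Z *\<^sub>V x" by (rule proj_id[OF Z p])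
    then show ?thesis using csubspace_diff[OF N(1) that pN(1)] pN(2) by (simp add: N'_def)
  qed
  have inj: "x = y" if "x \<in> N'" "y \<in> N'" "T *\<^sub>V x = T *\<^sub>V y" for x y
  proof -
    have d: "x - y \<in> N'" by (rule csubspace_diff[OF N'(1) that(1,2)])
    then have "x - y \<in> Z" using that(3) by (simp add: Z_def N'_def)
    then have "proj Z *\<^sub>V (x - y) = x - y" by (rule proj_id[OF Z])
    then show ?thesis using d unfolding N'_def by auto
  qed
  have WN': "app T ` N' = W"
  proof (intro equalityI subsetI)
    fix y assume "y \<in> W"
    then obtain x where "x \<in> N" "y = T *\<^sub>V x" unfolding W_def by blast
    then show "y \<in> app T ` N'" using red[of x] by (metis imageI)
  qed (auto simp: N'_def W_def)
  obtain C where "\<forall>w\<in>W. \<exists>v\<in>N'. T *\<^sub>V v = w \<and> norm v \<le> C * norm w"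
    using closed_range_bounded_preimage[OF bounded_linear_app csubspace_imp_subspace[OF N'(1)] N'(2), of T] W(2)
    by (auto simp: WN')
  then have "\<exists>v. v \<in> N' \<and> T *\<^sub>V v = proj W *\<^sub>V x \<and> norm v \<le> C * norm (proj W *\<^sub>V x)" for x
    using proj_props(1)[OF W, of x] by blast
  then obtain h where h: "\<And>x. h x \<in> N'" "\<And>x. T *\<^sub>V h x = proj W *\<^sub>V x"
      "\<And>x. norm (h x) \<le> C * norm (proj W *\<^sub>V x)" by metis
  note S = subspaceD[OF N'(1)]
  have add: "h (x + y) = h x + h y" for x y by (rule inj) (simp_all add: h S)
  have sc: "h (z *\<^sub>C x) = z *\<^sub>C h x" for z x by (rule inj) (simp_all add: h S)
  have "norm (h x) \<le> norm x * \<bar>C\<bar>" for x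
  proof -
    have "norm (h x) \<le> \<bar>C\<bar> * norm (proj W *\<^sub>V x)"
      by (rule order_trans[OF h(3) mult_right_mono]) auto
    also have "\<dots> \<le> \<bar>C\<bar> * norm x" by (intro mult_left_mono orth_proj_norm_le orth_proj_proj[OF W]) auto
    finally show ?thesis by (simp add: mult.commute)
  qed
  then have "bounded_linear h" by (intro bounded_linear_intro[OF add]) (auto simp: scaleR_scaleC sc)
  then have app_h: "app (Bop h) = h" using sc by (simp add: Bop_inverse)
  show ?thesis
  proof
    show "Bop h *\<^sub>V x \<in> N" for x using h(1) by (simp add: app_h N'_def)
    show "T * Bop h = proj (app T ` N)" by (rule bop_eqI) (simp add: app_h h W_def)
    show "Bop h *\<^sub>V T *\<^sub>V x = x - proj {x \<in> N. T *\<^sub>V x = 0} *\<^sub>V x" if x: "x \<in> N" for x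
      unfolding app_h Z_def[symmetric]
    proof (rule inj)
      have "T *\<^sub>V x \<in> W" using x by (simp add: W_def)
      then show "T *\<^sub>V h (T *\<^sub>V x) = T *\<^sub>V (x - proj Z *\<^sub>V x)"
        using red[OF x] proj_id[OF W] by (simp add: h)
    qed (use h red[OF x] in auto)
  qed
qed

section \<open>Atkinson's theorem on invariant subspaces\<close>

lemma cspan_image_subset:
  assumes "\<And>x. x \<in> A \<Longrightarrow> T *\<^sub>V x \<in> cspan B" "x \<in> cspan A"
  shows "T *\<^sub>V x \<in> cspan B"
proof -
  have "csubspace {x. T *\<^sub>V x \<in> cspan B}"
    by (auto simp: cv.subspace_def cv.span_zero intro: cv.span_add cv.span_scale)
  then have "cspan A \<subseteq> {x. T *\<^sub>V x \<in> cspan B}" by (rule cv.span_minimal[rotated]) (use assms(1) in auto)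
  then show ?thesis using assms(2) by blast
qed

text \<open>The errors of the Moore-Penrose inverse are the projections onto the kernel and away
  from the range, both of finite rank on \<open>N\<close>. Operators \<open>X\<close> with values in
  \<open>N\<close> express equations on \<open>N\<close> through operators on the whole
  space.\<close>

lemma fredholm_parametrix:
  assumes N: "csubspace (N :: 'a::chilbert_space set)" "closed N"
    and T: "\<And>x. x \<in> N \<Longrightarrow> T *\<^sub>V x \<in> N"
    and fr: "fredholm_on N (restrict (app T) N)"
  obtains L where "\<And>x. L *\<^sub>V x \<in> N"
    "\<And>X. (\<And>x. X *\<^sub>V x \<in> N) \<Longrightarrow> ck (L * T * X) = ck X \<and> ck (T * L * X) = ck X"
proof -
  have im: "restrict (app T) N ` N = app T ` N" by auto
  have ker: "{x \<in> N. restrict (app T) N x = 0} = {x \<in> N. T *\<^sub>V x = 0}" by auto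
  have fr': "closed (app T ` N)" "cfinite_dim {x \<in> N. T *\<^sub>V x = 0}" "cfinite_codim N (app T ` N)"
    using fr unfolding fredholm_on_def im ker by blast+
  obtain L where L: "\<And>x. L *\<^sub>V x \<in> N" "T * L = proj (app T ` N)"
    "\<And>x. x \<in> N \<Longrightarrow> L *\<^sub>V T *\<^sub>V x = x - proj {x \<in> N. T *\<^sub>V x = 0} *\<^sub>V x"
    using closed_range_generalized_inverse[OF N fr'(1)] by blast
  let ?Z = "{x \<in> N. T *\<^sub>V x = 0}" and ?W = "app T ` N"
  have "?Z = N \<inter> {x. T *\<^sub>V x = 0}" by auto
  then have Z: "csubspace ?Z" "closed ?Z"
    using cv.subspace_inter[OF N(1) ker_csubspace] closed_Int[OF N(2) ker_closed] by metis+
  have W: "csubspace ?W" "closed ?W" using range_csubspace[OF N(1)] fr' by auto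
  have cZ: "cpt (proj ?Z)" by (rule finite_dim_proj_cpt[OF Z fr'(2)])
  obtain F where F: "finite F" "N \<subseteq> cspan (?W \<union> F)" using fr'(3) by (auto simp: cfinite_codim_def)
  have "ck (L * T * X) = ck X \<and> ck (T * L * X) = ck X" if X: "\<And>x. X *\<^sub>V x \<in> N" for X
  proof
    have "L * T * X = X - proj ?Z * X" by (rule bop_eqI) (simp add: L(3)[OF X])
    then show "ck (L * T * X) = ck X"
      using cpt_mult_right[OF cZ, of X] by (simp add: ck_ops flip: ck_eq_0_iff)
    have "cpt ((1 - proj ?W) * X)"
    proof (rule cpt_range_in_span[OF finite_imageI[OF F(1)]])
      fix x
      have st: "(1 - proj ?W) *\<^sub>V y \<in> cspan (app (1 - proj ?W) ` F)" if "y \<in> ?W \<union> F" for y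
        using that proj_id[OF W, of y] by (auto intro: cv.span_base simp del: app_ops(4)) (auto simp: cv.span_zero)
      show "((1 - proj ?W) * X) *\<^sub>V x \<in> cspan (app (1 - proj ?W) ` F)"
        unfolding app_ops(6) by (rule cspan_image_subset[OF st]) (use X[of x] F(2) in blast)+
    qed
    then show "ck (T * L * X) = ck X" unfolding L(2)
      by (simp add: ck_ops left_diff_distrib flip: ck_eq_0_iff)
  qed
  with L(1) show ?thesis by (rule that)
qed

lemma restrict_carrier:
  assumes M: "csubspace M" "\<And>x. x \<in> M \<Longrightarrow> T *\<^sub>V x \<in> M"
  shows "restrict (app T) M \<in> carrier (bounded_ops M)"
  using M(2) subspaceD[OF M(1)] norm_app[of T]
  by (auto simp: bounded_ops_def intro!: exI[of _ "norm T"])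

lemma fredholm_onI:
  assumes N: "csubspace (N :: 'a::chilbert_space set)" "closed N"
    and T: "\<And>x. x \<in> N \<Longrightarrow> T *\<^sub>V x \<in> N"
    and pr: "proper_on N T" and codim: "cfinite_codim N (app T ` N)"
  shows "fredholm_on N (restrict (app T) N)"
proof -
  have im: "restrict (app T) N ` N = app T ` N" by auto
  have ker: "{x \<in> N. restrict (app T) N x = 0} = {x \<in> N. T *\<^sub>V x = 0}" by auto
  show ?thesis unfolding fredholm_on_def im ker
    by (intro conjI restrict_carrier[OF N(1) T] proper_closed_range[OF N pr] proper_finite_dim_ker[OF N(1) pr] codim)
qed

text \<open>The right half of Atkinson's theorem. On unit vectors orthogonal to the range,
  \<open>K\<close> must cancel the vector itself and so has norm at least 1, which a compact
  operator cannot keep up along an orthonormal sequence.\<close>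

lemma finite_codim_range:
  assumes N: "csubspace (N :: 'a::chilbert_space set)"
    and T: "\<And>x. x \<in> N \<Longrightarrow> T *\<^sub>V x \<in> N" and cl: "closed (app T ` N)"
    and R: "\<And>x. x \<in> N \<Longrightarrow> x + K *\<^sub>V x \<in> app T ` N" and K: "cpt K"
  shows "cfinite_codim N (app T ` N)"
proof (rule ccontr)
  assume "\<not> ?thesis"
  then obtain e where e: "orthonormal_seq e" "\<And>k. e k \<in> N" "\<And>k. norm (e k) = 1"
      "\<And>k w. w \<in> app T ` N \<Longrightarrow> cinner w (e k) = 0"
    using infinite_codim_orthonormal_seq[OF N range_csubspace[OF N] cl] T by (metis image_subsetI)
  have "(\<lambda>k. norm (K *\<^sub>V e k)) \<longlonglongrightarrow> 0" using cpt_orthonormal_tendsto[OF K e(1)] tendsto_norm_zero by blast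
  moreover have "1 \<le> norm (K *\<^sub>V e k)" for k
  proof -
    have "cinner (e k + K *\<^sub>V e k) (e k) = 0" using e(4)[OF R[OF e(2)]] .
    then have "cinner (K *\<^sub>V e k) (e k) = - 1" using e(3)[of k] by (simp add: cinner_simps cinner_self add_eq_0_iff)
    then show ?thesis using cauchy_schwarz[of "K *\<^sub>V e k" "e k"] e(3)[of k] by simp
  qed
  ultimately have "1 \<le> (0::real)" by (intro LIMSEQ_le_const) auto
  then show False by simp
qed

text \<open>Boundedness comes from the open mapping theorem for addition on
  \<open>M \<times> N\<close>.\<close>

lemma oblique_projection:
  fixes M N :: "'a::chilbert_space set"
  assumes M: "csubspace M" "closed M" and N: "csubspace N" "closed N"
    and MN: "M \<inter> N = {0}" "{x + y |x y. x \<in> M \<and> y \<in> N} = UNIV"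
  obtains P where "\<And>x. P *\<^sub>V x \<in> M" "\<And>x. x - P *\<^sub>V x \<in> N" "\<And>x. x \<in> M \<Longrightarrow> P *\<^sub>V x = x"
    "\<And>x. x \<in> N \<Longrightarrow> P *\<^sub>V x = 0"
proof -
  have lin: "bounded_linear (\<lambda>z::'a \<times> 'a. fst z + snd z)"
    by (intro bounded_linear_add bounded_linear_fst bounded_linear_snd)
  have sub: "subspace (M \<times> N)"
    by (rule subspace_Times[OF csubspace_imp_subspace[OF M(1)] csubspace_imp_subspace[OF N(1)]])
  have onto: "(\<lambda>z. fst z + snd z) ` (M \<times> N) = UNIV" using MN(2) by (force simp: image_def)
  obtain C where C: "\<forall>w\<in>UNIV. \<exists>v\<in>M \<times> N. fst v + snd v = w \<and> norm v \<le> C * norm w"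
    using closed_range_bounded_preimage[OF lin sub closed_Times[OF M(2) N(2)]] onto by auto
  then obtain v where v: "\<And>w. v w \<in> M \<times> N" "\<And>w. fst (v w) + snd (v w) = w" "\<And>w. norm (v w) \<le> C * norm w"
    by (metis UNIV_I)
  define p where "p w = fst (v w)" for w
  have p: "p w \<in> M" "w - p w \<in> N" for w
  proof -
    show "p w \<in> M" using v(1)[of w] by (auto simp: p_def mem_Times_iff)
    have "w - p w = snd (v w)" using v(2)[of w] by (metis add_diff_cancel_left' p_def)
    then show "w - p w \<in> N" using v(1)[of w] by (auto simp: mem_Times_iff)
  qed
  have u: "p w = m" if "m \<in> M" "w - m \<in> N" for w m
  proof -
    have "p w - m \<in> M" by (rule csubspace_diff[OF M(1) p(1) that(1)])
    moreover have "(w - m) - (w - p w) \<in> N" by (rule csubspace_diff[OF N(1) that(2) p(2)])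
    ultimately have "p w - m \<in> M \<inter> N" by simp
    then show ?thesis using MN(1) by simp
  qed
  have add: "p (x + y) = p x + p y" for x y
  proof (rule u)
    have "(x - p x) + (y - p y) \<in> N" by (rule subspaceD(2)[OF N(1) p(2) p(2)])
    then show "x + y - (p x + p y) \<in> N" by (simp add: algebra_simps)
  qed (rule subspaceD(2)[OF M(1) p(1) p(1)])
  have sc: "p (c *\<^sub>C x) = c *\<^sub>C p x" for c x
  proof (rule u)
    show "c *\<^sub>C x - c *\<^sub>C p x \<in> N"
      using subspaceD(3)[OF N(1) p(2)] by (simp flip: cv.scale_right_diff_distrib)
  qed (rule subspaceD(3)[OF M(1) p(1)])
  have "norm (p w) \<le> norm w * C" for w
    using order_trans[OF norm_fst_le[of "fst (v w)" "snd (v w)"]] v(3)[of w] by (simp add: p_def mult.commute)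
  then have "bounded_linear p" by (intro bounded_linear_intro[OF add]) (auto simp: scaleR_scaleC sc)
  then have app_p: "app (Bop p) = p" using sc by (simp add: Bop_inverse)
  show ?thesis
  proof
    show "Bop p *\<^sub>V x \<in> M" "x - Bop p *\<^sub>V x \<in> N" for x unfolding app_p by (rule p)+
    show "Bop p *\<^sub>V x = x" if "x \<in> M" for x
      unfolding app_p by (rule u) (use that subspaceD(1)[OF N(1)] in auto)
    show "Bop p *\<^sub>V x = 0" if "x \<in> N" for x
      unfolding app_p by (rule u) (use that subspaceD(1)[OF M(1)] in auto)
  qed
qed

subsection \<open>Comparison with the record of the Calkin algebra\<close>

lemma compact_coset: "\<K> +>\<^bsub>\<L>\<^esub> app S = {app (X + S) |X. cpt X}"
proof -
  have "{app (X + S) |X. cpt X} = {k \<oplus>\<^bsub>\<L>\<^esub> app S |k. k \<in> \<K>}"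
  proof (intro equalityI subsetI)
    fix f assume "f \<in> {k \<oplus>\<^bsub>\<L>\<^esub> app S |k. k \<in> \<K>}"
    then obtain k where k: "k \<in> \<K>" "f = k \<oplus>\<^bsub>\<L>\<^esub> app S" by blast
    then have "app (Bop k) = k" by (intro app_Bop) (simp add: compact_ops_def)
    then show "f \<in> {app (X + S) |X. cpt X}"
      using k by (intro CollectI exI[of _ "Bop k"]) (simp add: app_eq_ops cpt_def)
  qed (auto simp: app_eq_ops cpt_def)
  then show ?thesis by (auto simp: a_r_coset_def')
qed

lemma calkin_map_eq_iff: "\<pi>\<^sub>C (app S) = \<pi>\<^sub>C (app T) \<longleftrightarrow> ck S = ck T"
proof
  assume "\<pi>\<^sub>C (app S) = \<pi>\<^sub>C (app T)"
  moreover have "app S \<in> \<pi>\<^sub>C (app S)"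
    unfolding calkin_map_def compact_coset by (intro CollectI exI[of _ 0]) (simp add: cpt_0)
  ultimately obtain X where "app S = app (X + T)" "cpt X" unfolding calkin_map_def compact_coset by auto
  then show "ck S = ck T" by (simp add: app_inject ck_eq_iff)
next
  have *: "\<pi>\<^sub>C (app S) \<subseteq> \<pi>\<^sub>C (app T)" if "cpt (S - T)" for S T :: "'a bop"
    unfolding calkin_map_def compact_coset
  proof safe
    fix X :: "'a bop" assume "cpt X"
    then have "cpt (X + (S - T))" using that by (rule cpt_add)
    then show "\<exists>Y. app (X + S) = app (Y + T) \<and> cpt Y" by (intro exI[of _ "X + (S - T)"]) simp
  qed
  assume "ck S = ck T"
  then have "cpt (S - T)" "cpt (T - S)" by (metis ck_eq_iff)+
  then show "\<pi>\<^sub>C (app S) = \<pi>\<^sub>C (app T)" using * by blast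
qed

text \<open>The passage from the type to the record; \<open>rep_calkin\<close> picks an arbitrary
  representative, on which the coset does not depend.\<close>

definition of_calkin :: "'a::chilbert_space calkin \<Rightarrow> ('a \<Rightarrow> 'a) set"
  where "of_calkin x = \<pi>\<^sub>C (app (rep_calkin x))"

lemma of_calkin_ck: "of_calkin (ck S) = \<pi>\<^sub>C (app S)"
  unfolding of_calkin_def calkin_map_eq_iff by (rule Quotient3_abs_rep[OF Quotient3_calkin])

lemma of_calkin_inject: "of_calkin x = of_calkin y \<longleftrightarrow> x = y"
  by (metis calkin_map_eq_iff ck_surj of_calkin_ck)

lemma carrier_calkin: "(carrier \<C> :: ('a::chilbert_space \<Rightarrow> 'a) set set) = range of_calkin"
proof -
  have "(carrier \<C> :: ('a \<Rightarrow> 'a) set set) = {\<pi>\<^sub>C f |f. f \<in> carrier \<L>}"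
    by (auto simp: calkin_algebra_def quotient_algebra_def FactRing_def A_RCOSETS_def' calkin_map_def)
  also have "\<dots> = range of_calkin"
  proof (intro equalityI subsetI)
    fix X :: "('a \<Rightarrow> 'a) set" assume "X \<in> {\<pi>\<^sub>C f |f. f \<in> carrier \<L>}"
    then obtain f where "X = \<pi>\<^sub>C f" "f \<in> carrier \<L>" by blast
    then have "X = of_calkin (ck (Bop f))" by (simp add: of_calkin_ck app_Bop)
    then show "X \<in> range of_calkin" by blast
  qed (auto simp: of_calkin_def app_carrier)
  finally show ?thesis .
qed

lemma of_calkin_mem [simp]: "of_calkin x \<in> carrier \<C>"
  by (simp add: carrier_calkin)

lemma of_calkin_mult: "of_calkin (x * y) = of_calkin x \<otimes>\<^bsub>\<C>\<^esub> of_calkin y"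
proof -
  obtain S T where "x = ck S" "y = ck T" by (metis ck_surj)
  then show ?thesis
    using ring_hom_mult[OF calkin_map_ring_hom app_carrier[of S] app_carrier[of T]]
    by (simp add: ck_ops(4)[symmetric] of_calkin_ck app_eq_ops)
qed

lemma of_calkin_add: "of_calkin (x + y) = of_calkin x \<oplus>\<^bsub>\<C>\<^esub> of_calkin y"
proof -
  obtain S T where "x = ck S" "y = ck T" by (metis ck_surj)
  then show ?thesis
    using ring_hom_add[OF calkin_map_ring_hom app_carrier[of S] app_carrier[of T]]
    by (simp add: ck_ops(1)[symmetric] of_calkin_ck app_eq_ops)
qed

lemma of_calkin_1: "of_calkin 1 = \<one>\<^bsub>\<C>\<^esub>"
  using ring_hom_one[OF calkin_map_ring_hom] by (simp add: ck_ops(6)[symmetric] of_calkin_ck app_eq_ops)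

lemma of_calkin_0: "of_calkin 0 = \<zero>\<^bsub>\<C>\<^esub>"
  using ring_hom_zero[OF calkin_map_ring_hom ring_operator_algebra ring_calkin_algebra]
  by (simp add: ck_ops(5)[symmetric] of_calkin_ck app_eq_ops)

lemma of_calkin_power: "of_calkin (x ^ n) = of_calkin x [^]\<^bsub>\<C>\<^esub> n"
proof -
  interpret ring "\<C> :: (complex, ('a \<Rightarrow> 'a) set) module" by (rule ring_calkin_algebra)
  show ?thesis by (induction n) (simp_all add: of_calkin_1 of_calkin_mult power_Suc2 del: power_Suc)
qed

lemma of_calkin_diff: "of_calkin (x - y) = of_calkin x \<ominus>\<^bsub>\<C>\<^esub> of_calkin y"
proof -
  interpret ring "\<C> :: (complex, ('a \<Rightarrow> 'a) set) module" by (rule ring_calkin_algebra)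
  have "of_calkin (- y) \<oplus>\<^bsub>\<C>\<^esub> of_calkin y = \<zero>\<^bsub>\<C>\<^esub>" by (simp flip: of_calkin_add of_calkin_0)
  then have "\<ominus>\<^bsub>\<C>\<^esub> of_calkin y = of_calkin (- y)" by (intro minus_equality) auto
  then show ?thesis by (simp add: a_minus_def flip: of_calkin_add)
qed

lemma of_calkin_csc: "of_calkin (csc z) = z \<odot>\<^bsub>\<C>\<^esub> \<one>\<^bsub>\<C>\<^esub>"
proof -
  have "of_calkin (csc z) = \<pi>\<^sub>C (z \<odot>\<^bsub>\<L>\<^esub> app 1)"
    by (simp add: csc_def of_calkin_ck flip: app_eq_ops(5))
  also have "\<dots> = z \<odot>\<^bsub>\<C>\<^esub> \<pi>\<^sub>C (app 1)" by (rule calkin_map_smult[OF app_carrier])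
  also have "\<pi>\<^sub>C (app 1) = \<one>\<^bsub>\<C>\<^esub>" by (metis ck_ops(6) of_calkin_1 of_calkin_ck)
  finally show ?thesis .
qed

lemma of_calkin_unit: "of_calkin x \<in> Units \<C> \<longleftrightarrow> (\<exists>v. v * x = 1 \<and> x * v = 1)"
  unfolding Units_def carrier_calkin
  by (auto simp flip: of_calkin_mult of_calkin_1 simp: of_calkin_inject)

definition quasi_nil :: "'a::chilbert_space calkin \<Rightarrow> bool"
  where "quasi_nil w \<longleftrightarrow> (\<forall>z. z \<noteq> 0 \<longrightarrow> (\<exists>v. v * (csc z - w) = 1 \<and> (csc z - w) * v = 1))"

lemma quasi_nilpotent_of_calkin: "quasi_nilpotent \<C> (of_calkin w) \<longleftrightarrow> quasi_nil w"
  unfolding quasi_nilpotent_def alg_spectrum_def quasi_nil_def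
  by (auto simp flip: of_calkin_csc of_calkin_diff simp: of_calkin_unit)

lemma drazin_of_calkin:
  "of_calkin b \<in> drazin_invertibles \<C> \<longleftrightarrow>
    (\<exists>c m. b * c = c * b \<and> c * b * c = c \<and> b ^ m * c * b = b ^ m)"
  unfolding drazin_invertibles_def carrier_calkin
  by (auto simp flip: of_calkin_mult of_calkin_power simp: of_calkin_inject)

lemma koliha_drazin_of_calkin:
  "of_calkin b \<in> koliha_drazin_invertibles \<C> \<longleftrightarrow>
    (\<exists>c w. quasi_nil w \<and> b * c = c * b \<and> c * b * c = c \<and> b * c * b = b + w)"
proof
  assume "of_calkin b \<in> koliha_drazin_invertibles \<C>"
  then obtain c w where cw: "quasi_nilpotent \<C> w" "of_calkin b \<otimes>\<^bsub>\<C>\<^esub> of_calkin c = of_calkin c \<otimes>\<^bsub>\<C>\<^esub> of_calkin b"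
      "of_calkin c \<otimes>\<^bsub>\<C>\<^esub> of_calkin b \<otimes>\<^bsub>\<C>\<^esub> of_calkin c = of_calkin c"
      "of_calkin b \<otimes>\<^bsub>\<C>\<^esub> of_calkin c \<otimes>\<^bsub>\<C>\<^esub> of_calkin b = of_calkin b \<oplus>\<^bsub>\<C>\<^esub> w"
    unfolding koliha_drazin_invertibles_def carrier_calkin by blast
  then obtain w' where "w = of_calkin w'" unfolding quasi_nilpotent_def carrier_calkin by blast
  with cw have "quasi_nil w'" "b * c = c * b" "c * b * c = c" "b * c * b = b + w'"
    by (simp_all only: quasi_nilpotent_of_calkin of_calkin_inject flip: of_calkin_mult of_calkin_add)
  then show "\<exists>c w. quasi_nil w \<and> b * c = c * b \<and> c * b * c = c \<and> b * c * b = b + w" by blast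
next
  assume "\<exists>c w. quasi_nil w \<and> b * c = c * b \<and> c * b * c = c \<and> b * c * b = b + w"
  then obtain c w where cw: "quasi_nil w" "b * c = c * b" "c * b * c = c" "b * c * b = b + w" by blast
  have "quasi_nilpotent \<C> (of_calkin w)" using cw(1) by (simp add: quasi_nilpotent_of_calkin)
  moreover have "of_calkin b \<otimes>\<^bsub>\<C>\<^esub> of_calkin c = of_calkin c \<otimes>\<^bsub>\<C>\<^esub> of_calkin b"
    "of_calkin c \<otimes>\<^bsub>\<C>\<^esub> of_calkin b \<otimes>\<^bsub>\<C>\<^esub> of_calkin c = of_calkin c"
    "of_calkin b \<otimes>\<^bsub>\<C>\<^esub> of_calkin c \<otimes>\<^bsub>\<C>\<^esub> of_calkin b = of_calkin b \<oplus>\<^bsub>\<C>\<^esub> of_calkin w"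
    using cw(2-4) by (metis of_calkin_mult of_calkin_add)+
  ultimately show "of_calkin b \<in> koliha_drazin_invertibles \<C>"
    unfolding koliha_drazin_invertibles_def using of_calkin_mem by blast
qed

lemma bounded_ops_unit_iff:
  assumes M: "csubspace (M :: 'a::chilbert_space set)" and T: "\<And>x. x \<in> M \<Longrightarrow> T *\<^sub>V x \<in> M"
  shows "z \<odot>\<^bsub>bounded_ops M\<^esub> \<one>\<^bsub>bounded_ops M\<^esub> \<ominus>\<^bsub>bounded_ops M\<^esub> restrict (app T) M \<in> Units (bounded_ops M) \<longleftrightarrow>
    (\<exists>g\<in>carrier (bounded_ops M). \<forall>x\<in>M. g (z *\<^sub>C x - T *\<^sub>V x) = x \<and> z *\<^sub>C g x - T *\<^sub>V g x = x)"
proof -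
  interpret ring "bounded_ops M" by (rule ring_bounded_ops[OF M])
  note S = subspaceD[OF M]
  have T': "restrict (app T) M \<in> carrier (bounded_ops M)" by (rule restrict_carrier[OF M T])
  define f where "f = (\<lambda>x\<in>M. z *\<^sub>C x - T *\<^sub>V x)"
  have "\<ominus>\<^bsub>bounded_ops M\<^esub> restrict (app T) M = (\<lambda>x\<in>M. - (T *\<^sub>V x))"
  proof (rule minus_equality)
    show "(\<lambda>x\<in>M. - (T *\<^sub>V x)) \<oplus>\<^bsub>bounded_ops M\<^esub> restrict (app T) M = \<zero>\<^bsub>bounded_ops M\<^esub>"
      by (auto simp: bounded_ops_simps)
    have "(\<lambda>x\<in>M. - (T *\<^sub>V x)) = restrict (app (- T)) M" by auto
    then show "(\<lambda>x\<in>M. - (T *\<^sub>V x)) \<in> carrier (bounded_ops M)"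
      using restrict_carrier[OF M, of "- T"] T S(3)[of "T *\<^sub>V _" "- 1"] by (simp add: scaleC_minus_one)
  qed (rule T')
  then have eq: "z \<odot>\<^bsub>bounded_ops M\<^esub> \<one>\<^bsub>bounded_ops M\<^esub> \<ominus>\<^bsub>bounded_ops M\<^esub> restrict (app T) M = f"
    by (auto simp: a_minus_def bounded_ops_simps f_def)
  have fM: "f x \<in> M" if "x \<in> M" for x
    using that T csubspace_diff[OF M] S(3) by (simp add: f_def)
  have fC: "f \<in> carrier (bounded_ops M)"
    using eq T' bounded_ops_closed[OF M] by (metis minus_closed)
  have "compose M g f = (\<lambda>x\<in>M. x) \<longleftrightarrow> (\<forall>x\<in>M. g (f x) = x)" for g :: "'a \<Rightarrow> 'a"
    by (auto simp: compose_def fun_eq_iff)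
  moreover have "compose M f g = (\<lambda>x\<in>M. x) \<longleftrightarrow> (\<forall>x\<in>M. f (g x) = x)" for g :: "'a \<Rightarrow> 'a"
    by (auto simp: compose_def fun_eq_iff)
  ultimately show ?thesis
    unfolding eq Units_def
    using fC by (auto simp: bounded_ops_simps f_def dest: bounded_opsD(2) intro!: bexI)
qed

lemma quasi_nilpotent_restrict:
  assumes M: "csubspace (M :: 'a::chilbert_space set)" and T: "\<And>x. x \<in> M \<Longrightarrow> T *\<^sub>V x \<in> M"
  shows "quasi_nilpotent (bounded_ops M) (restrict (app T) M) \<longleftrightarrow>
    (\<forall>z. z \<noteq> 0 \<longrightarrow> (\<exists>g\<in>carrier (bounded_ops M). \<forall>x\<in>M. g (z *\<^sub>C x - T *\<^sub>V x) = x \<and> z *\<^sub>C g x - T *\<^sub>V g x = x))"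
proof -
  have "restrict (app T) M \<in> carrier (bounded_ops M)" by (rule restrict_carrier[OF M T])
  moreover have "A \<subseteq> {0} \<longleftrightarrow> (\<forall>z. z \<noteq> 0 \<longrightarrow> z \<notin> A)" for A :: "complex set" by blast
  ultimately show ?thesis
    unfolding quasi_nilpotent_def alg_spectrum_def by (simp add: bounded_ops_unit_iff[OF M T])
qed

subsection \<open>From operators to the Calkin algebra\<close>

text \<open>Iterating the assumptions gives \<open>b ^ (n + k) * u ^ k = b ^ n\<close> and its
  mirror image. Bracketing \<open>v ^ k * b ^ (n + k) * u ^ k\<close> in two ways shows that
  \<open>b ^ n * u ^ k\<close> equals \<open>v ^ k * b ^ n\<close>. The inverse is this element for
  \<open>k = n + 1\<close>; one form serves for \<open>b * c\<close>, the other for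
  \<open>c * b\<close>.\<close>

lemma strongly_pi_regular_drazin:
  fixes b u v :: "'r::monoid_mult"
  assumes u: "b ^ n = b ^ Suc n * u" and v: "b ^ n = v * b ^ Suc n"
  shows "\<exists>c. b * c = c * b \<and> c * b * c = c \<and> b ^ n * c * b = b ^ n"
proof -
  have bu: "b ^ (n + k) * u ^ k = b ^ n" for k
  proof (induction k)
    case (Suc k)
    have e: "b ^ (n + Suc k) = b ^ k * b ^ Suc n" "b ^ (n + k) = b ^ k * b ^ n"
      by (metis add.commute add_Suc_shift power_add, metis add.commute power_add)
    have "b ^ (n + Suc k) * u ^ Suc k = b ^ k * (b ^ Suc n * u) * u ^ k"
      by (simp only: e power_Suc[of u] mult.assoc)
    also have "\<dots> = b ^ (n + k) * u ^ k" by (simp only: u[symmetric] e)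
    finally show ?case using Suc by simp
  qed simp
  have vb: "v ^ k * b ^ (n + k) = b ^ n" for k
  proof (induction k)
    case (Suc k)
    have "b ^ (n + Suc k) = b ^ Suc n * b ^ k" by (metis add_Suc_shift power_add)
    then have "v ^ Suc k * b ^ (n + Suc k) = v ^ k * (v * b ^ Suc n) * b ^ k"
      by (simp only: power_Suc2[of v] mult.assoc)
    also have "\<dots> = v ^ k * b ^ (n + k)" by (simp only: v[symmetric] power_add mult.assoc)
    finally show ?case using Suc by simp
  qed simp
  have swap: "b ^ n * u ^ k = v ^ k * b ^ n" if "k \<le> n + 1" for k
  proof -
    have "v ^ k * (b ^ (n + k) * u ^ k) = (v ^ k * b ^ (n + k)) * u ^ k" by (simp only: mult.assoc)
    then show ?thesis by (simp only: bu vb)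
  qed
  define c where "c = b ^ n * u ^ Suc n"
  have c': "c = v ^ Suc n * b ^ n" using swap[of "Suc n"] by (simp add: c_def)
  have bc: "b * c = b ^ n * u ^ n"
  proof -
    have "b * c = b ^ Suc n * u * u ^ n" by (simp add: c_def mult.assoc)
    then show ?thesis by (simp only: u[symmetric])
  qed
  have cb: "c * b = v ^ n * b ^ n"
  proof -
    have "c * b = v ^ n * (v * b ^ Suc n)" by (simp only: c' power_Suc2[of v] power_Suc2[of b] mult.assoc)
    then show ?thesis by (simp only: v[symmetric])
  qed
  have bb: "b ^ n * (b ^ n * u ^ n) = b ^ n" using bu[of n] by (simp add: power_add mult.assoc)
  have eq: "b * c = c * b" using swap[of n] by (simp add: bc cb)
  have "c * b * c = v ^ n * (b ^ n * (b ^ n * u ^ n)) * u"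
    by (subst cb) (simp only: c_def mult.assoc power_Suc2)
  also have "\<dots> = b ^ n * u ^ n * u" by (simp only: bb swap[of n, symmetric, simplified])
  also have "\<dots> = c" by (simp only: c_def power_Suc2 mult.assoc)
  finally have "c * b * c = c" .
  moreover have "b ^ n * c * b = b ^ n" using bb by (simp add: mult.assoc eq[symmetric] bc)
  ultimately show ?thesis using eq by blast
qed

text \<open>A parametrix \<open>L\<close> of \<open>T\<close> on the range of \<open>T ^ n\<close>
  yields both regularity equations, once each side is multiplied by \<open>T ^ n\<close>.\<close>

lemma B_fredholm_drazin:
  fixes T :: "'a::chilbert_space bop"
  assumes "app T \<in> \<B>\<F>"
  shows "of_calkin (ck T) \<in> drazin_invertibles \<C>"
proof -
  obtain n where "closed (range (app T ^^ n))" "fredholm_on (range (app T ^^ n)) (restrict (app T) (range (app T ^^ n)))"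
    using assms unfolding B_fredholm_def by blast
  moreover have Tn: "app T ^^ n = app (T ^ n)" by (rule ext) (simp add: app_power)
  ultimately have cl: "closed (range (app (T ^ n)))"
      and fr: "fredholm_on (range (app (T ^ n))) (restrict (app T) (range (app (T ^ n))))" by simp_all
  let ?R = "range (app (T ^ n))"
  have R: "csubspace ?R" by (rule range_csubspace[OF csubspace_UNIV])
  have TR: "T *\<^sub>V x \<in> ?R" if xR: "x \<in> ?R" for x
  proof -
    obtain y where "x = (T ^ n) *\<^sub>V y" using xR by blast
    then have "T *\<^sub>V x = (T ^ n) *\<^sub>V T *\<^sub>V y" using app_mult_cong[OF power_commutes[of T n, symmetric]] by simp
    then show ?thesis by (metis rangeI)
  qed
  obtain L where L: "\<And>x. L *\<^sub>V x \<in> ?R"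
    "\<And>X. (\<And>x. X *\<^sub>V x \<in> ?R) \<Longrightarrow> ck (L * T * X) = ck X \<and> ck (T * L * X) = ck X"
    using fredholm_parametrix[OF R cl TR fr] by metis
  obtain J where J: "T ^ n * J = proj ?R"
    using closed_range_generalized_inverse[OF csubspace_UNIV closed_UNIV cl] by metis
  \<comment> \<open>\<open>L\<close> takes values in the range of \<open>T ^ n\<close>, so it
    factors through \<open>T ^ n\<close>; this turns \<open>T * L * T ^ n\<close> into a right
    multiple of \<open>T ^ Suc n\<close>.\<close>
  have "T ^ n * J * L = L" unfolding J by (rule bop_eqI) (simp add: proj_id[OF R cl] L)
  moreover have "T ^ Suc n * (J * L * T ^ n) = T * (T ^ n * J * L) * T ^ n" by (simp only: power_Suc mult.assoc)
  ultimately have "T ^ Suc n * (J * L * T ^ n) = T * L * T ^ n" by simp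
  moreover have L2: "ck (T * L * T ^ n) = ck (T ^ n)" "ck (L * T * T ^ n) = ck (T ^ n)" using L(2)[of "T ^ n"] by auto
  ultimately have "ck (T ^ Suc n) * ck (J * L * T ^ n) = ck (T ^ n)" unfolding ck_ops(4)[symmetric] by simp
  then have "ck T ^ Suc n * ck (J * L * T ^ n) = ck T ^ n" unfolding ck_power .
  moreover have "ck L * ck T ^ Suc n = ck T ^ n"
    using L2(2) by (simp only: mult.assoc ck_ops(4) ck_power power_Suc)
  ultimately have "ck T ^ n = ck T ^ Suc n * ck (J * L * T ^ n)" "ck T ^ n = ck L * ck T ^ Suc n" by metis+
  from strongly_pi_regular_drazin[OF this] show ?thesis unfolding drazin_of_calkin by blast
qed

text \<open>The inverse is the class of \<open>L * E\<close>, for a parametrix \<open>L\<close> on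
  \<open>N\<close> and the projection \<open>E\<close> onto \<open>N\<close> along \<open>M\<close>;
  its products with \<open>b\<close> are the class of \<open>E\<close>. The remainder is
  \<open>T\<close> on \<open>M\<close> extended by 0, with the sign forced by
  \<open>b * c * b = b + w\<close>.\<close>

lemma pseudo_B_fredholm_koliha_drazin:
  fixes T :: "'a::chilbert_space bop"
  assumes "app T \<in> \<P>\<B>\<F>"
  shows "of_calkin (ck T) \<in> koliha_drazin_invertibles \<C>"
proof -
  obtain M N where M: "csubspace M" "closed M" "app T ` M \<subseteq> M" and N: "csubspace N" "closed N" "app T ` N \<subseteq> N"
    and MN: "M \<inter> N = {0}" "{x + y |x y. x \<in> M \<and> y \<in> N} = UNIV"
    and qn: "quasi_nilpotent (bounded_ops M) (restrict (app T) M)" and fr: "fredholm_on N (restrict (app T) N)"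
    using assms unfolding pseudo_B_fredholm_def mem_Collect_eq
    by (elim conjE exE) (rule that; assumption)
  have TM: "T *\<^sub>V x \<in> M" if "x \<in> M" for x using M(3) that by blast
  have TN: "T *\<^sub>V x \<in> N" if "x \<in> N" for x using N(3) that by blast
  obtain P where P: "\<And>x. P *\<^sub>V x \<in> M" "\<And>x. x - P *\<^sub>V x \<in> N" "\<And>x. x \<in> M \<Longrightarrow> P *\<^sub>V x = x"
    "\<And>x. x \<in> N \<Longrightarrow> P *\<^sub>V x = 0"
    using oblique_projection[OF M(1,2) N(1,2) MN] by blast
  define E where "E = 1 - P"
  have PP: "P * P = P" by (rule bop_eqI) (simp add: P)
  have TP: "T * P = P * T"
  proof (rule bop_eqI)
    fix x
    have "P *\<^sub>V T *\<^sub>V (x - P *\<^sub>V x) = 0" by (rule P(4)[OF TN[OF P(2)]])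
    moreover have "P *\<^sub>V T *\<^sub>V P *\<^sub>V x = T *\<^sub>V P *\<^sub>V x" by (rule P(3)[OF TM[OF P(1)]])
    ultimately show "(T * P) *\<^sub>V x = (P * T) *\<^sub>V x" by simp
  qed
  have EE: "E * E = E" "P * E = 0" "E * P = 0" "P + E = 1" by (simp_all add: E_def algebra_simps PP)
  have TE: "T * E = E * T" by (simp add: E_def algebra_simps TP)
  have EN: "E *\<^sub>V x \<in> N" for x by (simp add: E_def P)
  obtain L where L: "\<And>x. L *\<^sub>V x \<in> N"
    "\<And>X. (\<And>x. X *\<^sub>V x \<in> N) \<Longrightarrow> ck (L * T * X) = ck X \<and> ck (T * L * X) = ck X"
    using fredholm_parametrix[OF N(1,2) TN fr] by metis
  have EL: "E * L = L" by (rule bop_eqI) (simp add: E_def P(4)[OF L(1)])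
  define b where "b = ck T"
  define c where "c = ck (L * E)"
  have ckE: "ck (L * T * E) = ck E" "ck (T * L * E) = ck E" using L(2)[of E] EN by blast+
  have cb: "c * b = ck E"
    using ckE(1) by (simp only: b_def c_def ck_ops(4)[symmetric] mult.assoc TE)
  have bc: "b * c = ck E"
    using ckE(2) by (simp only: b_def c_def ck_ops(4)[symmetric] mult.assoc)
  have ec: "ck E * c = c"
    using EL by (simp only: c_def ck_ops(4)[symmetric] mult.assoc[symmetric])
  define w where "w = - ck (T * P)"
  have bcb: "b * c * b = b + w"
  proof -
    have "E * T = T - T * P" by (simp add: E_def algebra_simps TP)
    then have "ck E * ck T = ck T + w" by (simp add: w_def ck_ops(2) flip: ck_ops(4))
    then show ?thesis unfolding bc unfolding b_def .
  qed
  have "quasi_nil w" unfolding quasi_nil_def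
  proof (intro allI impI)
    fix z :: complex assume z: "z \<noteq> 0"
    then have "- z \<noteq> 0" by simp
    then have "\<exists>g\<in>carrier (bounded_ops M). \<forall>x\<in>M. g ((- z) *\<^sub>C x - T *\<^sub>V x) = x \<and> (- z) *\<^sub>C g x - T *\<^sub>V g x = x"
      using qn quasi_nilpotent_restrict[OF M(1), of T] TM by blast
    then obtain g where g: "g \<in> carrier (bounded_ops M)"
        "\<And>x. x \<in> M \<Longrightarrow> g ((- z) *\<^sub>C x - T *\<^sub>V x) = x" "\<And>x. x \<in> M \<Longrightarrow> (- z) *\<^sub>C g x - T *\<^sub>V g x = x"
      by blast
    note gD = bounded_opsD[OF g(1)]
    have "\<exists>K. \<forall>x\<in>M. norm (g x) \<le> K * norm x" using g(1) by (simp add: bounded_ops_def)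
    then obtain K where K: "\<And>x. x \<in> M \<Longrightarrow> norm (g x) \<le> K * norm x" by blast
    define h where "h x = g (P *\<^sub>V x)" for x
    have hC: "h (a *\<^sub>C x) = a *\<^sub>C h x" for a x by (simp add: h_def gD P)
    have "norm (h x) \<le> norm x * (\<bar>K\<bar> * norm P)" for x
    proof -
      have "norm (h x) \<le> \<bar>K\<bar> * norm (P *\<^sub>V x)" unfolding h_def
        by (rule order_trans[OF K[OF P(1)] mult_right_mono]) auto
      also have "\<dots> \<le> \<bar>K\<bar> * (norm P * norm x)" by (intro mult_left_mono norm_app) auto
      finally show ?thesis by (simp add: mult_ac)
    qed
    then have "bounded_linear h"
      by (intro bounded_linear_intro) (auto simp: scaleR_scaleC hC, simp add: h_def gD P)
    then have app_h: "app (Bop h) = h" using hC by (simp add: Bop_inverse)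
    define V where "V = Bop h"
    have PV: "P * V = V" by (rule bop_eqI) (simp add: V_def app_h h_def P gD)
    have VP: "V * P = V" by (rule bop_eqI) (simp add: V_def app_h h_def P)
    have V1: "(scal (- z) - T) * V = P" by (rule bop_eqI) (use g(3)[OF P(1)] in \<open>simp add: V_def app_h h_def\<close>)
    have V2: "V * (scal (- z) - T) * P = P"
      by (rule bop_eqI) (use g(2)[OF P(1)] in \<open>simp add: V_def app_h h_def P TM subspaceD(3)[OF M(1)] csubspace_diff[OF M(1)]\<close>)
    define Y where "Y = scal z + T * P"
    \<comment> \<open>Inverts \<open>Y\<close> block by block: \<open>Y\<close> is multiplication by
      \<open>z\<close> on the range of \<open>E\<close>, and on \<open>M\<close> it is minus the
      operator that \<open>V\<close> inverts.\<close>
    define U where "U = scal (1 / z) * E - V"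
    have Y: "Y = scal z * E - (scal (- z) - T) * P"
      using EE(4) by (simp add: Y_def scal_simps algebra_simps flip: distrib_left)
    have sz: "scal (1 / z) * (scal z * X) = X" "scal z * (scal (1 / z) * X) = X" for X :: "'a bop"
      using z by (simp_all add: mult.assoc[symmetric] scal_simps(2)[symmetric] scal_simps(3))
    have EV: "E * V = 0" "V * E = 0" by (simp_all add: E_def left_diff_distrib right_diff_distrib PV VP)
    have PTz: "P * (scal (- z) - T) = (scal (- z) - T) * P"
      by (simp add: left_diff_distrib right_diff_distrib TP scal_commute)
    have "U * Y = 1"
    proof -
      have 1: "scal (1 / z) * E * (scal z * E) = E"
        using sz(1)[of "E * E"] by (metis EE(1) mult.assoc scal_commute)
      have 2: "E * ((scal (- z) - T) * P) = 0" by (metis EE(3) PTz mult.assoc mult_zero_left)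
      have 3: "V * (scal z * E) = 0" using EV(2) by (metis mult.assoc mult_zero_right scal_commute)
      have "U * Y = scal (1 / z) * E * (scal z * E) - scal (1 / z) * (E * ((scal (- z) - T) * P))
          - V * (scal z * E) + V * (scal (- z) - T) * P"
        unfolding U_def Y by (simp add: left_diff_distrib right_diff_distrib mult.assoc)
      then show ?thesis using EE(4) by (simp only: 1 2 3 V2) (simp add: add.commute)
    qed
    moreover have "Y * U = 1"
    proof -
      have 1: "scal z * E * (scal (1 / z) * E) = E"
        using sz(2)[of "E * E"] by (metis EE(1) mult.assoc scal_commute)
      have 2: "(scal (- z) - T) * P * (scal (1 / z) * E) = 0"
        by (metis EE(2) mult.assoc mult_zero_right scal_commute)
      have 3: "scal z * E * V = 0" by (simp add: mult.assoc EV)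
      have 4: "(scal (- z) - T) * P * V = P" by (simp only: mult.assoc PV V1)
      have "Y * U = scal z * E * (scal (1 / z) * E) - scal z * E * V
          - (scal (- z) - T) * P * (scal (1 / z) * E) + (scal (- z) - T) * P * V"
        unfolding U_def Y by (simp only: left_diff_distrib right_diff_distrib) simp
      then show ?thesis using EE(4) by (simp only: 1 2 3 4) (simp add: add.commute)
    qed
    moreover have "csc z - w = ck Y" by (simp add: csc_def w_def Y_def ck_ops)
    ultimately show "\<exists>v. v * (csc z - w) = 1 \<and> (csc z - w) * v = 1"
      by (metis ck_ops(4,6))
  qed
  moreover have "b * c = c * b" "c * b * c = c" by (simp_all add: bc cb ec)
  ultimately show ?thesis unfolding koliha_drazin_of_calkin b_def[symmetric] using bcb by blast
qed

subsection \<open>From the Calkin algebra to operators\<close>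

text \<open>The lift \<open>T\<close> of \<open>ck S\<close> acts as \<open>Q\<close> on the range of the idempotent \<open>P\<close> and as \<open>(1 - P) * S * (1 - P)\<close> on
  its kernel. Since \<open>P\<close> need not be orthogonal, while the decompositions that supply \<open>Q\<close> need an orthogonal
  projection, \<open>Q\<close> is taken relative to the orthogonal projection onto the range of \<open>P\<close>.\<close>

locale calkin_splitting =
  fixes S C P Q :: "'a::chilbert_space bop"
  assumes comm: "ck S * ck C = ck C * ck S" and CSC: "ck C * ck S * ck C = ck C"
    and PP: "P * P = P" and ckP: "ck P = 1 - ck S * ck C"
    and P0Q: "proj {x. P *\<^sub>V x = x} * Q = Q"
    and ckQ: "ck Q = ck (P * S * P * proj {x. P *\<^sub>V x = x})"
begin

abbreviation "M \<equiv> {x. P *\<^sub>V x = x}"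
abbreviation "N \<equiv> {x. P *\<^sub>V x = 0}"
abbreviation "P0 \<equiv> proj M"

definition F :: "'a bop" where "F = (1 - P) * S * (1 - P)"
definition T :: "'a bop" where "T = Q * P + F"

lemma M: "csubspace M" "closed M" and N: "csubspace N" "closed N"
  by (rule fix_csubspace, rule fix_closed, rule ker_csubspace, rule ker_closed)

lemma P_M: "P *\<^sub>V x \<in> M" and P_N: "(1 - P) *\<^sub>V x \<in> N"
  using app_mult_cong[of P P P 1 x] PP by simp_all

text \<open>\<open>P\<close> and \<open>P0\<close> have the same range, so each absorbs the other
  from the left; from the right they do not in general.\<close>

lemma P0_P: "P0 * P = P"
  by (rule bop_eqI) (simp add: proj_id[OF M P_M])

lemma P_P0: "P * P0 = P0"
  by (rule bop_eqI) (use proj_props(1)[OF M] in simp)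

lemma PQ: "P * Q = Q"
  using P_P0 P0Q by (metis mult.assoc)

lemma T_on_M: "x \<in> M \<Longrightarrow> T *\<^sub>V x = Q *\<^sub>V x"
  by (simp add: T_def F_def)

lemma T_on_N: "x \<in> N \<Longrightarrow> T *\<^sub>V x = F *\<^sub>V x"
  by (simp add: T_def)

lemma F_N: "F *\<^sub>V x \<in> N"
  using P_N by (simp add: F_def)

lemma T_N: "x \<in> N \<Longrightarrow> T *\<^sub>V x \<in> N"
  using F_N[of x] T_on_N[of x] by simp

lemma Q_M: "Q *\<^sub>V x \<in> M"
  using arg_cong[OF PQ, of "\<lambda>T. T *\<^sub>V x"] by simp

lemma T_M: "x \<in> M \<Longrightarrow> T *\<^sub>V x \<in> M"
  using Q_M[of x] T_on_M[of x] by simp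

lemma ck_compl: "ck (1 - P) = ck S * ck C"
  by (simp add: ck_ops ckP)

lemma ck_compl_commute: "ck (1 - P) * ck S = ck S * ck (1 - P)"
  using comm unfolding ck_compl by (metis mult.assoc)

lemma ck_compl_idem: "ck (1 - P) * ck (1 - P) = ck (1 - P)"
  using PP by (simp add: algebra_simps flip: ck_ops)

text \<open>Modulo compact operators \<open>P\<close> commutes with \<open>S\<close>, so the two
  diagonal blocks already add up to \<open>S\<close>; restricting to \<open>P0\<close> is undone by
  \<open>P0 * P = P\<close>.\<close>

lemma ck_T: "ck T = ck S"
proof -
  have "ck (Q * P) = ck (P * S * P * (P0 * P))" by (simp only: ck_ops(4) ckQ mult.assoc)
  then have "ck (Q * P) = ck (P * S * P)" by (simp add: P0_P mult.assoc PP)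
  also have "\<dots> = ck P * (ck S * ck P)" by (simp add: ck_ops mult.assoc)
  also have "ck S * ck P = ck P * ck S"
    using ck_compl_commute by (simp add: ck_ops algebra_simps)
  also have "ck P * (ck P * ck S) = ck (P * P) * ck S" by (simp add: ck_ops mult.assoc)
  finally have 1: "ck (Q * P) = ck P * ck S" by (simp only: PP)
  have "ck F = ck (1 - P) * (ck S * ck (1 - P))" by (simp only: F_def ck_ops(4) mult.assoc)
  also have "\<dots> = ck (1 - P) * ck (1 - P) * ck S" by (simp only: ck_compl_commute[symmetric] mult.assoc)
  finally have "ck F = ck (1 - P) * ck S" by (simp only: ck_compl_idem)
  then show ?thesis by (simp add: T_def ck_ops(1) 1) (simp add: ck_ops algebra_simps)
qed

text \<open>\<open>C\<close> is a left inverse of \<open>F\<close> on \<open>N\<close> modulo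
  compact operators.\<close>

lemma proper_T: "proper_on N T"
proof (rule proper_on_compact_perturbation)
  have "ck C * ck F = ck C * ck (1 - P) * ck S * ck (1 - P)" by (simp only: F_def ck_ops(4) mult.assoc)
  also have "ck C * ck (1 - P) = ck C" by (simp only: ck_compl) (metis CSC mult.assoc)
  also have "ck C * ck S * ck (1 - P) = ck (1 - P) * ck (1 - P)" by (simp only: comm[symmetric] ck_compl)
  finally have "ck (C * F) = ck (1 - P)" by (simp only: ck_compl_idem ck_ops(4))
  then show "cpt (C * F - (1 - P))" by (simp only: ck_eq_iff)
  show "C *\<^sub>V T *\<^sub>V x = x + (C * F - (1 - P)) *\<^sub>V x" if "x \<in> N" for x
    using that T_on_N[OF that] by simp
qed

lemma closed_range_T: "closed (app T ` N)"
  by (rule proper_closed_range[OF N proper_T])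

text \<open>\<open>(1 - P) * C\<close> is a right inverse modulo compact operators that maps into
  \<open>N\<close>.\<close>

lemma codim_T: "cfinite_codim N (app T ` N)"
proof (rule finite_codim_range[OF N(1) T_N closed_range_T])
  define L where "L = (1 - P) * C"
  have "ck (F * L * (1 - P)) = ck (1 - P) * ck S * ck ((1 - P) * (1 - P)) * ck C * ck (1 - P)"
    by (simp only: F_def L_def ck_ops(4) mult.assoc)
  also have "(1 - P) * (1 - P) = 1 - P" using PP by (simp add: algebra_simps)
  also have "ck (1 - P) * ck S * ck (1 - P) * ck C * ck (1 - P)
      = ck (1 - P) * (ck S * ck (1 - P)) * ck C * ck (1 - P)" by (simp only: mult.assoc)
  also have "\<dots> = ck (1 - P) * ck (1 - P) * (ck S * ck C) * ck (1 - P)"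
    by (simp only: ck_compl_commute[symmetric] mult.assoc)
  also have "\<dots> = ck (1 - P)" by (simp only: ck_compl[symmetric] ck_compl_idem)
  finally have "ck (F * L * (1 - P)) = ck (1 - P)" .
  then show "cpt (F * L * (1 - P) - (1 - P))" by (simp only: ck_eq_iff)
  fix x assume x: "x \<in> N"
  have LN: "L *\<^sub>V x \<in> N" using P_N by (simp add: L_def)
  have "x + (F * L * (1 - P) - (1 - P)) *\<^sub>V x = T *\<^sub>V L *\<^sub>V x"
    using x T_on_N[OF LN] by simp
  then show "x + (F * L * (1 - P) - (1 - P)) *\<^sub>V x \<in> app T ` N" using LN by blast
qed

lemma fredholm_T: "fredholm_on N (restrict (app T) N)"
  by (rule fredholm_onI[OF N T_N proper_T codim_T])

text \<open>\<open>Q\<close> commutes with \<open>P0\<close>, hence so does the inverse of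
  \<open>Q - scal z\<close>, which therefore restricts to \<open>M\<close>. The spectrum is defined
  through \<open>z - T\<close>, so the inverse enters with a minus sign.\<close>

lemma pseudo_B_fredholm_T:
  assumes inv: "\<And>z. z \<noteq> 0 \<Longrightarrow> \<exists>R. (Q - scal z) * R = 1 \<and> R * (Q - scal z) = 1" and QP0: "Q * P0 = Q"
  shows "app T \<in> \<P>\<B>\<F>"
proof -
  have "quasi_nilpotent (bounded_ops M) (restrict (app T) M)"
  proof (rule iffD2[OF quasi_nilpotent_restrict[OF M(1)]], erule T_M, intro allI impI)
    fix z :: complex assume "z \<noteq> 0"
    then obtain R where R: "(Q - scal z) * R = 1" "R * (Q - scal z) = 1" using inv by blast
    have c: "P0 * (Q - scal z) = (Q - scal z) * P0"
      by (simp add: right_diff_distrib left_diff_distrib P0Q QP0 scal_commute)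
    have "R * P0 * ((Q - scal z) * R) = R * (P0 * (Q - scal z)) * R" by (simp only: mult.assoc)
    also have "\<dots> = R * (Q - scal z) * (P0 * R)" by (simp only: c mult.assoc)
    finally have RP0: "R * P0 = P0 * R" by (simp add: R)
    have RM: "R *\<^sub>V x \<in> M" if "x \<in> M" for x
      using app_mult_cong[OF RP0, of x] proj_id[OF M that] proj_props(1)[OF M, of "R *\<^sub>V x"] by metis
    have R': "(- R) *\<^sub>V x \<in> M" if "x \<in> M" for x
      using RM[OF that] by simp
    have eq: "R *\<^sub>V (Q *\<^sub>V x - z *\<^sub>C x) = x" "Q *\<^sub>V R *\<^sub>V x - z *\<^sub>C (R *\<^sub>V x) = x" for x
      using arg_cong[OF R(1), of "\<lambda>T. T *\<^sub>V x"] arg_cong[OF R(2), of "\<lambda>T. T *\<^sub>V x"] by simp_all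
    show "\<exists>g\<in>carrier (bounded_ops M). \<forall>x\<in>M. g (z *\<^sub>C x - T *\<^sub>V x) = x \<and> z *\<^sub>C g x - T *\<^sub>V g x = x"
    proof (intro bexI ballI conjI)
      show "restrict (app (- R)) M \<in> carrier (bounded_ops M)" by (rule restrict_carrier[OF M(1) R'])
      fix x assume x: "x \<in> M"
      have "z *\<^sub>C x - T *\<^sub>V x \<in> M"
        by (rule csubspace_diff[OF M(1) subspaceD(3)[OF M(1) x] T_M[OF x]])
      then show "restrict (app (- R)) M (z *\<^sub>C x - T *\<^sub>V x) = x"
        using eq(1)[of x] T_on_M[OF x] by (simp add: algebra_simps del: mem_Collect_eq)
      show "z *\<^sub>C restrict (app (- R)) M x - T *\<^sub>V restrict (app (- R)) M x = x"
        using x eq(2)[of x] T_on_M[OF RM[OF x]] by (simp add: algebra_simps del: mem_Collect_eq)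
    qed
  qed
  moreover have "M \<inter> N = {0}" by auto
  moreover have "{x + y |x y. x \<in> M \<and> y \<in> N} = UNIV"
  proof -
    have "z \<in> {x + y |x y. x \<in> M \<and> y \<in> N}" for z
      by (intro CollectI exI[of _ "P *\<^sub>V z"] exI[of _ "(1 - P) *\<^sub>V z"] conjI P_M P_N) simp
    then show ?thesis by blast
  qed
  moreover have "app T ` M \<subseteq> M" "app T ` N \<subseteq> N" using T_M T_N by blast+
  ultimately show ?thesis
    unfolding pseudo_B_fredholm_def using app_carrier M N fredholm_T by blast
qed

text \<open>On \<open>M\<close> the operator is the nilpotent \<open>Q\<close>, so
  \<open>T ^ Suc m\<close> kills the component in \<open>M\<close>.\<close>

lemma T_power_range:
  assumes nil: "Q ^ Suc m = 0" shows "range (app (T ^ Suc m)) = app (T ^ Suc m) ` N"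
proof (intro equalityI subsetI)
  fix y assume "y \<in> range (app (T ^ Suc m))"
  then obtain x where x: "y = (T ^ Suc m) *\<^sub>V x" by blast
  have "(T ^ k) *\<^sub>V P *\<^sub>V x = (Q ^ k) *\<^sub>V P *\<^sub>V x \<and> (Q ^ k) *\<^sub>V P *\<^sub>V x \<in> M" for k
  proof (induction k)
    case (Suc k)
    then have k: "(T ^ k) *\<^sub>V P *\<^sub>V x = (Q ^ k) *\<^sub>V P *\<^sub>V x" "(Q ^ k) *\<^sub>V P *\<^sub>V x \<in> M" by blast+
    then show ?case using T_on_M[OF k(2)] Q_M[of "(Q ^ k) *\<^sub>V P *\<^sub>V x"] by simp
  qed (use P_M[of x] in simp)
  then have "(T ^ Suc m) *\<^sub>V P *\<^sub>V x = 0" using nil by (metis app_ops(1))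
  then have "y = (T ^ Suc m) *\<^sub>V (1 - P) *\<^sub>V x" unfolding x by (simp only: app_ops(2,4) app_simps(2)) simp
  then show "y \<in> app (T ^ Suc m) ` N" using P_N by blast
qed auto

text \<open>The exponent is \<open>Suc m\<close>. The range \<open>R\<close> then lies in
  \<open>N\<close> and inherits properness; applying \<open>T ^ Suc m\<close> to a finite complement
  of \<open>T N\<close> in \<open>N\<close> bounds the codimension in \<open>R\<close>.\<close>

lemma B_fredholm_T:
  assumes nil: "Q ^ Suc m = 0" shows "app T \<in> \<B>\<F>"
proof -
  define R where "R = app (T ^ Suc m) ` N"
  have R: "csubspace R" "closed R"
    unfolding R_def
    by (rule range_csubspace[OF N(1)], rule proper_closed_range[OF N proper_power[OF proper_T T_N]])
  have RN: "R \<subseteq> N" unfolding R_def using power_invariant[of N T, OF T_N] by blast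
  have sw: "T *\<^sub>V (T ^ Suc m) *\<^sub>V x = (T ^ Suc m) *\<^sub>V T *\<^sub>V x" for x
    by (rule app_mult_cong[OF power_commutes[symmetric]])
  have TR: "T *\<^sub>V x \<in> R" if xR: "x \<in> R" for x
  proof -
    obtain y where "y \<in> N" "x = (T ^ Suc m) *\<^sub>V y" using xR unfolding R_def by blast
    then show ?thesis using T_N[of y] unfolding R_def by (metis imageI sw)
  qed
  have pr: "proper_on R T" using proper_T RN unfolding proper_on_def by (meson subsetD)
  have "cfinite_codim R (app T ` R)"
  proof -
    obtain G where G: "finite G" "G \<subseteq> N" "N \<subseteq> cspan (app T ` N \<union> G)"
      using codim_T unfolding cfinite_codim_def by blast
    have "(T ^ Suc m) *\<^sub>V x \<in> cspan (app T ` R \<union> app (T ^ Suc m) ` G)" if "x \<in> N" for x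
    proof (rule cspan_image_subset)
      show "x \<in> cspan (app T ` N \<union> G)" using that G(3) by blast
      fix y assume "y \<in> app T ` N \<union> G"
      then have "(T ^ Suc m) *\<^sub>V y \<in> app T ` R \<union> app (T ^ Suc m) ` G"
      proof
        assume "y \<in> app T ` N"
        then obtain x where "x \<in> N" "y = T *\<^sub>V x" by blast
        then have "(T ^ Suc m) *\<^sub>V y \<in> app T ` R" unfolding R_def by (metis imageI sw)
        then show ?thesis ..
      qed blast
      then show "(T ^ Suc m) *\<^sub>V y \<in> cspan (app T ` R \<union> app (T ^ Suc m) ` G)" by (rule cv.span_base)
    qed
    then have "R \<subseteq> cspan (app T ` R \<union> app (T ^ Suc m) ` G)" by (subst R_def) blast
    moreover have "app (T ^ Suc m) ` G \<subseteq> R" using G(2) unfolding R_def by blast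
    ultimately show ?thesis unfolding cfinite_codim_def
      by (intro exI[of _ "app (T ^ Suc m) ` G"] conjI finite_imageI G(1))
  qed
  then have "fredholm_on R (restrict (app T) R)" by (intro fredholm_onI R TR pr)
  moreover have "range (app T ^^ Suc m) = R"
  proof -
    have "app T ^^ Suc m = app (T ^ Suc m)" by (rule ext) (simp only: app_power)
    then show ?thesis using T_power_range[OF nil] by (simp only: R_def)
  qed
  ultimately have "closed (range (app T ^^ Suc m)) \<and>
      fredholm_on (range (app T ^^ Suc m)) (restrict (app T) (range (app T ^^ Suc m)))"
    using R(2) by (simp only:)
  then show ?thesis unfolding B_fredholm_def using app_carrier by blast
qed

end

lemma lift_spectral_idempotent:
  fixes b c :: "'a::chilbert_space calkin"
  assumes "b * c = c * b" "c * b * c = c"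
  obtains S C P :: "'a bop" where "b = ck S" "c = ck C" "P * P = P" "ck P = 1 - b * c"
proof -
  obtain S C where SC: "b = ck S" "c = ck C" by (metis ck_surj)
  have "(1 - b * c) * (1 - b * c) = 1 - b * c"
    using assms(2) by (simp add: algebra_simps)
  then have "ck ((1 - S * C) * (1 - S * C)) = ck (1 - S * C)" by (simp add: SC ck_ops)
  then have "cpt ((1 - S * C) * (1 - S * C) - (1 - S * C))" by (simp only: ck_eq_iff)
  then obtain P where "P * P = P" "cpt (P - (1 - S * C))" by (rule lift_idempotent)
  then show ?thesis using that[OF SC] by (simp add: SC ck_ops flip: ck_eq_iff)
qed

text \<open>With \<open>p = 1 - b * c\<close> the class of \<open>A\<close> is
  \<open>b * p = - w\<close>, so \<open>A\<close> is a Riesz operator. It is multiplied by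
  \<open>P0\<close> on the right so that the orthogonal projection \<open>P0\<close> fixes its range
  and the West decomposition stays in that corner.\<close>

lemma lift_koliha_drazin:
  fixes b :: "'a::chilbert_space calkin"
  assumes "of_calkin b \<in> koliha_drazin_invertibles \<C>"
  obtains T :: "'a bop" where "ck T = b" "app T \<in> \<P>\<B>\<F>"
proof -
  obtain c w where w: "quasi_nil w" and bc: "b * c = c * b" "c * b * c = c" "b * c * b = b + w"
    using assms unfolding koliha_drazin_of_calkin by blast
  obtain S C P where SC: "b = ck S" "c = ck C" and P: "P * P = P" "ck P = 1 - b * c"
    using lift_spectral_idempotent[OF bc(1,2)] by blast
  define P0 where "P0 = proj {x. P *\<^sub>V x = x}"
  have M: "csubspace {x. P *\<^sub>V x = x}" "closed {x. P *\<^sub>V x = x}" by (rule fix_csubspace, rule fix_closed)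
  have oP0: "orth_proj P0" unfolding P0_def by (rule orth_proj_proj[OF M])
  have P0P: "P0 * P = P"
    unfolding P0_def by (rule bop_eqI) (use app_mult_cong[of P P P 1] P(1) in \<open>simp add: proj_id[OF M]\<close>)
  define A where "A = P * S * P"
  have "(1 - b * c) * b = - w" using bc(3) by (simp add: left_diff_distrib)
  moreover have "b * (b * c) = b * c * b" by (metis bc(1) mult.assoc)
  then have "b * (1 - b * c) = (1 - b * c) * b" by (simp add: left_diff_distrib right_diff_distrib)
  moreover have "ck P * ck P = ck P" using P(1) by (simp flip: ck_ops)
  ultimately have ckA: "ck A = - w" unfolding A_def ck_ops(4) SC(1)[symmetric] P(2) by (metis mult.assoc)
  have "riesz A"
  proof (rule rieszI)
    fix z :: complex assume "z \<noteq> 0"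
    then obtain v where v: "v * (csc (- z) - w) = 1" "(csc (- z) - w) * v = 1"
      using w unfolding quasi_nil_def by (metis neg_equal_0_iff_equal)
    have "csc z - ck A = - (csc (- z) - w)" by (simp add: ckA csc_simps)
    then show "\<exists>v. v * (csc z - ck A) = 1 \<and> (csc z - ck A) * v = 1"
      using v by (intro exI[of _ "- v"]) (simp only: minus_mult_minus simp_thms)
  qed
  moreover have P0A: "P0 * A = A" unfolding A_def using P0P by (metis mult.assoc)
  ultimately have r: "riesz (A * P0)" by (rule riesz_restrict[OF _ oP0])
  have P0A': "P0 * (A * P0) = A * P0" using P0A by (metis mult.assoc)
  obtain D where D: "cpt D" "\<And>P1. orth_proj P1 \<Longrightarrow> P1 * (A * P0) = A * P0 \<Longrightarrow> P1 * D = D \<and> D * P1 = D"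
    "\<And>\<mu>. \<mu> \<noteq> 0 \<Longrightarrow> \<exists>R. (A * P0 - D - scal \<mu>) * R = 1 \<and> R * (A * P0 - D - scal \<mu>) = 1"
    using west_decomposition[OF r] by blast
  note DP = D(2)[OF oP0 P0A']
  interpret calkin_splitting S C P "A * P0 - D"
  proof
    show "ck S * ck C = ck C * ck S" "ck C * ck S * ck C = ck C" "ck P = 1 - ck S * ck C"
      using bc P(2) by (simp_all add: SC)
    show "proj {x. P *\<^sub>V x = x} * (A * P0 - D) = A * P0 - D"
      unfolding P0_def[symmetric] by (simp add: right_diff_distrib P0A' DP)
    show "ck (A * P0 - D) = ck (P * S * P * proj {x. P *\<^sub>V x = x})"
      using D(1) unfolding P0_def[symmetric] A_def[symmetric] by (simp add: ck_ops(2) flip: ck_eq_0_iff)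
  qed (rule P(1))
  have "app T \<in> \<P>\<B>\<F>"
  proof (rule pseudo_B_fredholm_T[OF D(3)])
    show "(A * P0 - D) * proj {x. P *\<^sub>V x = x} = A * P0 - D"
      unfolding P0_def[symmetric] by (simp add: left_diff_distrib mult.assoc DP orth_projD(1)[OF oP0])
  qed
  then show ?thesis using that ck_T SC(1) by blast
qed

text \<open>With \<open>p = 1 - b * c\<close>, the power \<open>b ^ m * p\<close> vanishes and
  \<open>A\<close> has class \<open>b * p\<close>. Since \<open>P0 * A = A\<close>, multiplying by
  \<open>P0\<close> on the right preserves nilpotency and moves \<open>A\<close> into an orthogonal
  corner, where the nilpotent lift applies.\<close>

lemma lift_drazin:
  fixes b :: "'a::chilbert_space calkin"
  assumes "of_calkin b \<in> drazin_invertibles \<C>"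
  obtains T :: "'a bop" where "ck T = b" "app T \<in> \<B>\<F>"
proof -
  obtain c m where bc: "b * c = c * b" "c * b * c = c" and m: "b ^ m * c * b = b ^ m"
    using assms unfolding drazin_of_calkin by blast
  obtain S C P where SC: "b = ck S" "c = ck C" and P: "P * P = P" "ck P = 1 - b * c"
    using lift_spectral_idempotent[OF bc] by blast
  define P0 where "P0 = proj {x. P *\<^sub>V x = x}"
  have M: "csubspace {x. P *\<^sub>V x = x}" "closed {x. P *\<^sub>V x = x}" by (rule fix_csubspace, rule fix_closed)
  have oP0: "orth_proj P0" unfolding P0_def by (rule orth_proj_proj[OF M])
  have P0P: "P0 * P = P"
    unfolding P0_def by (rule bop_eqI) (use app_mult_cong[of P P P 1] P(1) in \<open>simp add: proj_id[OF M]\<close>)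
  define A where "A = P * S * P"
  define p where "p = ck P"
  have "b * (b * c) = b * c * b" by (metis bc(1) mult.assoc)
  then have bp: "b * p = p * b" by (simp add: p_def P(2) left_diff_distrib right_diff_distrib)
  have pp: "p * p = p" using P(1) by (simp add: p_def flip: ck_ops)
  have ckA: "ck A = b * p" unfolding A_def ck_ops(4) SC(1)[symmetric] p_def[symmetric] bp[symmetric]
    by (simp add: mult.assoc pp)
  have "ck A ^ Suc k = b ^ Suc k * p" for k
  proof (induction k)
    case (Suc k)
    have "ck A ^ Suc (Suc k) = b * p * (b ^ Suc k * p)" by (metis Suc ckA power_Suc)
    also have "\<dots> = b * (p * b ^ Suc k) * p" by (simp only: mult.assoc)
    also have "p * b ^ Suc k = b ^ Suc k * p" using power_commuting_commutes[OF bp] by metis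
    finally show ?case by (simp only: power_Suc[of b "Suc k"] mult.assoc pp)
  qed (simp add: ckA)
  \<comment> \<open>The exponent is raised by one because powers of \<open>b * p\<close> have the
    form \<open>b ^ k * p\<close> only for positive \<open>k\<close>.\<close>
  moreover have "b ^ Suc m * p = 0"
  proof -
    have "b ^ m * p = 0" using m by (simp add: p_def P(2) right_diff_distrib bc(1) mult.assoc)
    then show ?thesis by (simp add: mult.assoc)
  qed
  ultimately have nilA: "ck A ^ Suc m = 0" by simp
  have P0A: "P0 * A = A" unfolding A_def using P0P by (metis mult.assoc)
  have "(A * P0) ^ Suc k = A ^ Suc k * P0" for k
  proof (induction k)
    case (Suc k)
    have "(A * P0) ^ Suc (Suc k) = A * (P0 * A) * (A ^ k * P0)"
      using Suc by (simp add: mult.assoc)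
    then show ?case by (simp add: P0A mult.assoc)
  qed simp
  from this[of m] have "ck (A * P0) ^ Suc m = ck A ^ Suc m * ck P0" by (metis ck_ops(4) ck_power)
  then have nil: "ck (A * P0) ^ Suc m = 0" using nilA by simp
  have P0A': "P0 * (A * P0) = A * P0" "A * P0 * P0 = A * P0"
    using P0A orth_projD(1)[OF oP0] by (metis mult.assoc)+
  obtain Q where Q: "P0 * Q = Q" "Q * P0 = Q" "ck Q = ck (A * P0)" "Q ^ Suc m = 0"
    using lift_nilpotent[OF oP0 P0A' nil] by blast
  interpret calkin_splitting S C P Q
  proof
    show "ck S * ck C = ck C * ck S" "ck C * ck S * ck C = ck C" "ck P = 1 - ck S * ck C"
      using bc P(2) by (simp_all add: SC)
    show "proj {x. P *\<^sub>V x = x} * Q = Q" using Q(1) by (simp only: P0_def)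
    show "ck Q = ck (P * S * P * proj {x. P *\<^sub>V x = x})" using Q(3) by (simp only: P0_def A_def)
  qed (rule P(1))
  show ?thesis using that ck_T SC(1) B_fredholm_T[OF Q(4)] by blast
qed

text \<open>Serves both parts: lifting representatives gives the image, and two operators of equal
  class differ by a compact one, which gives the preimage.\<close>

lemma calkin_image_vimage:
  fixes X :: "('a \<Rightarrow> 'a::chilbert_space) set"
  assumes X: "X \<subseteq> carrier \<L>" and E: "\<And>x. of_calkin x \<in> E \<longleftrightarrow> (\<exists>T. ck T = x \<and> app T \<in> X)" "E \<subseteq> carrier \<C>"
  shows "\<pi>\<^sub>C ` X = E \<and> \<pi>\<^sub>C -` E \<inter> carrier \<L> = X <+>\<^bsub>\<L>\<^esub> \<K>"
proof
  have Bop: "app (Bop f) = f" if "f \<in> carrier \<L>" for f :: "'a \<Rightarrow> 'a" using that by (rule app_Bop)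
  have mem: "\<pi>\<^sub>C (app S) \<in> E \<longleftrightarrow> (\<exists>T. ck T = ck S \<and> app T \<in> X)" for S
    unfolding of_calkin_ck[symmetric] by (rule E(1))
  show "\<pi>\<^sub>C ` X = E"
  proof (intro equalityI subsetI)
    fix y assume "y \<in> \<pi>\<^sub>C ` X"
    then obtain f where f: "f \<in> X" "y = \<pi>\<^sub>C f" by blast
    then have "f = app (Bop f)" using X Bop by (metis subsetD)
    then show "y \<in> E" using f mem[of "Bop f"] by metis
  next
    fix y assume y: "y \<in> E"
    then obtain x where x: "y = of_calkin x" using E(2) carrier_calkin by blast
    then obtain T where "ck T = x" "app T \<in> X" using y E(1) by blast
    then show "y \<in> \<pi>\<^sub>C ` X" using x of_calkin_ck by blast
  qed
  show "\<pi>\<^sub>C -` E \<inter> carrier \<L> = X <+>\<^bsub>\<L>\<^esub> \<K>"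
  proof (intro equalityI subsetI)
    fix f assume "f \<in> \<pi>\<^sub>C -` E \<inter> carrier \<L>"
    then have f: "\<pi>\<^sub>C (app (Bop f)) \<in> E" "f = app (Bop f)" using Bop by auto
    then obtain T where T: "ck T = ck (Bop f)" "app T \<in> X" using mem by blast
    have "cpt (Bop f - T)" using T(1) by (metis ck_eq_iff)
    moreover have "f = app T \<oplus>\<^bsub>\<L>\<^esub> app (Bop f - T)"
      using f(2) by (simp flip: app_eq_ops(1))
    ultimately show "f \<in> X <+>\<^bsub>\<L>\<^esub> \<K>" using T(2) unfolding set_add_def' cpt_def by blast
  next
    fix f assume "f \<in> X <+>\<^bsub>\<L>\<^esub> \<K>"
    then obtain g k where gk: "g \<in> X" "k \<in> \<K>" "f = g \<oplus>\<^bsub>\<L>\<^esub> k" unfolding set_add_def' by blast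
    have g: "app (Bop g) = g" using gk(1) X Bop by blast
    have k: "app (Bop k) = k" using gk(2) Bop by (auto simp: compact_ops_def)
    have f: "f = app (Bop g + Bop k)" by (simp add: app_eq_ops(1) g k gk(3))
    have "cpt (Bop k)" using gk(2) k by (simp add: cpt_def)
    then have "ck (Bop g + Bop k) = ck (Bop g)" by (simp add: ck_ops flip: ck_eq_0_iff)
    then have "\<pi>\<^sub>C f \<in> E" unfolding f mem using gk(1) g by metis
    then show "f \<in> \<pi>\<^sub>C -` E \<inter> carrier \<L>" using app_carrier f by auto
  qed
qed

theorem theorem3p12:
  assumes "\<not> cfinite_dim (UNIV :: 'a::chilbert_space set)"
  shows "(\<pi>\<^sub>C ` (\<P>\<B>\<F> :: ('a \<Rightarrow> 'a) set) = koliha_drazin_invertibles \<C> \<and>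
      \<pi>\<^sub>C -` koliha_drazin_invertibles \<C> \<inter> carrier \<L> = (\<P>\<B>\<F> :: ('a \<Rightarrow> 'a) set) <+>\<^bsub>\<L>\<^esub> \<K>) \<and>
    (\<pi>\<^sub>C ` (\<B>\<F> :: ('a \<Rightarrow> 'a) set) = drazin_invertibles \<C> \<and>
      \<pi>\<^sub>C -` drazin_invertibles \<C> \<inter> carrier \<L> = (\<B>\<F> :: ('a \<Rightarrow> 'a) set) <+>\<^bsub>\<L>\<^esub> \<K>)"
proof (intro conjI[OF calkin_image_vimage calkin_image_vimage])
  show "(\<P>\<B>\<F> :: ('a \<Rightarrow> 'a) set) \<subseteq> carrier \<L>" "(\<B>\<F> :: ('a \<Rightarrow> 'a) set) \<subseteq> carrier \<L>"
    unfolding pseudo_B_fredholm_def B_fredholm_def by blast+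
  show "of_calkin x \<in> koliha_drazin_invertibles \<C> \<longleftrightarrow> (\<exists>T. ck T = x \<and> app T \<in> \<P>\<B>\<F>)" for x :: "'a calkin"
    using pseudo_B_fredholm_koliha_drazin lift_koliha_drazin[of x] by metis
  show "of_calkin x \<in> drazin_invertibles \<C> \<longleftrightarrow> (\<exists>T. ck T = x \<and> app T \<in> \<B>\<F>)" for x :: "'a calkin"
    using B_fredholm_drazin lift_drazin[of x] by metis
qed (auto simp: koliha_drazin_invertibles_def drazin_invertibles_def)

end
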